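(* Let $p\in\mathbb{Z}[x]$ be a monic polynomial of degree $d\ge2$. Given $T>0$, let $a\in L^1_x(\mathbb{T};L^\infty_t([0,T]))$. Then there exists a constant $C>0$ such that $$\int_0^T\int_{\mathbb{T}}|a(t,x)|\,|e^{itP(D)}u_0(x)|^2\,dx\,dt\le C\|u_0\|^2_{L^2(\mathbb{T})},\qquad\forall u_0\in L^2(\mathbb{T}).$$ If, in addition, $\|a\|_{L^1_x(\mathbb{T};L^\infty_t([0,T]))}>0$, then there exists $C'>0$ such that $$\|u_0\|^2_{L^2(\mathbb{T})}\le C'\int_0^T\int_{\mathbb{T}}|a(t,x)|\,|e^{itP(D)}u_0(x)|^2\,dx\,dt,\qquad\forall u_0\in L^2(\mathbb{T}).$$
   Context: $\mathbb{T}=\mathbb{R}/2\pi\mathbb{Z}$. $P(D)$ is the Fourier multiplier $\widehat{P(D)u}(k)=p(k)\widehat u(k)$, $k\in\mathbb{Z}$, with $\widehat u(k)=\frac1{2\pi}\int_0^{2\pi}u(x)e^{-ikx}dx$; thus $e^{itP(D)}u_0=\sum_{k\in\mathbb{Z}}\widehat{u_0}(k)e^{i(kx+p(k)t)}$ is the solution of $\partial_tu=iP(D)u$, $u(0,\cdot)=u_0$. The space $L^1_x(\mathbb{T};L^\infty_t([0,T]))$ has norm $\int_{\mathbb{T}}\operatorname{ess\,sup}_{t\in[0,T]}|a(t,x)|\,dx$. *)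

theory Defs
  imports
    "HOL-Probability.Essential_Supremum"
    "HOL-Computational_Algebra.Polynomial"
begin

text \<open>
  A function on the torus \<open>\<real>/2\<pi>\<int>\<close> is given by its restriction to the fundamental domain
  \<open>[0, 2\<pi>]\<close>, carrying Lebesgue measure of total mass \<open>2\<pi>\<close>. Both endpoints represent the same
  point, which is harmless as all notions below ignore null sets. Elements of function
  spaces are represented by functions rather than by classes modulo null sets.
\<close>

abbreviation torus :: "real measure" where
  "torus \<equiv> lebesgue_on {0..2 * pi}"

definition L2_torus :: "(real \<Rightarrow> complex) set" where
  "L2_torus = {u \<in> borel_measurable torus. integrable torus (\<lambda>x. (cmod (u x))\<^sup>2)}"

definition L2_norm :: "(real \<Rightarrow> complex) \<Rightarrow> real" where
  "L2_norm u = sqrt (\<integral>x. (cmod (u x))\<^sup>2 \<partial>torus)"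

definition fourier_coeff :: "(real \<Rightarrow> complex) \<Rightarrow> int \<Rightarrow> complex" where
  "fourier_coeff u k = 1 / (2 * pi) * (\<integral>x. u x * exp (- \<i> * of_int k * of_real x) \<partial>torus)"

definition propagator_partial_sum ::
    "int poly \<Rightarrow> (real \<Rightarrow> complex) \<Rightarrow> nat \<Rightarrow> real \<Rightarrow> real \<Rightarrow> complex" where
  "propagator_partial_sum p u0 N t x =
     (\<Sum>k = - int N..int N. fourier_coeff u0 k *
        exp (\<i> * (of_int k * of_real x + of_int (poly p k) * of_real t)))"

text \<open>
  For square integrable data the series defining \<open>e\<^sup>i\<^sup>t\<^sup>P\<^sup>(\<^sup>D\<^sup>) u0\<close> converges in \<open>L\<^sup>2\<close> of the torus for
  every \<open>t\<close>, so its sum is determined only up to null sets. The following predicate says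
  that \<open>(t, x) \<mapsto> u t x\<close> is a version of it on \<open>[0, T]\<close> that is jointly measurable. Any two
  versions agree almost everywhere on \<open>[0, T] \<times> [0, 2\<pi>]\<close>.
\<close>

definition is_propagator ::
    "int poly \<Rightarrow> real \<Rightarrow> (real \<Rightarrow> complex) \<Rightarrow> (real \<Rightarrow> real \<Rightarrow> complex) \<Rightarrow> bool" where
  "is_propagator p T u0 u \<longleftrightarrow>
     (\<lambda>(t, x). u t x) \<in> borel_measurable (lebesgue_on ({0..T} \<times> {0..2 * pi})) \<and>
     (\<forall>t\<in>{0..T}. u t \<in> L2_torus \<and>
        (\<lambda>N. L2_norm (\<lambda>x. u t x - propagator_partial_sum p u0 N t x)) \<longlonglongrightarrow> 0)"

definition L1_Linf_norm :: "real \<Rightarrow> (real \<Rightarrow> real \<Rightarrow> complex) \<Rightarrow> ennreal" where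
  "L1_Linf_norm T a =
     (\<integral>\<^sup>+x. esssup (lebesgue_on {0..T}) (\<lambda>t. ennreal (cmod (a t x))) \<partial>torus)"

definition L1_Linf :: "real \<Rightarrow> (real \<Rightarrow> real \<Rightarrow> complex) set" where
  "L1_Linf T = {a. (\<lambda>(t, x). a t x) \<in> borel_measurable (lebesgue_on ({0..T} \<times> {0..2 * pi})) \<and>
     L1_Linf_norm T a < \<infinity>}"

definition weighted_integral ::
    "real \<Rightarrow> (real \<Rightarrow> real \<Rightarrow> complex) \<Rightarrow> (real \<Rightarrow> real \<Rightarrow> complex) \<Rightarrow> ennreal" where
  "weighted_integral T a u =
     (\<integral>\<^sup>+t. (\<integral>\<^sup>+x. ennreal (cmod (a t x) * (cmod (u t x))\<^sup>2) \<partial>torus) \<partial>lebesgue_on {0..T})"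

end

(*
  Write e_k(t, x) = exp(i(kx + p(k)t)). Since p has degree d >= 2, a given nonzero difference
  (k - l, p(k) - p(l)) occurs for at most d pairs. Hence, for a set F of positive measure in a
  box of side 2 pi, Bessel's inequality shows that the Gram matrix of the e_k in L2(F) is |F|
  times the identity plus a Hilbert-Schmidt operator (Zygmund). So the L2(F) norm controls the
  coefficients of a sum having, besides modes |k| > L, at most one mode |k| <= L.

  A low mode k0 of a sum f on a given set E is observed as follows. Small translations in x
  minus suitable constants remove all other modes in [-L, L] and keep k0. To have L available
  before the translations are chosen, F is the limit of a sequence E = G_0, G_1, ... where
  G_(j+1) and its translate by s_j lie in G_j, with s_j -> 0; no unique continuation theorem
  is needed. Controlling the low modes then controls the high ones.

  A weight a with positive norm exceeds a positive constant on such a set E, which gives the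
  lower bound. The upper bound is an L-infinity in x, L2 in t estimate: p takes each value at
  most d times, so the integral of |f(t, x)|^2 over whole periods in t is bounded by the sum of
  the |c_k|^2, for every x.
*)

theory Submission
  imports Defs
begin

section \<open>Level sets of polynomials and exponential sums\<close>

text \<open>The obstacle is a circle: separating the modes \<open>\<bar>k\<bar> \<le> L\<close> by a
  translation by \<open>s\<close> needs \<open>s\<close> small against \<open>1 / L\<close>,
  removing them shrinks the observation set, and \<open>L\<close> depends on the final set through
  the tail of a convergent series without a known rate. An infinite chain breaks the circle: only
  finitely many late links are used, and all sets of the chain contain the limit. The sets live in
  the plane, so no wrap-around occurs. Translations are in \<open>x\<close> because
  \<open>cis (k * s)\<close> separates all small \<open>k\<close>, whereas translations in time
  would not separate modes with equal values of \<open>p\<close>. All spectral estimates concern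
  finite sums, with constants independent of the index set. The passage to \<open>u\<close> needs
  Parseval's identity for \<open>u0\<close>, hence completeness of the trigonometric system, and an
  error bound for the partial sums that is uniform in \<open>t\<close>.\<close>

lemma card_level_set_le:
  fixes p :: "int poly"
  assumes "degree p > 0"
  shows "finite {k. poly p k = n}" "card {k. poly p k = n} \<le> degree p"
proof -
  let ?q = "p - [:n:]"
  have deg: "degree ?q = degree p"
    using assms degree_add_eq_left[of "- [:n:]" p]
    by (simp only: degree_minus diff_conv_add_uminus) simp
  then have "?q \<noteq> 0" using assms by auto
  moreover have "{k. poly ?q k = 0} = {k. poly p k = n}" by auto
  ultimately show "finite {k. poly p k = n}" "card {k. poly p k = n} \<le> degree p"
    using poly_roots_finite[of ?q] card_poly_roots_bound[of ?q] deg by auto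
qed

text \<open>
  This is where degree at least \<open>2\<close> enters: if \<open>p (x + m) - p x = n\<close> identically, then \<open>p\<close> is
  affine along the progression \<open>m\<int>\<close>.
\<close>

lemma card_difference_level_set_le:
  fixes p :: "int poly"
  assumes deg: "degree p \<ge> 2" and "m \<noteq> 0"
  shows "finite {k. poly p (k + m) - poly p k = n}"
    "card {k. poly p (k + m) - poly p k = n} \<le> degree p"
proof -
  define q where "q = pcompose p [:m, 1:] - p - [:n:]"
  have eval: "poly q k = poly p (k + m) - poly p k - n" for k
    by (simp add: q_def poly_pcompose add.commute)
  have "q \<noteq> 0"
  proof
    assume "q = 0"
    then have step: "poly p (k + m) = poly p k + n" for k
      using eval[of k] by simp
    have affine: "poly p (int j * m) = poly p 0 + int j * n" for j
    proof (induction j)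
      case (Suc j)
      have "int (Suc j) * m = int j * m + m" by (simp add: algebra_simps)
      then show ?case using step[of "int j * m"] Suc by (simp add: algebra_simps)
    qed simp
    \<comment> \<open>This is \<open>p (m * x)\<close> minus the affine function found above: it
      vanishes at every natural number, yet its degree is that of \<open>p\<close>, at least
      2.\<close>
    define r where "r = pcompose p [:0, m:] - [:poly p 0, n:]"
    have "degree (pcompose p [:0, m:]) = degree p"
      using \<open>m \<noteq> 0\<close> by (simp add: degree_pcompose)
    moreover have "degree [:poly p 0, n:] \<le> 1" by simp
    ultimately have "degree r = degree p"
      unfolding r_def using deg degree_add_eq_left[of "- [:poly p 0, n:]" "pcompose p [:0, m:]"]
      by (simp only: degree_minus diff_conv_add_uminus)
    then have "r \<noteq> 0" using deg by auto
    then have "finite {k. poly r k = 0}" by (rule poly_roots_finite)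
    moreover have "range int \<subseteq> {k. poly r k = 0}"
      using affine by (auto simp: r_def poly_pcompose algebra_simps)
    ultimately have "finite (range int)" by (rule finite_subset[rotated])
    then show False using finite_imageD[of int UNIV] by simp
  qed
  moreover have "degree q \<le> degree p"
    unfolding q_def
    by (intro degree_diff_le) (auto intro: order_trans[OF degree_pcompose_le])
  moreover have "{k. poly q k = 0} = {k. poly p (k + m) - poly p k = n}"
    using eval by auto
  ultimately show "finite {k. poly p (k + m) - poly p k = n}"
    "card {k. poly p (k + m) - poly p k = n} \<le> degree p"
    using poly_roots_finite[of q] card_poly_roots_bound[of q] by auto
qed

section \<open>Squared moduli of finite sums\<close>

lemma cmod_sum_mult_squared:
  fixes c \<phi> :: "'i \<Rightarrow> complex"
  shows "complex_of_real ((cmod (\<Sum>i\<in>I. c i * \<phi> i))\<^sup>2)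
    = (\<Sum>i\<in>I. \<Sum>j\<in>I. c i * cnj (c j) * (\<phi> i * cnj (\<phi> j)))"
  unfolding complex_norm_square cnj_sum sum_product
  by (intro sum.cong refl) (simp add: mult_ac)

lemma cis_eq_small:
  assumes "cis a = cis b" "\<bar>a - b\<bar> < 2 * pi"
  shows "a = b"
proof -
  have "cis (a - b) = 1" using assms(1) by (simp add: cis_divide[symmetric])
  then have "cos (a - b) = 1" by (metis cis.simps(1) one_complex.sel(1))
  then obtain n :: int where n: "a - b = of_int n * 2 * pi" by (auto simp: cos_one_2pi_int)
  then have "\<bar>of_int n :: real\<bar> * (2 * pi) < 1 * (2 * pi)" using assms(2) by (simp add: abs_mult)
  then have "n = 0" using pi_gt_zero by (simp only: mult_less_cancel_right) linarith
  then show ?thesis using n by simp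
qed

lemma cmod_add_squared_le: "(cmod (z + w))\<^sup>2 \<le> 2 * (cmod z)\<^sup>2 + 2 * (cmod w)\<^sup>2"
proof -
  have "(cmod (z + w))\<^sup>2 \<le> (cmod z + cmod w)\<^sup>2"
    by (intro power_mono norm_triangle_ineq) auto
  also have "\<dots> \<le> 2 * (cmod z)\<^sup>2 + 2 * (cmod w)\<^sup>2"
    using zero_le_power2[of "cmod z - cmod w"]
    by (simp add: power2_sum power2_diff)
  finally show ?thesis .
qed

lemma cmod_sum_squared_le:
  "(cmod (\<Sum>i\<in>I. f i))\<^sup>2 \<le> real (card I) * (\<Sum>i\<in>I. (cmod (f i))\<^sup>2)"
proof -
  have "(cmod (\<Sum>i\<in>I. f i))\<^sup>2 \<le> (\<Sum>i\<in>I. cmod (f i))\<^sup>2"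
    by (intro power_mono norm_sum) auto
  also have "\<dots> \<le> real (card I) * (\<Sum>i\<in>I. (cmod (f i))\<^sup>2)"
    using sum_squared_le_sum_of_squares[of "\<lambda>i. cmod (f i)" I] 
    by (simp add: mult.commute)
  finally show ?thesis .
qed

text \<open>Stated for arbitrary functions and measures because it serves three times: for the Gram
  matrix on a set of the plane, for time integrals at a fixed point, and for orthogonality on the
  torus.\<close>

lemma integral_cmod_sum_squared:
  fixes c :: "'i \<Rightarrow> complex" and \<phi> :: "'i \<Rightarrow> 'a \<Rightarrow> complex"
  assumes int: "\<And>i j. i \<in> I \<Longrightarrow> j \<in> I \<Longrightarrow> integrable M (\<lambda>x. \<phi> i x * cnj (\<phi> j x))"
  shows "integrable M (\<lambda>x. (cmod (\<Sum>i\<in>I. c i * \<phi> i x))\<^sup>2)"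
    "complex_of_real (\<integral>x. (cmod (\<Sum>i\<in>I. c i * \<phi> i x))\<^sup>2 \<partial>M)
      = (\<Sum>i\<in>I. \<Sum>j\<in>I. c i * cnj (c j) * (\<integral>x. \<phi> i x * cnj (\<phi> j x) \<partial>M))"
proof -
  have "integrable M (\<lambda>x. complex_of_real ((cmod (\<Sum>i\<in>I. c i * \<phi> i x))\<^sup>2))"
    unfolding cmod_sum_mult_squared
    by (intro Bochner_Integration.integrable_sum integrable_mult_right int)
  then show "integrable M (\<lambda>x. (cmod (\<Sum>i\<in>I. c i * \<phi> i x))\<^sup>2)"
    by (simp only: complex_of_real_integrable_eq)
  have "complex_of_real (\<integral>x. (cmod (\<Sum>i\<in>I. c i * \<phi> i x))\<^sup>2 \<partial>M)
     = (\<integral>x. complex_of_real ((cmod (\<Sum>i\<in>I. c i * \<phi> i x))\<^sup>2) \<partial>M)"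
    by (rule integral_complex_of_real[symmetric])
  also have "\<dots> = (\<Sum>i\<in>I. \<Sum>j\<in>I. \<integral>x. c i * cnj (c j) * (\<phi> i x * cnj (\<phi> j x)) \<partial>M)"
    unfolding cmod_sum_mult_squared using int
    by (subst Bochner_Integration.integral_sum;
        (intro Bochner_Integration.integrable_sum integrable_mult_right sum.cong refl)?)
       (auto simp: Bochner_Integration.integral_sum)
  also have "\<dots> = (\<Sum>i\<in>I. \<Sum>j\<in>I. c i * cnj (c j) * (\<integral>x. \<phi> i x * cnj (\<phi> j x) \<partial>M))"
    by simp
  finally show "complex_of_real (\<integral>x. (cmod (\<Sum>i\<in>I. c i * \<phi> i x))\<^sup>2 \<partial>M)
      = (\<Sum>i\<in>I. \<Sum>j\<in>I. c i * cnj (c j) * (\<integral>x. \<phi> i x * cnj (\<phi> j x) \<partial>M))" .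
qed

text \<open>A point is \<open>(t, x)\<close> whereas a frequency is (space frequency, time frequency).\<close>

definition expo :: "int \<times> int \<Rightarrow> real \<times> real \<Rightarrow> complex" where
  "expo \<nu> z = cis (of_int (fst \<nu>) * snd z + of_int (snd \<nu>) * fst z)"

lemma cmod_expo [simp]: "cmod (expo \<nu> z) = 1"
  by (simp add: expo_def)

lemma expo_mult_cnj: "expo \<nu> z * cnj (expo \<mu> z) = expo (\<nu> - \<mu>) z"
  by (simp add: expo_def cis_cnj cis_mult algebra_simps)

lemma expo_zero [simp]: "expo 0 z = 1"
  by (simp add: expo_def)

lemma continuous_on_expo [continuous_intros]:
  "continuous_on S f \<Longrightarrow> continuous_on S (\<lambda>z. expo \<nu> (f z))"
  unfolding expo_def by (intro continuous_intros)

lemma borel_measurable_expo [measurable]: "expo \<nu> \<in> borel_measurable borel"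
  by (intro borel_measurable_continuous_onI continuous_intros)

text \<open>Up to sign and normalisation, the Fourier transform of the indicator function of
  \<open>G\<close> at integer frequencies. By \<open>expo_mult_cnj\<close> the Gram matrix of the
  exponentials depends only on frequency differences.\<close>

definition gram :: "(real \<times> real) set \<Rightarrow> int \<times> int \<Rightarrow> complex" where
  "gram G \<nu> = (LINT z:G|lborel. expo \<nu> z)"

text \<open>The frequency map \<open>f\<close> admits both uses: \<open>id\<close> on arbitrary
  frequencies for Bessel's inequality, and \<open>mode p\<close> on integers for solutions of the
  equation.\<close>

definition energy :: "(real \<times> real) set \<Rightarrow> ('i \<Rightarrow> int \<times> int) \<Rightarrow> 'i set \<Rightarrow> ('i \<Rightarrow> complex) \<Rightarrow> real" where
  "energy G f I c = (LINT z:G|lborel. (cmod (\<Sum>i\<in>I. c i * expo (f i) z))\<^sup>2)"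

definition fin_meas :: "'a::euclidean_space set \<Rightarrow> bool" where
  "fin_meas G \<longleftrightarrow> G \<in> sets borel \<and> emeasure lborel G < \<infinity>"

lemma set_integrable_bounded:
  fixes f :: "'a::euclidean_space \<Rightarrow> 'b::{banach, second_countable_topology}"
  assumes "fin_meas G" and [measurable]: "f \<in> borel_measurable borel" and "\<And>z. norm (f z) \<le> B"
  shows "set_integrable lborel G f"
  unfolding set_integrable_def
proof (rule Bochner_Integration.integrable_bound)
  have [measurable]: "G \<in> sets borel" using assms by (simp add: fin_meas_def)
  show "integrable lborel (\<lambda>z. B *\<^sub>R indicator G z :: real)"
    using assms by (intro integrable_scaleR_right) (auto simp: fin_meas_def)
  show "(\<lambda>x. indicat_real G x *\<^sub>R f x) \<in> borel_measurable lborel" by measurable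
  show "AE x in lborel. norm (indicat_real G x *\<^sub>R f x) \<le> norm (B *\<^sub>R indicator G x :: real)"
    using assms(3) by (intro AE_I2) (auto simp: indicator_def intro: order_trans[OF _ abs_ge_self])
qed

lemma set_integrable_expo: "fin_meas G \<Longrightarrow> set_integrable lborel G (expo \<nu>)"
  by (rule set_integrable_bounded[where B = 1]) auto

lemma set_integrable_energy:
  "fin_meas G \<Longrightarrow> set_integrable lborel G (\<lambda>z. (cmod (\<Sum>i\<in>I. c i * expo (f i) z))\<^sup>2)"
proof (rule set_integrable_bounded[where B = "(\<Sum>i\<in>I. cmod (c i))\<^sup>2"])
  show "norm ((cmod (\<Sum>i\<in>I. c i * expo (f i) z))\<^sup>2) \<le> (\<Sum>i\<in>I. cmod (c i))\<^sup>2" for z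
    by (auto intro!: power_mono order_trans[OF norm_sum] simp: norm_mult)
qed auto

lemma energy_expansion:
  assumes "fin_meas G"
  shows "complex_of_real (energy G f I c) = (\<Sum>i\<in>I. \<Sum>j\<in>I. c i * cnj (c j) * gram G (f i - f j))"
proof -
  have [measurable]: "G \<in> sets lborel" using assms by (simp add: fin_meas_def)
  let ?M = "restrict_space lborel G"
  have "integrable ?M (\<lambda>z. expo (f i) z * cnj (expo (f j) z))" for i j
    unfolding expo_mult_cnj using set_integrable_expo[OF assms, of "f i - f j"]
    using \<open>G \<in> sets lborel\<close>
    by (simp add: set_integrable_def integrable_restrict_space)
  from integral_cmod_sum_squared(2)[where M = ?M and \<phi> = "\<lambda>i z. expo (f i) z" and I = I and c = c, OF this]
  show ?thesis
    unfolding energy_def gram_def expo_mult_cnj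
    using \<open>G \<in> sets lborel\<close>
    by (simp add: set_lebesgue_integral_def integral_restrict_space)
qed

lemma energy_nonneg: "energy G f I c \<ge> 0"
  unfolding energy_def set_lebesgue_integral_def by (intro integral_nonneg_AE) auto

lemma energy_mono:
  assumes "fin_meas G" "fin_meas H" "G \<subseteq> H"
  shows "energy G f I c \<le> energy H f I c"
  unfolding energy_def set_lebesgue_integral_def
  using set_integrable_energy[OF assms(1)] set_integrable_energy[OF assms(2)] assms(3)
  by (intro integral_mono) (auto simp: set_integrable_def indicator_def)

section \<open>The Gram matrix of the modes on a set\<close>

text \<open>The arbitrary start \<open>\<tau>\<close> serves the boxes around the observation set,
  the number \<open>N\<close> of periods the time intervals that cover
  \<open>{0..T}\<close>.\<close>

lemma integral_cis_periods:
  fixes \<tau> :: real and n :: int and N :: nat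
  shows "(LINT s:{\<tau>..\<tau> + 2 * pi * real N}|lborel. cis (of_int n * s)) = (if n = 0 then of_real (2 * pi * real N) else 0)"
proof (cases "n = 0")
  case True
  then show ?thesis
    by (simp add: set_lebesgue_integral_def scaleR_conv_of_real)
next
  case False
  let ?F = "\<lambda>s::real. cis (of_int n * s) / (\<i> * of_int n)"
  have "(?F has_vector_derivative cis (of_int n * s)) (at s within A)" for s A
  proof -
    have "((\<lambda>s. exp (\<i> * of_int n * of_real s) / (\<i> * of_int n)) has_vector_derivative
        exp (\<i> * of_int n * of_real s)) (at s within A)"
      using False by (auto intro!: derivative_eq_intros has_vector_derivative_real_field)
    then show ?thesis by (simp add: cis_conv_exp mult_ac)
  qed
  then have "integral\<^sup>L lborel (\<lambda>s. indicator {\<tau>..\<tau> + 2 * pi * real N} s *\<^sub>R cis (of_int n * s))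
      = ?F (\<tau> + 2 * pi * real N) - ?F \<tau>"
    by (intro integral_FTC_atLeastAtMost) (auto intro!: continuous_intros)
  also have "cis (of_int n * (\<tau> + 2 * pi * real N)) = cis (of_int n * \<tau>) * cis (2 * pi * (of_int n * real N))"
    unfolding cis_mult by (rule arg_cong[of _ _ cis]) (simp add: distrib_left)
  also have "cis (2 * pi * (of_int n * real N)) = 1" by (rule cis_multiple_2pi) simp
  finally show ?thesis using False by (simp add: set_lebesgue_integral_def)
qed

lemmas integral_cis_period = integral_cis_periods[of _ 1, simplified]

lemma fin_meas_box:
  fixes a b c d :: real
  shows "fin_meas ({a..b} \<times> {c..d})"
  unfolding fin_meas_def
  using emeasure_bounded_finite[OF bounded_Times[OF bounded_closed_interval bounded_closed_interval]]
  by (auto simp: borel_closed closed_Times)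

lemma fin_meas_subset: "fin_meas H \<Longrightarrow> G \<in> sets borel \<Longrightarrow> G \<subseteq> H \<Longrightarrow> fin_meas G"
  unfolding fin_meas_def by (metis emeasure_mono order_le_less_trans sets_lborel)

lemma gram_box:
  fixes \<tau> :: real
  shows "gram ({\<tau>..\<tau> + 2 * pi} \<times> {0..2 * pi}) \<nu> = (if \<nu> = 0 then of_real (4 * pi\<^sup>2) else 0)"
proof -
  obtain m n where \<nu>: "\<nu> = (m, n)" by (cases \<nu>)
  let ?B = "{\<tau>..\<tau> + 2 * pi} \<times> {0..2 * pi}"
  have "integrable (lborel \<Otimes>\<^sub>M lborel) (\<lambda>z. indicator ?B z *\<^sub>R expo \<nu> z)"
    using set_integrable_expo[OF fin_meas_box] by (simp add: lborel_prod set_integrable_def)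
  note lborel_pair.integral_fst'[OF this]
  then have "gram ?B \<nu> = (\<integral>t. \<integral>x. indicator ?B (t, x) *\<^sub>R expo \<nu> (t, x) \<partial>lborel \<partial>lborel)"
    by (simp add: gram_def set_lebesgue_integral_def lborel_prod)
  also have "(\<lambda>t x. indicator ?B (t, x) *\<^sub>R expo \<nu> (t, x))
    = (\<lambda>t x. (indicator {\<tau>..\<tau> + 2 * pi} t *\<^sub>R cis (of_int n * t)) *
          (indicator {0..0 + 2 * pi} x *\<^sub>R cis (of_int m * x)))"
    by (intro ext) (auto simp: expo_def \<nu> cis_mult indicator_def add.commute)
  also have "(\<integral>t. \<integral>x. (indicator {\<tau>..\<tau> + 2 * pi} t *\<^sub>R cis (of_int n * t)) *
          (indicator {0..0 + 2 * pi} x *\<^sub>R cis (of_int m * x)) \<partial>lborel \<partial>lborel)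
      = (LINT s:{\<tau>..\<tau> + 2 * pi}|lborel. cis (of_int n * s)) * (LINT s:{0..0 + 2 * pi}|lborel. cis (of_int m * s))"
    unfolding set_lebesgue_integral_def
    by (simp only: integral_mult_right_zero integral_mult_left_zero)
  also have "\<dots> = (if \<nu> = 0 then of_real (4 * pi\<^sup>2) else 0)"
    unfolding integral_cis_period \<nu> by (auto simp: zero_prod_def power2_eq_square)
  finally show ?thesis .
qed

text \<open>A substitute for Cauchy-Schwarz, by the arithmetic-geometric mean inequality with weight
  \<open>4 * pi\<^sup>2\<close>. This weight is the area of a full period box, so that the energy
  over the box divided by it is exactly the sum of the squared coefficients and can be absorbed in
  \<open>gram_bessel\<close>.\<close>

lemma integral_norm_sum_le:
  assumes F: "fin_meas F" and "finite I"
  shows "cmod (LINT z:F|lborel. (\<Sum>i\<in>I. c i * expo (f i) z))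
    \<le> (4 * pi\<^sup>2 * measure lborel F + energy F f I c / (4 * pi\<^sup>2)) / 2"
proof -
  let ?g = "\<lambda>z. \<Sum>i\<in>I. c i * expo (f i) z"
  let ?m = "4 * pi\<^sup>2 :: real"
  have m: "?m > 0" by simp
  have amgm: "cmod w \<le> (?m + (cmod w)\<^sup>2 / ?m) / 2" for w
  proof -
    have "0 \<le> (?m - cmod w)\<^sup>2 / ?m" by simp
    also have "\<dots> = ?m + (cmod w)\<^sup>2 / ?m - 2 * cmod w"
      using m by (simp add: field_simps power2_eq_square)
    finally show ?thesis by simp
  qed
  have int: "set_integrable lborel F ?g"
    by (rule set_integrable_bounded[OF F, where B = "\<Sum>i\<in>I. cmod (c i)"])
       (auto intro!: order_trans[OF norm_sum] simp: norm_mult)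
  have intc: "set_integrable lborel F (\<lambda>z. ?m)"
    by (rule set_integrable_bounded[OF F, where B = "?m"]) auto
  have "cmod (LINT z:F|lborel. ?g z) \<le> (LINT z:F|lborel. cmod (?g z))"
    using int by (rule set_integral_norm_bound)
  also have "\<dots> \<le> (LINT z:F|lborel. (?m + (cmod (?g z))\<^sup>2 / ?m) / 2)"
    by (intro set_integral_mono set_integrable_norm int set_integrable_divide
          set_integral_add(1) set_integrable_energy F intc amgm) 
  also have "\<dots> = ((LINT z:F|lborel. ?m) + energy F f I c / ?m) / 2"
    unfolding energy_def using set_integrable_energy[OF F, of c f I] intc
    by (simp add: set_integral_add)
  also have "(LINT z:F|lborel. ?m) = ?m * measure lborel F"
    using F by (simp add: set_lebesgue_integral_def fin_meas_def)
  finally show ?thesis .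
qed

text \<open>Duality: with coefficients \<open>cnj (gram F \<nu>)\<close> the left-hand sum is the
  integral over \<open>F\<close> of the corresponding exponential sum. Enlarging \<open>F\<close> to
  the box in the energy term, where the exponentials are orthogonal, bounds it by half of the
  right-hand side plus half of itself.\<close>

lemma gram_bessel:
  fixes \<tau> :: real
  assumes F: "F \<in> sets borel" "F \<subseteq> {\<tau>..\<tau> + 2 * pi} \<times> {0..2 * pi}" and "finite N"
  shows "(\<Sum>\<nu>\<in>N. (cmod (gram F \<nu>))\<^sup>2) \<le> 4 * pi\<^sup>2 * measure lborel F"
proof -
  let ?B = "{\<tau>..\<tau> + 2 * pi} \<times> {0..2 * pi}" and ?S = "\<Sum>\<nu>\<in>N. (cmod (gram F \<nu>))\<^sup>2"
  define c where "c = (\<lambda>\<nu>. cnj (gram F \<nu>))"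
  have finF: "fin_meas F" using fin_meas_subset[OF fin_meas_box] F by blast
  have "complex_of_real (energy ?B id N c) = (\<Sum>i\<in>N. \<Sum>j\<in>N. if i = j then 4 * pi\<^sup>2 * (c i * cnj (c j)) else 0)"
    by (subst energy_expansion[OF fin_meas_box], intro sum.cong refl) (simp add: gram_box)
  also have "\<dots> = complex_of_real (4 * pi\<^sup>2 * ?S)"
    using \<open>finite N\<close> by (simp add: c_def sum.delta' sum_distrib_left mult_ac flip: complex_norm_square of_real_power)
  finally have box: "energy ?B id N c = 4 * pi\<^sup>2 * ?S"
    by (simp only: of_real_eq_iff)
  have "complex_of_real ?S = (\<Sum>\<nu>\<in>N. c \<nu> * gram F \<nu>)"
    unfolding c_def of_real_sum complex_norm_square by (intro sum.cong refl mult.commute)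
  also have "\<dots> = (LINT z:F|lborel. (\<Sum>\<nu>\<in>N. c \<nu> * expo (id \<nu>) z))"
    unfolding gram_def using set_integrable_expo[OF finF]
    by (simp add: set_lebesgue_integral_def set_integrable_def scaleR_sum_right
        Bochner_Integration.integral_sum flip: mult_scaleR_right)
  finally have "cmod (complex_of_real ?S) \<le> (4 * pi\<^sup>2 * measure lborel F + energy F id N c / (4 * pi\<^sup>2)) / 2"
    using integral_norm_sum_le[OF finF \<open>finite N\<close>, of c id] by presburger
  moreover have "energy F id N c \<le> 4 * pi\<^sup>2 * ?S"
    using energy_mono[OF finF fin_meas_box F(2)] box by metis
  then have "energy F id N c / (4 * pi\<^sup>2) \<le> ?S" by (simp add: field_simps)
  moreover have "?S \<ge> 0" by (intro sum_nonneg) auto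
  moreover have "s \<le> m" if "\<bar>s\<bar> \<le> (m + e) / 2" "e \<le> s" "0 \<le> s" for s m e :: real
    using that by (simp add: field_simps)
  ultimately show ?thesis unfolding norm_of_real by blast
qed

abbreviation mode :: "int poly \<Rightarrow> int \<Rightarrow> int \<times> int" where
  "mode p k \<equiv> (k, poly p k)"

text \<open>Grouping by frequency difference leaves a sum over distinct frequencies, each with
  multiplicity at most \<open>degree p\<close>, to which \<open>gram_bessel\<close> applies. The
  bound is the same for every finite \<open>S\<close>, which yields summability over all
  off-diagonal pairs.\<close>

lemma off_diagonal_sum_le:
  fixes p :: "int poly" and \<tau> :: real
  assumes p: "degree p \<ge> 2"
    and F: "F \<in> sets borel" "F \<subseteq> {\<tau>..\<tau> + 2 * pi} \<times> {0..2 * pi}"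
    and S: "finite S" "\<And>k l. (k, l) \<in> S \<Longrightarrow> k \<noteq> l"
  shows "(\<Sum>(k, l)\<in>S. (cmod (gram F (mode p k - mode p l)))\<^sup>2)
    \<le> real (degree p) * (4 * pi\<^sup>2 * measure lborel F)"
proof -
  define h where "h = (\<lambda>(k, l). mode p k - mode p l)"
  have fiber: "card {s \<in> S. h s = \<nu>} \<le> degree p" if "\<nu> \<in> h ` S" for \<nu>
  proof -
    obtain m n where \<nu>: "\<nu> = (m, n)" by (cases \<nu>)
    have "m \<noteq> 0" using that S(2) by (auto simp: h_def \<nu>)
    note level = card_difference_level_set_le[OF p this, of n]
    \<comment> \<open>A pair in the fibre over \<open>(m, n)\<close> is determined by its second
      entry \<open>l\<close>, the first being \<open>l + m\<close>.\<close>
    have "card {s \<in> S. h s = \<nu>} \<le> card {k. poly p (k + m) - poly p k = n}"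
      using level(1) by (intro card_inj_on_le[where f = snd]) (auto simp: h_def \<nu> inj_on_def)
    with level(2) show ?thesis by linarith
  qed
  have "(\<Sum>(k, l)\<in>S. (cmod (gram F (mode p k - mode p l)))\<^sup>2) = (\<Sum>s\<in>S. (cmod (gram F (h s)))\<^sup>2)"
    by (intro sum.cong) (auto simp: h_def)
  also have "\<dots> = (\<Sum>\<nu>\<in>h ` S. \<Sum>s | s \<in> S \<and> h s = \<nu>. (cmod (gram F (h s)))\<^sup>2)"
    by (rule sum.image_gen[OF S(1)])
  also have "\<dots> = (\<Sum>\<nu>\<in>h ` S. real (card {s \<in> S. h s = \<nu>}) * (cmod (gram F \<nu>))\<^sup>2)"
    by (intro sum.cong refl) simp
  also have "\<dots> \<le> (\<Sum>\<nu>\<in>h ` S. real (degree p) * (cmod (gram F \<nu>))\<^sup>2)"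
    using fiber by (intro sum_mono mult_right_mono) auto
  also have "\<dots> \<le> real (degree p) * (4 * pi\<^sup>2 * measure lborel F)"
    unfolding sum_distrib_left[symmetric]
    using gram_bessel[OF F] S(1) by (intro mult_left_mono) auto
  finally show ?thesis .
qed

text \<open>Only convergence of the off-diagonal series is used, so \<open>L\<close> depends on
  \<open>F\<close> in an uncontrolled way. The finite set that carries all but
  \<open>\<epsilon>\<close> of the sum is enclosed in the square over
  \<open>{- L..L}\<close>.\<close>

lemma off_diagonal_tail:
  fixes p :: "int poly" and \<tau> :: real
  assumes p: "degree p \<ge> 2"
    and F: "F \<in> sets borel" "F \<subseteq> {\<tau>..\<tau> + 2 * pi} \<times> {0..2 * pi}" and "\<epsilon> > 0"
  obtains L :: int where "L \<ge> 0"
    "\<And>S. finite S \<Longrightarrow> (\<And>k l. (k, l) \<in> S \<Longrightarrow> k \<noteq> l \<and> \<not> (\<bar>k\<bar> \<le> L \<and> \<bar>l\<bar> \<le> L)) \<Longrightarrow>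
      (\<Sum>(k, l)\<in>S. (cmod (gram F (mode p k - mode p l)))\<^sup>2) \<le> \<epsilon>"
proof -
  define w where "w = (\<lambda>(k, l). (cmod (gram F (mode p k - mode p l)))\<^sup>2)"
  let ?D = "{(k, l). k \<noteq> l} :: (int \<times> int) set"
  have "w summable_on ?D"
    using off_diagonal_sum_le[OF p F]
    by (intro nonneg_bdd_above_summable_on bdd_aboveI2[where M = "real (degree p) * (4 * pi\<^sup>2 * measure lborel F)"])
       (auto simp: w_def case_prod_beta subset_iff)
  then obtain S0 where S0: "finite S0" "S0 \<subseteq> ?D"
    and tail: "\<And>S. finite S \<Longrightarrow> S \<subseteq> ?D \<Longrightarrow> S0 \<inter> S = {} \<Longrightarrow> sum w S \<le> \<epsilon>"
  proof -
    assume sm: "w summable_on ?D"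
    have "\<exists>S0. finite S0 \<and> S0 \<subseteq> ?D \<and> norm (sum w S0 - infsum w ?D) \<le> \<epsilon>"
      using infsum_finite_approximation[OF sm \<open>\<epsilon> > 0\<close>] by (auto simp: dist_norm)
    then obtain S0 where S0: "finite S0" "S0 \<subseteq> ?D" "norm (sum w S0 - infsum w ?D) \<le> \<epsilon>" by blast
    have "sum w S \<le> \<epsilon>" if "finite S" "S \<subseteq> ?D" "S0 \<inter> S = {}" for S
    proof -
      have "sum w S0 + sum w S = sum w (S0 \<union> S)"
        using that S0 by (intro sum.union_disjoint[symmetric]) auto
      also have "\<dots> \<le> infsum w ?D"
        using that S0 sm by (intro finite_sum_le_infsum) (auto simp: w_def)
      finally show ?thesis using S0(3) by auto
    qed
    with S0 show thesis by (intro that) auto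
  qed
  define L where "L = Max (insert 0 ((\<lambda>(k, l). max \<bar>k\<bar> \<bar>l\<bar>) ` S0))"
  have L: "\<bar>k\<bar> \<le> L" "\<bar>l\<bar> \<le> L" if "(k, l) \<in> S0" for k l
  proof -
    have "max \<bar>k\<bar> \<bar>l\<bar> \<le> L"
      unfolding L_def using that S0(1) by (intro Max_ge) (auto intro!: rev_image_eqI)
    then show "\<bar>k\<bar> \<le> L" "\<bar>l\<bar> \<le> L" by auto
  qed
  show thesis
  proof (rule that[of L])
    show "L \<ge> 0" unfolding L_def using S0(1) by (intro Max_ge) auto
    fix S :: "(int \<times> int) set"
    assume S: "finite S" "\<And>k l. (k, l) \<in> S \<Longrightarrow> k \<noteq> l \<and> \<not> (\<bar>k\<bar> \<le> L \<and> \<bar>l\<bar> \<le> L)"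
    then have "S \<subseteq> ?D" "S0 \<inter> S = {}" using L by fastforce+
    from tail[OF S(1) this] show "(\<Sum>(k, l)\<in>S. (cmod (gram F (mode p k - mode p l)))\<^sup>2) \<le> \<epsilon>"
      by (simp add: w_def)
  qed
qed

text \<open>
  The Gram matrix is its diagonal plus a Hilbert-Schmidt operator, which is small once at most
  one mode of modulus \<open>\<le> L\<close> is present.
\<close>

lemma energy_coercive:
  fixes p :: "int poly" and \<tau> :: real
  assumes p: "degree p \<ge> 2"
    and F: "F \<in> sets borel" "F \<subseteq> {\<tau>..\<tau> + 2 * pi} \<times> {0..2 * pi}" and pos: "measure lborel F > 0"
  obtains L :: int where "L \<ge> 0"
    "\<And>I c. finite I \<Longrightarrow> (\<And>k l. k \<in> I \<Longrightarrow> l \<in> I \<Longrightarrow> \<bar>k\<bar> \<le> L \<Longrightarrow> \<bar>l\<bar> \<le> L \<Longrightarrow> k = l) \<Longrightarrow>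
      measure lborel F / 2 * (\<Sum>k\<in>I. (cmod (c k))\<^sup>2) \<le> energy F (mode p) I c"
proof -
  let ?\<mu> = "measure lborel F"
  \<comment> \<open>With this threshold the Hilbert-Schmidt norm of the off-diagonal part is at most
    half of the diagonal entry \<open>?\<mu>\<close>.\<close>
  have "(?\<mu> / 2)\<^sup>2 > 0" using pos by simp
  then obtain L :: int where L: "L \<ge> 0"
    "\<And>S. finite S \<Longrightarrow> (\<And>k l. (k, l) \<in> S \<Longrightarrow> k \<noteq> l \<and> \<not> (\<bar>k\<bar> \<le> L \<and> \<bar>l\<bar> \<le> L)) \<Longrightarrow>
      (\<Sum>(k, l)\<in>S. (cmod (gram F (mode p k - mode p l)))\<^sup>2) \<le> (?\<mu> / 2)\<^sup>2"
    using off_diagonal_tail[OF p F] by blast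
  have finF: "fin_meas F" using fin_meas_subset[OF fin_meas_box] F by blast
  have gram0: "gram F 0 = of_real ?\<mu>"
    using finF by (simp add: gram_def set_lebesgue_integral_def fin_meas_def scaleR_conv_of_real)
  show thesis
  proof (rule that[OF L(1)])
    fix I :: "int set" and c :: "int \<Rightarrow> complex"
    assume I: "finite I" "\<And>k l. k \<in> I \<Longrightarrow> l \<in> I \<Longrightarrow> \<bar>k\<bar> \<le> L \<Longrightarrow> \<bar>l\<bar> \<le> L \<Longrightarrow> k = l"
    let ?x = "\<Sum>k\<in>I. (cmod (c k))\<^sup>2"
    define S where "S = I \<times> I \<inter> {(k, l). k \<noteq> l}"
    define R where "R = (\<Sum>(k, l)\<in>S. c k * cnj (c l) * gram F (mode p k - mode p l))"
    have S: "finite S" "S \<subseteq> I \<times> I" using I(1) by (auto simp: S_def)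
    let ?t = "\<lambda>(k, l). c k * cnj (c l) * gram F (mode p k - mode p l)"
    have "complex_of_real (energy F (mode p) I c) = (\<Sum>s\<in>I \<times> I. ?t s)"
      by (simp add: energy_expansion[OF finF] sum.cartesian_product)
    also have "I \<times> I = S \<union> (\<lambda>k. (k, k)) ` I" by (auto simp: S_def)
    also have "(\<Sum>s\<in>\<dots>. ?t s) = R + (\<Sum>s\<in>(\<lambda>k. (k, k)) ` I. ?t s)"
      unfolding R_def using S I(1) by (intro sum.union_disjoint) (auto simp: S_def)
    also have "(\<Sum>s\<in>(\<lambda>k. (k, k)) ` I. ?t s) = (\<Sum>k\<in>I. c k * cnj (c k) * gram F 0)"
      by (subst sum.reindex) (auto simp: inj_on_def zero_prod_def)
    also have "\<dots> = complex_of_real (?\<mu> * ?x)"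
      by (simp add: gram0 complex_norm_square sum_distrib_left mult.commute del: of_real_power)
    finally have "complex_of_real (energy F (mode p) I c) = R + complex_of_real (?\<mu> * ?x)" .
    then have "R = complex_of_real (energy F (mode p) I c - ?\<mu> * ?x)"
      by (simp only: of_real_diff add_diff_cancel_right')
    then have "cmod R = \<bar>energy F (mode p) I c - ?\<mu> * ?x\<bar>" by (simp only: norm_of_real)
    then have "energy F (mode p) I c \<ge> ?\<mu> * ?x - cmod R" by linarith
    moreover have "cmod R \<le> ?x * (?\<mu> / 2)"
    proof -
      let ?a = "\<lambda>(k, l). cmod (c k) * cmod (c l)"
        and ?b = "\<lambda>(k, l). cmod (gram F (mode p k - mode p l))"
      have "cmod R \<le> (\<Sum>s\<in>S. ?a s * ?b s)"
        unfolding R_def by (intro order_trans[OF norm_sum] sum_mono) (auto simp: norm_mult)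
      moreover have "(\<Sum>s\<in>S. ?a s * ?b s) \<ge> 0" by (intro sum_nonneg) auto
      ultimately have "(cmod R)\<^sup>2 \<le> (\<Sum>s\<in>S. ?a s * ?b s)\<^sup>2" by (intro power_mono) auto
      also have "\<dots> \<le> (\<Sum>s\<in>S. (?a s)\<^sup>2) * (\<Sum>s\<in>S. (?b s)\<^sup>2)" by (rule Cauchy_Schwarz_ineq_sum)
      also have "\<dots> \<le> (?x)\<^sup>2 * (?\<mu> / 2)\<^sup>2"
      proof (intro mult_mono)
        have "(\<Sum>s\<in>S. (?a s)\<^sup>2) \<le> (\<Sum>s\<in>I \<times> I. (?a s)\<^sup>2)"
          using S I(1) by (intro sum_mono2) auto
        also have "\<dots> = (\<Sum>k\<in>I. \<Sum>l\<in>I. (cmod (c k))\<^sup>2 * (cmod (c l))\<^sup>2)"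
          by (simp add: sum.cartesian_product power_mult_distrib case_prod_beta)
        also have "\<dots> = (?x)\<^sup>2" by (simp add: power2_eq_square sum_product)
        finally show "(\<Sum>s\<in>S. (?a s)\<^sup>2) \<le> (?x)\<^sup>2" .
        \<comment> \<open>As \<open>I\<close> has at most one mode in \<open>{- L..L}\<close>, every
          pair of distinct modes leaves the square.\<close>
        have "(\<Sum>(k, l)\<in>S. (cmod (gram F (mode p k - mode p l)))\<^sup>2) \<le> (?\<mu> / 2)\<^sup>2"
          using I(2) S(1) by (intro L(2)) (auto simp: S_def)
        then show "(\<Sum>s\<in>S. (?b s)\<^sup>2) \<le> (?\<mu> / 2)\<^sup>2" by (simp add: case_prod_beta)
      qed (auto intro: sum_nonneg)
      finally have "(cmod R)\<^sup>2 \<le> (?x * (?\<mu> / 2))\<^sup>2" by (simp only: power_mult_distrib)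
      then show ?thesis
        by (rule power2_le_imp_le) (auto intro!: mult_nonneg_nonneg sum_nonneg)
    qed
    ultimately show "?\<mu> / 2 * ?x \<le> energy F (mode p) I c" by (simp add: field_simps)
  qed
qed

section \<open>Observability from a set of positive measure\<close>

lemma fin_meas_bounded: "bounded G \<Longrightarrow> G \<in> sets borel \<Longrightarrow> fin_meas G"
  using emeasure_bounded_finite by (auto simp: fin_meas_def)

text \<open>Continuity of translation in measure. A compact \<open>K\<close> inside \<open>E\<close>
  misses less than \<open>\<epsilon> / 2\<close> of \<open>E\<close>, and an open \<open>U\<close>
  around \<open>K\<close> exceeds it by less than \<open>\<epsilon> / 2\<close>. Small translates of
  \<open>K\<close> stay in \<open>U\<close>, so they lose less than \<open>\<epsilon> / 2\<close> of
  overlap with \<open>K\<close>.\<close>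

lemma measure_inter_translate:
  fixes E :: "(real \<times> real) set"
  assumes E: "E \<in> sets borel" "bounded E" and "\<epsilon> > 0" "\<delta> > 0"
  obtains s where "0 < s" "s < \<delta>"
    "measure lborel {z \<in> E. (0, s) + z \<in> E} > measure lborel E - \<epsilon>"
proof -
  have leb: "E \<in> sets lebesgue" using E(1) by simp
  obtain K where K: "closed K" "K \<subseteq> E" "E - K \<in> lmeasurable" "emeasure lebesgue (E - K) < ennreal (\<epsilon> / 2)"
    using sets_lebesgue_inner_closed[OF leb, of "\<epsilon> / 2"] \<open>\<epsilon> > 0\<close> by auto
  have "compact K" using K E(2) by (meson bounded_subset compact_eq_bounded_closed)
  then have Km: "K \<in> lmeasurable" by (rule lmeasurable_compact)
  obtain U where U: "open U" "K \<subseteq> U" "U - K \<in> lmeasurable" "emeasure lebesgue (U - K) < ennreal (\<epsilon> / 2)"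
    using sets_lebesgue_outer_open[of K "\<epsilon> / 2"] Km \<open>\<epsilon> > 0\<close> by (auto simp: fmeasurableD)
  obtain r where r: "r > 0" "(\<Union>z\<in>K. ball z r) \<subseteq> U"
    using compact_subset_open_imp_ball_epsilon_subset[OF \<open>compact K\<close> U(1,2)] by auto
  define s where "s = min r \<delta> / 2"
  have s: "0 < s" "s < \<delta>" "s < r" using r(1) \<open>\<delta> > 0\<close> by (auto simp: s_def)
  define K' where "K' = (+) (0, - s) ` K"
  have K'_eq: "K' = {z. (0, s) + z \<in> K}"
  proof (intro set_eqI iffI)
    fix z assume "z \<in> K'"
    then obtain k where "k \<in> K" "z = (0, - s) + k" by (auto simp: K'_def)
    moreover from this have "(0, s) + z = k" by (cases k) simp
    ultimately show "z \<in> {z. (0, s) + z \<in> K}" by (simp only: mem_Collect_eq)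
  next
    fix z assume "z \<in> {z. (0, s) + z \<in> K}"
    moreover have "z = (0, - s) + ((0, s) + z)" by (simp add: prod_eq_iff)
    ultimately show "z \<in> K'" unfolding K'_def by blast
  qed
  have "K' \<subseteq> U"
  proof
    fix z assume "z \<in> K'"
    then have "(0, s) + z \<in> K" by (simp add: K'_eq)
    moreover have "dist ((0, s) + z) z < r"
      using s by (simp add: dist_norm norm_prod_def)
    then have "z \<in> ball ((0, s) + z) r" by (simp only: mem_ball)
    ultimately show "z \<in> U" using r(2) by blast
  qed
  have "compact K'" unfolding K'_def using \<open>compact K\<close> by (rule compact_translation)
  then have K'm: "K' \<in> lmeasurable" by (rule lmeasurable_compact)
  have "measure lebesgue K = measure lebesgue K'"
    unfolding K'_def by (rule measure_translation[symmetric])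
  also have "\<dots> = measure lebesgue (K \<inter> K' \<union> (K' - K))" by (rule arg_cong[where f = "measure lebesgue"]) auto
  also have "\<dots> \<le> measure lebesgue (K \<inter> K') + measure lebesgue (K' - K)"
    using Km K'm by (intro measure_Un_le) (auto simp: fmeasurableD)
  also have "measure lebesgue (K' - K) \<le> measure lebesgue (U - K)"
    using Km K'm U(3) \<open>K' \<subseteq> U\<close> by (intro measure_mono_fmeasurable) auto
  also have "measure lebesgue (U - K) < \<epsilon> / 2"
    using U(3,4) \<open>\<epsilon> > 0\<close> by (simp add: emeasure_eq_measure2 ennreal_less_iff)
  finally have 1: "measure lebesgue K < measure lebesgue (K \<inter> K') + \<epsilon> / 2" by simp
  have "measure lebesgue E = measure lebesgue (K \<union> (E - K))"
    using K(2) by (intro arg_cong[where f = "measure lebesgue"]) auto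
  also have "\<dots> \<le> measure lebesgue K + measure lebesgue (E - K)"
    using Km K(3) by (intro measure_Un_le) (auto simp: fmeasurableD)
  also have "measure lebesgue (E - K) < \<epsilon> / 2"
    using K(3,4) \<open>\<epsilon> > 0\<close> by (simp add: emeasure_eq_measure2 ennreal_less_iff)
  finally have 2: "measure lebesgue E < measure lebesgue K + \<epsilon> / 2" by simp
  have sub: "{z \<in> E. (0, s) + z \<in> E} \<in> sets borel" using E(1) by measurable
  have "{z \<in> E. (0, s) + z \<in> E} \<in> lmeasurable"
    using sub E(2) by (intro bounded_set_imp_lmeasurable) (auto intro: bounded_subset)
  then have "measure lebesgue (K \<inter> K') \<le> measure lebesgue {z \<in> E. (0, s) + z \<in> E}"
    using K(2) Km K'm by (intro measure_mono_fmeasurable) (auto simp: K'_eq)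
  with 1 2 have "measure lebesgue {z \<in> E. (0, s) + z \<in> E} > measure lebesgue E - \<epsilon>" by simp
  then show thesis using s sub E(1) by (intro that[of s]) (auto simp: measure_completion)
qed

text \<open>Dependent choice with the invariant that more than half of
  \<open>measure lborel E\<close> is left. Each step loses less than the current excess over that
  half, so the invariant persists, and continuity from above leaves at least half in the
  limit.\<close>

lemma shrinking_translates:
  fixes E :: "(real \<times> real) set"
  assumes E: "E \<in> sets borel" "bounded E" and pos: "measure lborel E > 0"
  obtains G :: "nat \<Rightarrow> (real \<times> real) set" and s :: "nat \<Rightarrow> real"
  where "G 0 = E" "\<And>j. G j \<in> sets borel" "\<And>j. G (Suc j) \<subseteq> G j"
    "\<And>j. 0 < s j" "\<And>j. s j < 1 / real (Suc j)"
    "\<And>j z. z \<in> G (Suc j) \<Longrightarrow> (0, s j) + z \<in> G j"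
    "measure lborel (\<Inter>j. G j) > 0"
proof -
  let ?\<mu> = "measure lborel :: (real \<times> real) set \<Rightarrow> real"
  define P where "P = (\<lambda>(n::nat) G. G \<in> sets borel \<and> G \<subseteq> E \<and> ?\<mu> G > ?\<mu> E / 2 \<and> (n = 0 \<longrightarrow> G = E))"
  define Q where "Q = (\<lambda>n (G :: (real \<times> real) set) H. H \<subseteq> G \<and> (\<exists>s. 0 < s \<and> s < 1 / real (Suc n) \<and> (\<forall>z\<in>H. (0, s) + z \<in> G)))"
  have "\<exists>G. \<forall>n. P n (G n) \<and> Q n (G n) (G (Suc n))"
  proof (rule dependent_nat_choice)
    show "\<exists>G. P 0 G" using E pos by (auto simp: P_def)
    fix G n assume G: "P n G"
    then have "G \<in> sets borel" "bounded G" "?\<mu> G - ?\<mu> E / 2 > 0"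
      using E(2) by (auto simp: P_def intro: bounded_subset)
    then obtain s where s: "0 < s" "s < 1 / real (Suc n)"
      "?\<mu> {z \<in> G. (0, s) + z \<in> G} > ?\<mu> G - (?\<mu> G - ?\<mu> E / 2)"
      using measure_inter_translate[of G "?\<mu> G - ?\<mu> E / 2" "1 / real (Suc n)"] by auto
    have "{z \<in> G. (0, s) + z \<in> G} \<in> sets borel" using \<open>G \<in> sets borel\<close> by measurable
    then have "P (Suc n) {z \<in> G. (0, s) + z \<in> G} \<and> Q n G {z \<in> G. (0, s) + z \<in> G}"
      using s G by (auto simp: P_def Q_def)
    then show "\<exists>H. P (Suc n) H \<and> Q n G H" by blast
  qed
  then obtain G where G: "\<And>n. P n (G n)" "\<And>n. Q n (G n) (G (Suc n))" by blast
  from G(2) obtain s where s: "\<And>n. 0 < s n \<and> s n < 1 / real (Suc n) \<and> (\<forall>z\<in>G (Suc n). (0, s n) + z \<in> G n)"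
    unfolding Q_def by metis
  have dec: "decseq G" using G(2) by (intro decseq_SucI) (auto simp: Q_def)
  have fin: "emeasure lborel (G n) \<noteq> \<infinity>" for n
  proof -
    have "bounded (G n)" using G(1)[of n] E(2) by (auto simp: P_def intro: bounded_subset)
    then show ?thesis using emeasure_bounded_finite by fastforce
  qed
  have "(\<lambda>n. ?\<mu> (G n)) \<longlonglongrightarrow> ?\<mu> (\<Inter>n. G n)"
    using G(1) dec fin by (intro Lim_measure_decseq) (auto simp: P_def)
  then have "?\<mu> (\<Inter>n. G n) \<ge> ?\<mu> E / 2"
    by (rule Lim_bounded2) (use G(1) in \<open>auto simp: P_def less_imp_le\<close>)
  then show thesis
    using G s pos by (intro that[of G s]) (auto simp: P_def Q_def)
qed

text \<open>Translating in \<open>x\<close> by \<open>s\<close> multiplies the coefficient of mode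
  \<open>k\<close> by \<open>cis (k * s)\<close>. Invariance of Lebesgue measure on the plane turns
  the left-hand side into an energy over the translate of \<open>H\<close>, a subset of
  \<open>G\<close>.\<close>

lemma energy_translate:
  assumes G: "fin_meas G" and H: "fin_meas H" and sub: "\<And>z. z \<in> H \<Longrightarrow> (0, s) + z \<in> G"
  shows "energy H (mode p) I (\<lambda>k. cis (of_int k * s) * c k) \<le> energy G (mode p) I c"
proof -
  let ?W = "\<lambda>z. (cmod (\<Sum>k\<in>I. c k * expo (mode p k) z))\<^sup>2"
  have [measurable]: "G \<in> sets borel" using G by (simp add: fin_meas_def)
  have shift: "cis (of_int k * s) * c k * expo (mode p k) z = c k * expo (mode p k) ((0, s) + z)" for k z
    by (simp add: expo_def distrib_left flip: cis_mult)
  have distr: "integrable lborel (\<lambda>z. indicator G ((0, s) + z) *\<^sub>R ?W ((0, s) + z))"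
    "(\<integral>z. indicator G ((0, s) + z) *\<^sub>R ?W ((0, s) + z) \<partial>lborel) = energy G (mode p) I c"
  proof -
    have "integrable (distr lborel borel ((+) (0, s))) (\<lambda>z. indicator G z *\<^sub>R ?W z)"
      using set_integrable_energy[OF G] unfolding lborel_distr_plus set_integrable_def .
    then show "integrable lborel (\<lambda>z. indicator G ((0, s) + z) *\<^sub>R ?W ((0, s) + z))"
      by (subst (asm) integrable_distr_eq) auto
    have "energy G (mode p) I c = (\<integral>z. indicator G z *\<^sub>R ?W z \<partial>(distr lborel borel ((+) (0, s))))"
      unfolding lborel_distr_plus energy_def set_lebesgue_integral_def ..
    also have "\<dots> = (\<integral>z. indicator G ((0, s) + z) *\<^sub>R ?W ((0, s) + z) \<partial>lborel)"
      by (rule integral_distr) measurable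
    finally show "(\<integral>z. indicator G ((0, s) + z) *\<^sub>R ?W ((0, s) + z) \<partial>lborel) = energy G (mode p) I c" ..
  qed
  have "energy H (mode p) I (\<lambda>k. cis (of_int k * s) * c k) = (LINT z:H|lborel. ?W ((0, s) + z))"
    by (simp add: energy_def shift)
  also have "\<dots> \<le> (\<integral>z. indicator G ((0, s) + z) *\<^sub>R ?W ((0, s) + z) \<partial>lborel)"
    unfolding set_lebesgue_integral_def
  proof (rule integral_mono[OF _ distr(1)])
    show "integrable lborel (\<lambda>z. indicator H z *\<^sub>R ?W ((0, s) + z))"
      using set_integrable_energy[OF H, of "\<lambda>k. cis (of_int k * s) * c k" "mode p" I]
      unfolding shift set_integrable_def .
  qed (use sub in \<open>auto simp: indicator_def\<close>)
  finally show ?thesis using distr(2) by simp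
qed

section \<open>Removal of modes by translations\<close>

lemma energy_add_le:
  assumes "fin_meas G"
  shows "energy G f I (\<lambda>i. c i + d i) \<le> 2 * energy G f I c + 2 * energy G f I d"
proof -
  let ?g = "\<lambda>c z. (cmod (\<Sum>i\<in>I. c i * expo (f i) z))\<^sup>2"
  have "energy G f I (\<lambda>i. c i + d i) \<le> (LINT z:G|lborel. 2 * ?g c z + 2 * ?g d z)"
    unfolding energy_def
    by (intro set_integral_mono set_integral_add(1) set_integrable_mult_right set_integrable_energy assms)
       (simp add: ring_distribs sum.distrib cmod_add_squared_le)
  also have "\<dots> = 2 * energy G f I c + 2 * energy G f I d"
    unfolding energy_def using set_integrable_energy[OF assms]
    by (subst set_integral_add(2)) auto
  finally show ?thesis .
qed

lemma energy_scale: "energy G f I (\<lambda>i. w * c i) = (cmod w)\<^sup>2 * energy G f I c"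
  by (simp add: energy_def norm_mult power_mult_distrib mult.assoc flip: sum_distrib_left)

text \<open>
  The factor \<open>cis (k s) - cis (k\<^sub>0 s)\<close> is the symbol of a translation in \<open>x\<close> minus a constant;
  it removes the mode \<open>k\<^sub>0\<close> at the price of shrinking the observation set.
\<close>

lemma energy_kill_modes:
  fixes G :: "nat \<Rightarrow> (real \<times> real) set" and s :: "nat \<Rightarrow> real"
  assumes G: "\<And>j. fin_meas (G j)" "\<And>j. G (Suc j) \<subseteq> G j"
    and s: "\<And>j. 0 < s j" "\<And>j. s j < 1 / real (Suc j)"
    and sub: "\<And>j z. z \<in> G (Suc j) \<Longrightarrow> (0, s j) + z \<in> G j"
    and "finite K" and K: "K \<subseteq> {- L..L}"
  shows "\<exists>j B. (\<forall>k\<in>K. B k = 0) \<and> (\<forall>k\<in>{- L..L} - K. B k \<noteq> 0) \<and>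
    (\<forall>I c. energy (G j) (mode p) I (\<lambda>k. B k * c k) \<le> 4 ^ card K * energy (G 0) (mode p) I c)"
proof -
  \<comment> \<open>For \<open>j \<ge> j0\<close> the bound on \<open>s j\<close> makes the phases
    \<open>k * s j\<close> of the modes in \<open>{- L..L}\<close> differ by less than 1, hence by
    less than \<open>2 * pi\<close>, so distinct modes receive distinct factors.\<close>
  obtain j0 :: nat where j0: "2 * real_of_int \<bar>L\<bar> < real j0" using reals_Archimedean2 by blast
  have dec: "G j \<subseteq> G 0" for j by (induction j) (use G(2) in blast)+
  have "\<exists>j\<ge>j0. \<exists>B. (\<forall>k\<in>K. B k = 0) \<and> (\<forall>k\<in>{- L..L} - K. B k \<noteq> 0) \<and>
    (\<forall>I c. energy (G j) (mode p) I (\<lambda>k. B k * c k) \<le> 4 ^ card K * energy (G 0) (mode p) I c)"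
    using \<open>finite K\<close> K
  proof (induction K rule: finite_induct)
    case empty
    show ?case
      using energy_mono[OF G(1) G(1) dec[of j0]]
      by (intro exI[of _ j0] conjI exI[of _ "\<lambda>_. 1"]) auto
  next
    case (insert k0 K)
    then obtain j B where j: "j \<ge> j0" and B: "\<forall>k\<in>K. B k = 0" "\<forall>k\<in>{- L..L} - K. B k \<noteq> 0"
      "\<forall>I c. energy (G j) (mode p) I (\<lambda>k. B k * c k) \<le> 4 ^ card K * energy (G 0) (mode p) I c"
      by auto
    define \<beta> where "\<beta> k = cis (of_int k * s j) - cis (of_int k0 * s j)" for k :: int
    have \<beta>_nz: "\<beta> k \<noteq> 0" if "k \<in> {- L..L}" "k \<noteq> k0" for k
    proof
      assume "\<beta> k = 0"
      have "k0 \<in> {- L..L}" using insert.prems by simp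
      then have "\<bar>k - k0\<bar> \<le> 2 * \<bar>L\<bar>" using that by auto
      then have "real_of_int \<bar>k - k0\<bar> \<le> real_of_int (2 * \<bar>L\<bar>)" by (simp only: of_int_le_iff)
      also have "\<dots> < real (Suc j)" using j0 j by simp
      finally have "real_of_int \<bar>k - k0\<bar> * s j \<le> real (Suc j) * s j"
        using s(1)[of j] by (intro mult_right_mono) auto
      also have "\<dots> < 1" using s(2)[of j] by (simp add: field_simps)
      finally have "\<bar>of_int k * s j - of_int k0 * s j\<bar> < 2 * pi"
        using s(1)[of j] pi_gt3 by (simp add: abs_mult flip: left_diff_distrib)
      moreover have "cis (of_int k * s j) = cis (of_int k0 * s j)" using \<open>\<beta> k = 0\<close> by (simp add: \<beta>_def)
      ultimately have "of_int k * s j = of_int k0 * s j" by (rule cis_eq_small[rotated])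
      then show False using s(1)[of j] \<open>k \<noteq> k0\<close> by simp
    qed
    \<comment> \<open>Splitting \<open>\<beta>\<close> costs a factor 2 on each of two terms. Both
      are bounded by the energy on \<open>G j\<close>, the translated one because the translate of
      \<open>G (Suc j)\<close> lies in \<open>G j\<close>, the other by inclusion; hence a factor 4
      per removed mode.\<close>
    have "energy (G (Suc j)) (mode p) I (\<lambda>k. (\<beta> k * B k) * c k) \<le> 4 ^ card (insert k0 K) * energy (G 0) (mode p) I c" for I c
    proof -
      let ?d = "\<lambda>k. B k * c k"
      have "energy (G (Suc j)) (mode p) I (\<lambda>k. (\<beta> k * B k) * c k)
          = energy (G (Suc j)) (mode p) I (\<lambda>k. cis (of_int k * s j) * ?d k + (- cis (of_int k0 * s j)) * ?d k)"
        by (simp add: \<beta>_def algebra_simps)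
      also have "\<dots> \<le> 2 * energy (G (Suc j)) (mode p) I (\<lambda>k. cis (of_int k * s j) * ?d k)
          + 2 * energy (G (Suc j)) (mode p) I (\<lambda>k. (- cis (of_int k0 * s j)) * ?d k)"
        by (rule energy_add_le[OF G(1)])
      also have "energy (G (Suc j)) (mode p) I (\<lambda>k. cis (of_int k * s j) * ?d k) \<le> energy (G j) (mode p) I ?d"
        by (rule energy_translate[OF G(1) G(1) sub])
      also have "energy (G (Suc j)) (mode p) I (\<lambda>k. (- cis (of_int k0 * s j)) * ?d k) \<le> energy (G j) (mode p) I ?d"
        unfolding energy_scale using energy_mono[OF G(1) G(1) G(2)] by simp
      finally have "energy (G (Suc j)) (mode p) I (\<lambda>k. (\<beta> k * B k) * c k) \<le> 4 * energy (G j) (mode p) I ?d" by simp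
      also have "\<dots> \<le> 4 * (4 ^ card K * energy (G 0) (mode p) I c)" using B(3) by simp
      also have "\<dots> = 4 ^ card (insert k0 K) * energy (G 0) (mode p) I c"
        using insert.hyps by simp
      finally show ?thesis .
    qed
    moreover have "\<beta> k0 = 0" by (simp add: \<beta>_def)
    ultimately show ?case
      using B(1,2) \<beta>_nz j
      by (intro exI[of _ "Suc j"] conjI exI[of _ "\<lambda>k. \<beta> k * B k"]) auto
  qed
  then show ?thesis by blast
qed

section \<open>Observability for finite sums\<close>

lemma energy_mono_neutral:
  assumes "finite I" "J \<subseteq> I" "\<And>i. i \<in> I - J \<Longrightarrow> c i = 0"
  shows "energy G f I c = energy G f J c"
  unfolding energy_def using assms
  by (intro arg_cong[where f = "\<lambda>g. LINT z:G|lborel. (cmod (g z))\<^sup>2"] ext sum.mono_neutral_right) auto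

text \<open>Crude, as it grows with \<open>card I\<close>; it is applied to the modes in
  \<open>{- L..L}\<close>, whose number is fixed.\<close>

lemma energy_le:
  assumes "fin_meas G"
  shows "energy G f I c \<le> measure lborel G * (real (card I) * (\<Sum>i\<in>I. (cmod (c i))\<^sup>2))"
proof -
  have "energy G f I c \<le> (LINT z:G|lborel. real (card I) * (\<Sum>i\<in>I. (cmod (c i))\<^sup>2))"
    unfolding energy_def
  proof (intro set_integral_mono set_integrable_energy assms)
    show "set_integrable lborel G (\<lambda>z. real (card I) * (\<Sum>i\<in>I. (cmod (c i))\<^sup>2))"
      by (rule set_integrable_bounded[OF assms]) auto
    show "(cmod (\<Sum>i\<in>I. c i * expo (f i) z))\<^sup>2 \<le> real (card I) * (\<Sum>i\<in>I. (cmod (c i))\<^sup>2)" for z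
      using cmod_sum_squared_le[of "\<lambda>i. c i * expo (f i) z" I] by (simp add: norm_mult)
  qed
  also have "\<dots> = measure lborel G * (real (card I) * (\<Sum>i\<in>I. (cmod (c i))\<^sup>2))"
    using assms by (simp add: set_lebesgue_integral_def fin_meas_def)
  finally show ?thesis .
qed

text \<open>Uniformity in \<open>I\<close> and \<open>c\<close> later permits the limit over partial
  sums. The low modes are bounded one at a time; the high modes follow by subtracting the low part
  from the sum.\<close>

theorem trigonometric_observability:
  fixes p :: "int poly" and \<tau> :: real
  assumes p: "degree p \<ge> 2"
    and E: "E \<in> sets borel" "E \<subseteq> {\<tau>..\<tau> + 2 * pi} \<times> {0..2 * pi}" and pos: "measure lborel E > 0"
  obtains C where "C > 0"
    "\<And>I c. finite I \<Longrightarrow> (\<Sum>k\<in>I. (cmod (c k))\<^sup>2) \<le> C * energy E (mode p) I c"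
proof -
  have bE: "bounded E"
    using bounded_subset[OF bounded_Times[OF bounded_closed_interval bounded_closed_interval] E(2)] .
  obtain G s where G: "G 0 = E" "\<And>j. G j \<in> sets borel" "\<And>j. G (Suc j) \<subseteq> G j"
    and s: "\<And>j. 0 < s j" "\<And>j. s j < 1 / real (Suc j)"
    and sub: "\<And>j z. z \<in> G (Suc j) \<Longrightarrow> (0, s j) + z \<in> G j"
    and posF: "measure lborel (\<Inter>j. G j) > 0"
    using shrinking_translates[OF E(1) bE pos] by blast
  define F where "F = (\<Inter>j. G j)"
  let ?m = "measure lborel F"
  have dec: "G j \<subseteq> E" for j by (induction j) (use G in blast)+
  have finG: "fin_meas (G j)" for j
    using bounded_subset[OF bE dec] G(2) by (rule fin_meas_bounded)
  have F: "F \<in> sets borel" "F \<subseteq> E" "\<And>j. F \<subseteq> G j"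
    using G by (auto simp: F_def intro!: sets.countable_INT)
  have finF: "fin_meas F" using fin_meas_bounded[OF bounded_subset[OF bE F(2)] F(1)] .
  have finE: "fin_meas E" using fin_meas_bounded[OF bE E(1)] .
  have m: "?m > 0" using posF by (simp add: F_def)
  obtain L where L: "L \<ge> 0"
    "\<And>I c. finite I \<Longrightarrow> (\<And>k l. k \<in> I \<Longrightarrow> l \<in> I \<Longrightarrow> \<bar>k\<bar> \<le> L \<Longrightarrow> \<bar>l\<bar> \<le> L \<Longrightarrow> k = l) \<Longrightarrow>
      ?m / 2 * (\<Sum>k\<in>I. (cmod (c k))\<^sup>2) \<le> energy F (mode p) I c"
    using energy_coercive[OF p F(1) order_trans[OF F(2) E(2)] m] by blast
  have "\<exists>C\<ge>0. \<forall>I c. finite I \<longrightarrow> k0 \<in> I \<longrightarrow> (cmod (c k0))\<^sup>2 \<le> C * energy E (mode p) I c"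
    if k0: "k0 \<in> {- L..L}" for k0
  proof -
    let ?K = "{- L..L} - {k0}"
    obtain j B where B: "\<forall>k\<in>?K. B k = 0" "\<forall>k\<in>{- L..L} - ?K. B k \<noteq> 0"
      "\<And>I c. energy (G j) (mode p) I (\<lambda>k. B k * c k) \<le> 4 ^ card ?K * energy (G 0) (mode p) I c"
      using energy_kill_modes[of G s ?K L p] finG G(3) s sub by auto
    have Bk0: "B k0 \<noteq> 0" using B(2) k0 by auto
    define C where "C = 4 ^ card ?K * 2 / (?m * (cmod (B k0))\<^sup>2)"
    have "(cmod (c k0))\<^sup>2 \<le> C * energy E (mode p) I c" if I: "finite I" "k0 \<in> I" for I c
    proof -
      let ?d = "\<lambda>k. B k * c k"
      have "(cmod (?d k0))\<^sup>2 \<le> (\<Sum>k\<in>I - ?K. (cmod (?d k))\<^sup>2)"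
        using I by (intro member_le_sum) auto
      then have "?m / 2 * (cmod (?d k0))\<^sup>2 \<le> ?m / 2 * (\<Sum>k\<in>I - ?K. (cmod (?d k))\<^sup>2)"
        using m by (intro mult_left_mono) auto
      also have "\<dots> \<le> energy F (mode p) (I - ?K) ?d"
        using I(1) by (intro L(2)) auto
      also have "\<dots> = energy F (mode p) I ?d"
        using I(1) B(1) by (intro energy_mono_neutral[symmetric]) auto
      also have "\<dots> \<le> energy (G j) (mode p) I ?d"
        by (rule energy_mono[OF finF finG F(3)])
      also have "\<dots> \<le> 4 ^ card ?K * energy E (mode p) I c"
        using B(3) by (simp add: G(1))
      finally have "?m / 2 * ((cmod (B k0))\<^sup>2 * (cmod (c k0))\<^sup>2) \<le> 4 ^ card ?K * energy E (mode p) I c"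
        by (simp only: norm_mult power_mult_distrib)
      then show ?thesis using m Bk0 by (simp add: C_def field_simps)
    qed
    moreover have "C \<ge> 0" using m by (simp add: C_def)
    ultimately show ?thesis by blast
  qed
  then obtain C where C: "\<And>k. k \<in> {- L..L} \<Longrightarrow> C k \<ge> 0"
    "\<And>k I c. k \<in> {- L..L} \<Longrightarrow> finite I \<Longrightarrow> k \<in> I \<Longrightarrow> (cmod (c k))\<^sup>2 \<le> C k * energy E (mode p) I c"
    by metis
  define C1 where "C1 = (\<Sum>k\<in>{- L..L}. C k)"
  define n where "n = real (card {- L..L})"
  \<comment> \<open>The summand \<open>C1\<close> bounds the low modes. In the other,
    \<open>2 / ?m\<close> comes from coercivity on \<open>F\<close>, and the bracket from writing
    the high part as \<open>c - cL\<close> and bounding the energy of \<open>cL\<close> by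
    \<open>energy_le\<close>.\<close>
  define C2 where "C2 = C1 + 2 / ?m * (2 + 2 * (measure lborel E * (n * C1)))"
  have C1: "C1 \<ge> 0" unfolding C1_def by (intro sum_nonneg C(1))
  show thesis
  proof (rule that[of C2])
    have "0 < 2 / ?m * 2" using m by simp
    also have "\<dots> \<le> 2 / ?m * (2 + 2 * (measure lborel E * (n * C1)))"
      using m C1 by (intro mult_left_mono) (auto simp: n_def)
    finally show "C2 > 0" using C1 by (simp add: C2_def)
    fix I :: "int set" and c :: "int \<Rightarrow> complex"
    assume I: "finite I"
    let ?e = "energy E (mode p) I c"
    let ?J = "I \<inter> {- L..L}"
    define cL where "cL = (\<lambda>k. if k \<in> {- L..L} then c k else 0)"
    define cH where "cH = (\<lambda>k. if k \<in> {- L..L} then 0 else c k)"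
    have e: "?e \<ge> 0" by (rule energy_nonneg)
    have low: "(\<Sum>k\<in>?J. (cmod (c k))\<^sup>2) \<le> C1 * ?e"
    proof -
      have "(\<Sum>k\<in>?J. (cmod (c k))\<^sup>2) \<le> (\<Sum>k\<in>?J. C k * ?e)"
        using I by (intro sum_mono C(2)) auto
      also have "\<dots> \<le> (\<Sum>k\<in>{- L..L}. C k * ?e)"
        using C(1) e by (intro sum_mono2) auto
      finally show ?thesis by (simp add: C1_def sum_distrib_right)
    qed
    have "energy E (mode p) I cL = energy E (mode p) ?J cL"
      using I by (intro energy_mono_neutral) (auto simp: cL_def)
    also have "\<dots> \<le> measure lborel E * (real (card ?J) * (\<Sum>k\<in>?J. (cmod (cL k))\<^sup>2))"
      by (rule energy_le[OF finE])
    also have "\<dots> \<le> measure lborel E * (n * (C1 * ?e))"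
    proof (intro mult_left_mono mult_mono)
      show "real (card ?J) \<le> n" unfolding n_def by (intro of_nat_mono card_mono) auto
      show "(\<Sum>k\<in>?J. (cmod (cL k))\<^sup>2) \<le> C1 * ?e"
        using low by (simp add: cL_def)
    qed (auto simp: n_def intro: sum_nonneg)
    finally have eL: "energy E (mode p) I cL \<le> measure lborel E * (n * (C1 * ?e))" .
    have "cH = (\<lambda>k. c k + (- 1) * cL k)" by (auto simp: cH_def cL_def)
    then have "energy E (mode p) I cH \<le> 2 * ?e + 2 * energy E (mode p) I (\<lambda>k. (- 1) * cL k)"
      using energy_add_le[OF finE] by metis
    also have "energy E (mode p) I (\<lambda>k. (- 1) * cL k) = energy E (mode p) I cL"
      unfolding energy_scale by simp
    finally have eH: "energy E (mode p) I cH \<le> 2 * ?e + 2 * (measure lborel E * (n * (C1 * ?e)))"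
      using eL by simp
    have "?m / 2 * (\<Sum>k\<in>I - {- L..L}. (cmod (c k))\<^sup>2) = ?m / 2 * (\<Sum>k\<in>I - {- L..L}. (cmod (cH k))\<^sup>2)"
      by (intro arg_cong[where f = "(*) (?m / 2)"] sum.cong) (auto simp: cH_def)
    also have "\<dots> \<le> energy F (mode p) (I - {- L..L}) cH"
      using I by (intro L(2)) auto
    also have "\<dots> = energy F (mode p) I cH"
      using I by (intro energy_mono_neutral[symmetric]) (auto simp: cH_def)
    also have "\<dots> \<le> energy E (mode p) I cH" by (rule energy_mono[OF finF finE F(2)])
    finally have "?m / 2 * (\<Sum>k\<in>I - {- L..L}. (cmod (c k))\<^sup>2) \<le> 2 * ?e + 2 * (measure lborel E * (n * (C1 * ?e)))"
      using eH by simp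
    then have high: "(\<Sum>k\<in>I - {- L..L}. (cmod (c k))\<^sup>2) \<le> 2 / ?m * (2 + 2 * (measure lborel E * (n * C1))) * ?e"
      using m by (simp add: field_simps)
    have "(\<Sum>k\<in>I. (cmod (c k))\<^sup>2) = (\<Sum>k\<in>?J. (cmod (c k))\<^sup>2) + (\<Sum>k\<in>I - {- L..L}. (cmod (c k))\<^sup>2)"
      using I by (simp add: sum.Int_Diff)
    with low high show "(\<Sum>k\<in>I. (cmod (c k))\<^sup>2) \<le> C2 * ?e"
      by (simp add: C2_def distrib_right)
  qed
qed

text \<open>Over whole periods only the pairs with \<open>poly p k = poly p l\<close> survive. Their
  size \<open>cmod (c k) * cmod (c l)\<close> is at most the mean of the squares, and each mode has
  at most \<open>degree p\<close> partners, itself included. Uniformity in \<open>x\<close> is what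
  a weight merely integrable in \<open>x\<close> requires.\<close>

lemma time_integral_le:
  fixes p :: "int poly" and c :: "int \<Rightarrow> complex"
  assumes p: "degree p > 0" and "finite I"
  shows "(LINT t:{0..2 * pi * real N}|lborel. (cmod (\<Sum>k\<in>I. c k * expo (mode p k) (t, x)))\<^sup>2)
    \<le> 2 * pi * real N * real (degree p) * (\<Sum>k\<in>I. (cmod (c k))\<^sup>2)"
    (is "?lhs \<le> _")
    and "set_integrable lborel {0..2 * pi * real N} (\<lambda>t. (cmod (\<Sum>k\<in>I. c k * expo (mode p k) (t, x)))\<^sup>2)"
proof -
  let ?P = "{0..2 * pi * real N}" and ?n = "2 * pi * real N"
  let ?M = "restrict_space lborel ?P"
  let ?S = "\<Sum>k\<in>I. \<Sum>l\<in>I. if poly p k = poly p l then ((cmod (c k))\<^sup>2 + (cmod (c l))\<^sup>2) / 2 else 0"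
  have fin: "fin_meas ?P" by (simp add: fin_meas_def)
  have prod: "expo (mode p k) (t, x) * cnj (expo (mode p l) (t, x))
      = cis (of_int (k - l) * x) * cis (of_int (poly p k - poly p l) * t)" for k l t
    unfolding expo_mult_cnj by (simp add: expo_def cis_mult)
  have int: "set_integrable lborel ?P (\<lambda>t. expo (mode p k) (t, x) * cnj (expo (mode p l) (t, x)))" for k l
    by (rule set_integrable_bounded[OF fin, where B = 1])
       (auto simp: norm_mult prod intro!: borel_measurable_continuous_onI continuous_intros)
  then have "integrable ?M (\<lambda>t. expo (mode p k) (t, x) * cnj (expo (mode p l) (t, x)))" for k l
    by (simp add: set_integrable_def integrable_restrict_space)
  note ex = integral_cmod_sum_squared[where M = ?M and \<phi> = "\<lambda>k t. expo (mode p k) (t, x)" and I = I and c = c, OF this]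
  show "set_integrable lborel ?P (\<lambda>t. (cmod (\<Sum>k\<in>I. c k * expo (mode p k) (t, x)))\<^sup>2)"
    using ex(1) by (simp add: set_integrable_def integrable_restrict_space)
  have coef: "(\<integral>t. expo (mode p k) (t, x) * cnj (expo (mode p l) (t, x)) \<partial>?M)
      = (if poly p k = poly p l then cis (of_int (k - l) * x) * of_real ?n else 0)" for k l
  proof -
    have "(\<integral>t. expo (mode p k) (t, x) * cnj (expo (mode p l) (t, x)) \<partial>?M)
       = (LINT t:{0..0 + ?n}|lborel. cis (of_int (k - l) * x) * cis (of_int (poly p k - poly p l) * t))"
      unfolding prod set_lebesgue_integral_def by (subst integral_restrict_space) auto
    also have "\<dots> = cis (of_int (k - l) * x) * (LINT t:{0..0 + ?n}|lborel. cis (of_int (poly p k - poly p l) * t))"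
      by (rule set_integral_mult_right)
    also have "\<dots> = (if poly p k = poly p l then cis (of_int (k - l) * x) * of_real ?n else 0)"
      unfolding integral_cis_periods by simp
    finally show ?thesis .
  qed
  have "complex_of_real ?lhs = (\<Sum>k\<in>I. \<Sum>l\<in>I. c k * cnj (c l) *
      (if poly p k = poly p l then cis (of_int (k - l) * x) * of_real ?n else 0))"
    using ex(2) unfolding coef by (simp add: integral_restrict_space set_lebesgue_integral_def)
  then have "cmod (complex_of_real ?lhs) = cmod (\<Sum>k\<in>I. \<Sum>l\<in>I. c k * cnj (c l) *
      (if poly p k = poly p l then cis (of_int (k - l) * x) * of_real ?n else 0))"
    by (rule arg_cong)
  then have "?lhs \<le> cmod (\<Sum>k\<in>I. \<Sum>l\<in>I. c k * cnj (c l) *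
      (if poly p k = poly p l then cis (of_int (k - l) * x) * of_real ?n else 0))"
    unfolding norm_of_real by linarith
  also have "\<dots> \<le> (\<Sum>k\<in>I. \<Sum>l\<in>I. ?n * (if poly p k = poly p l then ((cmod (c k))\<^sup>2 + (cmod (c l))\<^sup>2) / 2 else 0))"
  proof (intro order_trans[OF norm_sum] sum_mono)
    fix k l
    have "cmod (c k) * cmod (c l) \<le> ((cmod (c k))\<^sup>2 + (cmod (c l))\<^sup>2) / 2"
      using sum_squares_bound[of "cmod (c k)" "cmod (c l)"] by simp
    then have "cmod (c k) * cmod (c l) * ?n \<le> ((cmod (c k))\<^sup>2 + (cmod (c l))\<^sup>2) / 2 * ?n"
      by (intro mult_right_mono) auto
    then show "cmod (c k * cnj (c l) * (if poly p k = poly p l then cis (of_int (k - l) * x) * of_real ?n else 0))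
        \<le> ?n * (if poly p k = poly p l then ((cmod (c k))\<^sup>2 + (cmod (c l))\<^sup>2) / 2 else 0)"
      by (simp add: norm_mult mult_ac)
  qed
  also have "\<dots> = ?n * ?S" by (simp only: sum_distrib_left)
  \<comment> \<open>By symmetry in \<open>k\<close> and \<open>l\<close> the two halves of the mean
    contribute equally.\<close>
  also have "?S = (\<Sum>k\<in>I. \<Sum>l\<in>I. if poly p k = poly p l then (cmod (c k))\<^sup>2 else 0)"
  proof -
    let ?A = "\<Sum>k\<in>I. \<Sum>l\<in>I. if poly p k = poly p l then (cmod (c k))\<^sup>2 else 0"
    have "?S = (\<Sum>k\<in>I. \<Sum>l\<in>I. (if poly p k = poly p l then (cmod (c k))\<^sup>2 else 0) / 2
        + (if poly p l = poly p k then (cmod (c l))\<^sup>2 else 0) / 2)"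
      by (intro sum.cong refl) (auto simp: add_divide_distrib)
    also have "\<dots> = ?A / 2 + (\<Sum>k\<in>I. \<Sum>l\<in>I. if poly p l = poly p k then (cmod (c l))\<^sup>2 else 0) / 2"
      by (simp only: sum.distrib sum_divide_distrib)
    also have "(\<Sum>k\<in>I. \<Sum>l\<in>I. if poly p l = poly p k then (cmod (c l))\<^sup>2 else 0) = ?A"
      by (rule sum.swap)
    finally show ?thesis by simp
  qed
  also have "\<dots> = (\<Sum>k\<in>I. real (card {l \<in> I. poly p l = poly p k}) * (cmod (c k))\<^sup>2)"
    using \<open>finite I\<close> by (intro sum.cong refl) (simp add: sum.inter_filter[symmetric] eq_commute)
  also have "?n * \<dots> \<le> ?n * (\<Sum>k\<in>I. real (degree p) * (cmod (c k))\<^sup>2)"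
  proof (intro mult_left_mono sum_mono mult_right_mono)
    fix k
    have "card {l \<in> I. poly p l = poly p k} \<le> card {l. poly p l = poly p k}"
      using card_level_set_le(1)[OF p] by (intro card_mono) auto
    then show "real (card {l \<in> I. poly p l = poly p k}) \<le> real (degree p)"
      using card_level_set_le(2)[OF p, of "poly p k"] by simp
  qed auto
  finally show "?lhs \<le> ?n * real (degree p) * (\<Sum>k\<in>I. (cmod (c k))\<^sup>2)"
    by (simp add: sum_distrib_left mult_ac)
qed

section \<open>Completeness of the trigonometric system\<close>

text \<open>As an inductive predicate, so that products, continuity and vanishing of integrals
  follow by rule induction; the zero function is a monomial with \<open>c = 0\<close>.\<close>

inductive trig_polynomial :: "(real \<Rightarrow> complex) \<Rightarrow> bool" where
  monomial: "trig_polynomial (\<lambda>x. c * cis (of_int k * x))"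
| add: "trig_polynomial f \<Longrightarrow> trig_polynomial g \<Longrightarrow> trig_polynomial (\<lambda>x. f x + g x)"

lemma trig_polynomial_mult:
  assumes "trig_polynomial f" "trig_polynomial g"
  shows "trig_polynomial (\<lambda>x. f x * g x)"
  using assms(1)
proof induction
  case (monomial c k)
  show ?case using assms(2)
  proof induction
    case (monomial d l)
    have "(\<lambda>x. c * cis (of_int k * x) * (d * cis (of_int l * x))) = (\<lambda>x. (c * d) * cis (of_int (k + l) * x))"
      by (simp add: fun_eq_iff distrib_right flip: cis_mult)
    then show ?case by (simp only: trig_polynomial.monomial)
  next
    case (add f g)
    then show ?case by (simp add: distrib_left trig_polynomial.add)
  qed
next
  case (add f g)
  then show ?case by (simp add: distrib_right trig_polynomial.add)
qed

lemma trig_polynomial_const: "trig_polynomial (\<lambda>x. c)"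
  using monomial[of c 0] by simp

text \<open>On the unit circle a real linear functional is a combination of \<open>cos\<close> and
  \<open>sin\<close>, hence of the frequencies 1 and -1; sums and products preserve trigonometric
  polynomials.\<close>

lemma trig_polynomial_real_polynomial:
  assumes "real_polynomial_function R"
  shows "trig_polynomial (\<lambda>x. of_real (R (cis x)))"
  using assms
proof induction
  case (linear f)
  have "complex_of_real (f (cis x)) = (of_real (f 1) - \<i> * of_real (f \<i>)) / 2 * cis (of_int 1 * x)
      + (of_real (f 1) + \<i> * of_real (f \<i>)) / 2 * cis (of_int (- 1) * x)" for x
  proof -
    have "cis x = cos x *\<^sub>R 1 + sin x *\<^sub>R \<i>" by (simp add: complex_eq_iff)
    then have "f (cis x) = cos x * f 1 + sin x * f \<i>"
      using linear by (simp add: linear_simps)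
    then show ?thesis by (simp add: complex_eq_iff field_simps)
  qed
  then show ?case
    by (simp only:) (intro trig_polynomial.add trig_polynomial.monomial)
next
  case (const c)
  show ?case by (rule trig_polynomial_const)
next
  case (add f g)
  then show ?case by (simp add: trig_polynomial.add)
next
  case (mult f g)
  then show ?case by (simp add: trig_polynomial_mult)
qed

lemma trig_polynomial_complex_polynomial:
  fixes g :: "complex \<Rightarrow> complex"
  assumes "polynomial_function g"
  shows "trig_polynomial (\<lambda>x. g (cis x))"
proof -
  have "real_polynomial_function (Re \<circ> g)" "real_polynomial_function (Im \<circ> g)"
    using assms bounded_linear_Re bounded_linear_Im by (auto simp: polynomial_function_def)
  then have "trig_polynomial (\<lambda>x. of_real ((Re \<circ> g) (cis x)) + \<i> * of_real ((Im \<circ> g) (cis x)))"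
    by (intro trig_polynomial.add trig_polynomial_mult trig_polynomial_const trig_polynomial_real_polynomial)
  then show ?thesis by (simp flip: complex_eq)
qed

text \<open>A continuous surjection from a compact space to a Hausdorff space, \<open>cis\<close> is
  a quotient map of \<open>{0..2 * pi}\<close> onto the circle. Periodicity lets \<open>h\<close>
  descend to the circle, where Stone-Weierstrass for polynomials on the plane applies.\<close>

lemma trig_polynomial_approximation:
  fixes h :: "real \<Rightarrow> complex"
  assumes cont: "continuous_on {0..2 * pi} h" and per: "h 0 = h (2 * pi)" and "\<epsilon> > 0"
  obtains g where "trig_polynomial g" "\<And>x. x \<in> {0..2 * pi} \<Longrightarrow> cmod (h x - g x) < \<epsilon>"
proof -
  let ?X = "top_of_set {0..2 * pi}" and ?Y = "top_of_set (sphere (0 :: complex) 1)"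
  have im: "cis ` {0..2 * pi} = sphere 0 1"
  proof (intro equalityI subsetI)
    fix z :: complex assume "z \<in> sphere 0 1"
    then have "z = cis (Arg2pi z)" by (simp add: cis_conv_exp complex_norm_eq_1_exp mult.commute)
    moreover have "Arg2pi z \<in> {0..2 * pi}" using Arg2pi[of z] by auto
    ultimately show "z \<in> cis ` {0..2 * pi}" by blast
  qed auto
  have quot: "quotient_map ?X ?Y cis"
  proof (rule T1_Spaces.continuous_imp_quotient_map)
    show "continuous_map ?X ?Y cis"
      using im by (auto intro!: continuous_intros)
    show "compact_space ?X" by (simp add: compact_space_subtopology)
    show "Hausdorff_space ?Y" by (simp add: Hausdorff_space_subtopology)
    show "cis ` topspace ?X = topspace ?Y" using im by simp
  qed
  have eq: "h x = h y" if "x \<in> {0..2 * pi}" "y \<in> {0..2 * pi}" "cis x = cis y" for x y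
  proof (cases "\<bar>x - y\<bar> < 2 * pi")
    case True
    then show ?thesis using cis_eq_small[OF that(3)] by simp
  next
    case False
    then have "x = 0 \<and> y = 2 * pi \<or> x = 2 * pi \<and> y = 0" using that(1,2) by auto
    then show ?thesis using per by auto
  qed
  obtain H where H: "continuous_map ?Y euclidean H" "\<And>x. x \<in> topspace ?X \<Longrightarrow> H (cis x) = h x"
  proof (rule quotient_map_lift_exists[OF quot])
    show "continuous_map ?X euclidean h" using cont by simp
    show "h x = h y" if "x \<in> topspace ?X" "y \<in> topspace ?X" "cis x = cis y" for x y
      using that(1,2) by (intro eq[OF _ _ that(3)]) simp_all
  next
    fix g assume "continuous_map ?Y euclidean g" "\<And>x. x \<in> topspace ?X \<Longrightarrow> g (cis x) = h x"
    then show thesis by (rule that)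
  qed
  then have "continuous_on (sphere 0 1) H" by simp
  then obtain g where g: "polynomial_function g" "\<And>z. z \<in> sphere 0 1 \<Longrightarrow> cmod (H z - g z) < \<epsilon>"
    using Stone_Weierstrass_polynomial_function[OF compact_sphere, of 0 1 H \<epsilon>] \<open>\<epsilon> > 0\<close> by auto
  show thesis
  proof (rule that[OF trig_polynomial_complex_polynomial[OF g(1)]])
    show "cmod (h x - g (cis x)) < \<epsilon>" if "x \<in> {0..2 * pi}" for x
      using g(2)[of "cis x"] H(2)[of x] that by simp
  qed
qed

section \<open>Square integrable functions on the torus\<close>

lemma finite_measure_torus: "finite_measure torus"
  by (rule finite_measureI) (simp add: emeasure_restrict_space)

lemma measure_torus: "measure torus {0..2 * pi} = 2 * pi"
  by (simp add: measure_restrict_space)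

lemma nn_integral_torus: "(\<integral>\<^sup>+x. f x \<partial>torus) = (\<integral>\<^sup>+x. f x * indicator {0..2 * pi} x \<partial>lborel)"
  by (simp add: nn_integral_restrict_space nn_integral_completion)

lemma borel_measurable_torus: "f \<in> borel_measurable borel \<Longrightarrow> f \<in> borel_measurable torus"
  by (intro measurable_restrict_space1 measurable_completion) simp

lemma integral_torus:
  fixes f :: "real \<Rightarrow> 'b::{banach, second_countable_topology}"
  assumes [measurable]: "f \<in> borel_measurable borel"
  shows "integral\<^sup>L torus f = (LINT x:{0..2 * pi}|lborel. f x)"
  unfolding set_lebesgue_integral_def
  by (subst integral_restrict_space) (simp_all add: integral_completion)

lemma borel_measurable_cis_int [measurable]: "(\<lambda>x. cis (of_int k * x)) \<in> borel_measurable borel"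
  by (intro borel_measurable_continuous_onI continuous_intros)

lemma borel_measurable_cnj [measurable (raw)]:
  "f \<in> borel_measurable M \<Longrightarrow> (\<lambda>x. cnj (f x)) \<in> borel_measurable M"
  by (rule borel_measurable_continuous_on[where f = cnj]) (intro continuous_intros)

lemma integral_cis_torus: "(\<integral>x. cis (of_int k * x) \<partial>torus) = (if k = 0 then of_real (2 * pi) else 0)"
  using integral_cis_period[of 0 k] by (subst integral_torus) auto

lemma integrable_torus_bounded:
  fixes f :: "real \<Rightarrow> 'b::{banach, second_countable_topology}"
  assumes "f \<in> borel_measurable torus" "\<And>x. x \<in> {0..2 * pi} \<Longrightarrow> norm (f x) \<le> B"
  shows "integrable torus f"
  using assms by (intro finite_measure.integrable_const_bound[OF finite_measure_torus, of _ B] AE_I2) auto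

lemma L2_torus_measurable: "u \<in> L2_torus \<Longrightarrow> u \<in> borel_measurable torus"
  and L2_torus_integrable: "u \<in> L2_torus \<Longrightarrow> integrable torus (\<lambda>x. (cmod (u x))\<^sup>2)"
  by (auto simp: L2_torus_def)

lemma L2_norm_squared: "(L2_norm u)\<^sup>2 = (\<integral>x. (cmod (u x))\<^sup>2 \<partial>torus)"
  unfolding L2_norm_def by (rule real_sqrt_pow2) (intro integral_nonneg_AE; simp)

lemma L2_torus_product:
  assumes "u \<in> L2_torus" "v \<in> L2_torus"
  shows "integrable torus (\<lambda>x. u x * cnj (v x))"
proof (rule Bochner_Integration.integrable_bound)
  note [measurable] = assms[THEN L2_torus_measurable]
  show "integrable torus (\<lambda>x. (cmod (u x))\<^sup>2 + (cmod (v x))\<^sup>2)"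
    using assms by (simp add: L2_torus_integrable)
  show "(\<lambda>x. u x * cnj (v x)) \<in> borel_measurable torus" by measurable
  have "a * b \<le> a\<^sup>2 + b\<^sup>2" if "a \<ge> 0" "b \<ge> 0" for a b :: real
    using sum_squares_bound[of a b] mult_nonneg_nonneg[OF that] by linarith
  then show "AE x in torus. norm (u x * cnj (v x)) \<le> norm ((cmod (u x))\<^sup>2 + (cmod (v x))\<^sup>2)"
    by (intro AE_I2) (simp add: norm_mult)
qed

lemma L2_torus_add:
  assumes "u \<in> L2_torus" "v \<in> L2_torus"
  shows "(\<lambda>x. u x + v x) \<in> L2_torus"
proof -
  note [measurable] = assms[THEN L2_torus_measurable]
  have "integrable torus (\<lambda>x. (cmod (u x + v x))\<^sup>2)"
  proof (rule Bochner_Integration.integrable_bound)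
    show "integrable torus (\<lambda>x. 2 * (cmod (u x))\<^sup>2 + 2 * (cmod (v x))\<^sup>2)"
      using assms by (simp add: L2_torus_integrable)
    show "AE x in torus. norm ((cmod (u x + v x))\<^sup>2) \<le> norm (2 * (cmod (u x))\<^sup>2 + 2 * (cmod (v x))\<^sup>2)"
      using cmod_add_squared_le by (intro AE_I2) (simp add: abs_of_nonneg)
  qed measurable
  then show ?thesis by (simp add: L2_torus_def)
qed

lemma L2_torus_bounded:
  assumes [measurable]: "u \<in> borel_measurable torus" and "\<And>x. x \<in> {0..2 * pi} \<Longrightarrow> cmod (u x) \<le> B"
  shows "u \<in> L2_torus"
  unfolding L2_torus_def
  using assms(2) by (auto intro!: integrable_torus_bounded[where B = "B\<^sup>2"] power_mono)

lemma L2_torus_cis_sum: "(\<lambda>x. \<Sum>k\<in>I. c k * cis (of_int k * x)) \<in> L2_torus"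
proof (rule L2_torus_bounded[where B = "\<Sum>k\<in>I. cmod (c k)"])
  show "cmod (\<Sum>k\<in>I. c k * cis (of_int k * x)) \<le> (\<Sum>k\<in>I. cmod (c k))" for x
    by (auto intro!: order_trans[OF norm_sum] simp: norm_mult)
qed (intro borel_measurable_torus borel_measurable_continuous_onI continuous_intros)

lemma L2_torus_diff:
  assumes "u \<in> L2_torus" "v \<in> L2_torus"
  shows "(\<lambda>x. u x - v x) \<in> L2_torus"
proof -
  have "(\<lambda>x. - v x) \<in> L2_torus" using assms(2) by (simp add: L2_torus_def)
  from L2_torus_add[OF assms(1) this] show ?thesis by simp
qed

lemma integrable_L2_torus:
  assumes "u \<in> L2_torus"
  shows "integrable torus u"
  using L2_torus_product[OF assms, of "\<lambda>_. 1"] L2_torus_bounded[of "\<lambda>_. 1" 1] by simp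

lemma cis_L2_torus: "(\<lambda>x. cis (of_int k * x)) \<in> L2_torus"
  by (rule L2_torus_bounded[where B = 1])
     (auto intro!: borel_measurable_torus borel_measurable_continuous_onI continuous_intros)

lemma fourier_coeff_cis:
  "(\<integral>x. u x * cnj (cis (of_int k * x)) \<partial>torus) = of_real (2 * pi) * fourier_coeff u k"
proof -
  have "cnj (cis (of_int k * x)) = exp (- \<i> * of_int k * of_real x)" for x :: real
    by (simp add: cis_conv_exp exp_cnj mult.assoc)
  then show ?thesis by (simp add: fourier_coeff_def)
qed

lemma L2_norm_cis_sum:
  assumes "finite I"
  shows "(L2_norm (\<lambda>x. \<Sum>k\<in>I. c k * cis (of_int k * x)))\<^sup>2 = 2 * pi * (\<Sum>k\<in>I. (cmod (c k))\<^sup>2)"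
proof -
  have "integrable torus (\<lambda>x. cis (of_int k * x) * cnj (cis (of_int l * x)))" for k l :: int
    by (intro L2_torus_product cis_L2_torus)
  note ex = integral_cmod_sum_squared(2)[where M = torus and \<phi> = "\<lambda>k x. cis (of_int k * x)" and I = I and c = c, OF this]
  have "cis (of_int k * x) * cnj (cis (of_int l * x)) = cis (of_int (k - l) * x)" for k l :: int and x :: real
    by (simp add: cis_cnj cis_mult left_diff_distrib)
  then have "complex_of_real ((L2_norm (\<lambda>x. \<Sum>k\<in>I. c k * cis (of_int k * x)))\<^sup>2)
    = (\<Sum>k\<in>I. \<Sum>l\<in>I. if k = l then c k * cnj (c l) * of_real (2 * pi) else 0)"
    unfolding L2_norm_squared ex
    by (intro sum.cong refl) (simp only: integral_cis_torus, simp)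
  also have "\<dots> = (\<Sum>k\<in>I. complex_of_real (2 * pi * (cmod (c k))\<^sup>2))"
    using assms by (intro sum.cong refl) (simp add: sum.delta' mult.commute complex_norm_square del: of_real_power)
  finally show ?thesis by (simp only: of_real_sum[symmetric] of_real_eq_iff sum_distrib_left)
qed

lemma cmod_diff_squared_cnj: "(cmod (z - w))\<^sup>2 = (cmod z)\<^sup>2 + (cmod w)\<^sup>2 - 2 * Re (z * cnj w)"
  unfolding cmod_power2 by (simp add: power2_eq_square algebra_simps)

lemma fourier_pythagoras:
  assumes u: "u \<in> L2_torus" and "finite I"
  shows "(L2_norm (\<lambda>x. u x - (\<Sum>k\<in>I. fourier_coeff u k * cis (of_int k * x))))\<^sup>2
    = (L2_norm u)\<^sup>2 - 2 * pi * (\<Sum>k\<in>I. (cmod (fourier_coeff u k))\<^sup>2)"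
proof -
  let ?c = "fourier_coeff u"
  let ?S = "\<lambda>x. \<Sum>k\<in>I. ?c k * cis (of_int k * x)"
  let ?s = "\<Sum>k\<in>I. (cmod (?c k))\<^sup>2"
  have S: "?S \<in> L2_torus" by (rule L2_torus_cis_sum)
  have int: "integrable torus (\<lambda>x. u x * cnj (?S x))" using u S by (rule L2_torus_product)
  have "(\<integral>x. u x * cnj (?S x) \<partial>torus) = (\<integral>x. (\<Sum>k\<in>I. cnj (?c k) * (u x * cnj (cis (of_int k * x)))) \<partial>torus)"
    by (simp add: sum_distrib_left mult_ac)
  also have "\<dots> = (\<Sum>k\<in>I. cnj (?c k) * (\<integral>x. u x * cnj (cis (of_int k * x)) \<partial>torus))"
    using L2_torus_product[OF u cis_L2_torus] by (subst Bochner_Integration.integral_sum) auto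
  also have "\<dots> = (\<Sum>k\<in>I. complex_of_real (2 * pi * (cmod (?c k))\<^sup>2))"
    unfolding fourier_coeff_cis
    by (intro sum.cong refl) (simp add: complex_norm_square mult_ac del: of_real_power)
  finally have inner: "(\<integral>x. u x * cnj (?S x) \<partial>torus) = complex_of_real (2 * pi * ?s)"
    by (simp only: of_real_sum[symmetric] sum_distrib_left)
  have "(\<integral>x. Re (u x * cnj (?S x)) \<partial>torus) = Re (complex_of_real (2 * pi * ?s))"
    unfolding inner[symmetric] using int by (rule integral_Re)
  then have re: "(\<integral>x. Re (u x * cnj (?S x)) \<partial>torus) = 2 * pi * ?s" by (simp only: Re_complex_of_real)
  have ire: "integrable torus (\<lambda>x. Re (u x * cnj (?S x)))" using int by (rule integrable_Re)
  have "(L2_norm (\<lambda>x. u x - ?S x))\<^sup>2 = (\<integral>x. (cmod (u x))\<^sup>2 + (cmod (?S x))\<^sup>2 - 2 * Re (u x * cnj (?S x)) \<partial>torus)"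
    unfolding L2_norm_squared
    by (intro Bochner_Integration.integral_cong refl) (rule cmod_diff_squared_cnj)
  also have "\<dots> = (L2_norm u)\<^sup>2 + (L2_norm ?S)\<^sup>2 - 2 * (2 * pi * ?s)"
  proof -
    have "(\<integral>x. f x + g x - 2 * h x \<partial>torus) = integral\<^sup>L torus f + integral\<^sup>L torus g - 2 * integral\<^sup>L torus h"
      if "integrable torus f" "integrable torus g" "integrable torus h" for f g h :: "real \<Rightarrow> real"
      using that by simp
    from this[OF L2_torus_integrable[OF u] L2_torus_integrable[OF S] ire]
    show ?thesis unfolding re L2_norm_squared .
  qed
  finally show ?thesis unfolding L2_norm_cis_sum[OF \<open>finite I\<close>] by simp
qed

section \<open>Uniqueness of Fourier coefficients\<close>

lemma trig_polynomial_continuous: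
  assumes "trig_polynomial g"
  shows "continuous_on S g"
  using assms by induction (auto intro!: continuous_intros)

lemma continuous_L2_torus:
  fixes h :: "real \<Rightarrow> complex"
  assumes "continuous_on UNIV h"
  shows "h \<in> L2_torus"
proof -
  have "compact (h ` {0..2 * pi})"
    using assms by (intro compact_continuous_image) (auto intro: continuous_on_subset)
  then obtain B where B: "\<And>x. x \<in> {0..2 * pi} \<Longrightarrow> cmod (h x) \<le> B"
    using compact_imp_bounded bounded_iff by (metis image_eqI)
  show ?thesis
    using assms B by (intro L2_torus_bounded borel_measurable_torus borel_measurable_continuous_onI)
qed

lemma integral_trig_polynomial_eq_0:
  assumes v: "v \<in> L2_torus" and coeff: "\<And>k. fourier_coeff v k = 0" and "trig_polynomial g"
  shows "(\<integral>x. v x * g x \<partial>torus) = 0"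
  using assms(3)
proof induction
  case (monomial c k)
  have "cis (of_int k * x) = cnj (cis (of_int (- k) * x))" for x :: real
    by (simp add: cis_cnj)
  then have "(\<integral>x. v x * cis (of_int k * x) \<partial>torus) = 0"
    using fourier_coeff_cis[of v "- k"] coeff by simp
  moreover have "(\<lambda>x. v x * (c * cis (of_int k * x))) = (\<lambda>x. c * (v x * cis (of_int k * x)))"
    by (simp add: mult_ac)
  ultimately show ?case by simp
next
  case (add f g)
  have int: "integrable torus (\<lambda>x. v x * f x)" if "trig_polynomial f" for f
  proof -
    have "(\<lambda>x. cnj (f x)) \<in> L2_torus"
      using that by (intro continuous_L2_torus continuous_intros trig_polynomial_continuous)
    from L2_torus_product[OF v this] show ?thesis by simp
  qed
  show ?case using add int[OF add.hyps(1)] int[OF add.hyps(2)] by (simp add: distrib_left)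
qed

lemma integral_periodic_eq_0:
  assumes v: "v \<in> L2_torus" and coeff: "\<And>k. fourier_coeff v k = 0"
    and h: "continuous_on UNIV h" "h 0 = h (2 * pi)"
  shows "(\<integral>x. v x * h x \<partial>torus) = 0"
proof -
  let ?V = "\<integral>x. cmod (v x) \<partial>torus"
  have vint: "integrable torus v" by (rule integrable_L2_torus[OF v])
  have int: "integrable torus (\<lambda>x. v x * f x)" if "continuous_on UNIV f" for f
    using L2_torus_product[OF v continuous_L2_torus[of "\<lambda>x. cnj (f x)"]] that
    by (simp add: continuous_on_cnj)
  have "cmod (\<integral>x. v x * h x \<partial>torus) \<le> \<epsilon> * ?V" if \<epsilon>: "\<epsilon> > 0" for \<epsilon>
  proof -
    obtain g where g: "trig_polynomial g" "\<And>x. x \<in> {0..2 * pi} \<Longrightarrow> cmod (h x - g x) < \<epsilon>"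
      using trig_polynomial_approximation[OF continuous_on_subset[OF h(1) subset_UNIV] h(2) \<epsilon>] by blast
    have gc: "continuous_on UNIV g" by (rule trig_polynomial_continuous[OF g(1)])
    have "(\<integral>x. v x * h x \<partial>torus) = (\<integral>x. v x * h x \<partial>torus) - (\<integral>x. v x * g x \<partial>torus)"
      by (simp add: integral_trig_polynomial_eq_0[OF v coeff g(1)])
    also have "\<dots> = (\<integral>x. v x * h x - v x * g x \<partial>torus)"
      by (rule Bochner_Integration.integral_diff[symmetric, OF int[OF h(1)] int[OF gc]])
    also have "cmod \<dots> \<le> (\<integral>x. cmod (v x * h x - v x * g x) \<partial>torus)"
      by (rule integral_norm_bound)
    also have "\<dots> \<le> (\<integral>x. \<epsilon> * cmod (v x) \<partial>torus)"
    proof (rule integral_mono)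
      show "integrable torus (\<lambda>x. cmod (v x * h x - v x * g x))"
        using int[OF h(1)] int[OF gc] by (intro integrable_norm Bochner_Integration.integrable_diff)
      show "integrable torus (\<lambda>x. \<epsilon> * cmod (v x))" using vint by simp
      fix x assume "x \<in> space torus"
      then have "cmod (h x - g x) \<le> \<epsilon>" using g(2)[of x] by simp
      then have "cmod (v x) * cmod (h x - g x) \<le> cmod (v x) * \<epsilon>" by (intro mult_left_mono) auto
      then show "cmod (v x * h x - v x * g x) \<le> \<epsilon> * cmod (v x)"
        by (simp only: right_diff_distrib[symmetric] norm_mult mult.commute[of \<epsilon>])
    qed
    finally show ?thesis by simp
  qed
  then have "cmod (\<integral>x. v x * h x \<partial>torus) \<le> 0"
  proof -
    assume *: "\<And>\<epsilon>. \<epsilon> > 0 \<Longrightarrow> cmod (\<integral>x. v x * h x \<partial>torus) \<le> \<epsilon> * ?V"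
    have V: "?V \<ge> 0" by (intro integral_nonneg_AE) simp
    show ?thesis
    proof (rule field_le_epsilon)
      fix e :: real assume "e > 0"
      have "cmod (\<integral>x. v x * h x \<partial>torus) \<le> e / (?V + 1) * ?V" using V \<open>e > 0\<close> by (intro * divide_pos_pos add_nonneg_pos) auto
      moreover have "e / (a + 1) * a \<le> e" if "a \<ge> 0" for a
        using that \<open>e > 0\<close> by (simp add: field_simps)
      from this[OF V] have "e / (?V + 1) * ?V \<le> e" .
      ultimately show "cmod (\<integral>x. v x * h x \<partial>torus) \<le> 0 + e" by linarith
    qed
  qed
  then show ?thesis by simp
qed

text \<open>
  Bounded measurable functions are limits almost everywhere of uniformly bounded continuous
  functions vanishing at \<open>0\<close> and \<open>2\<pi>\<close>, against which \<open>v\<close> integrates to \<open>0\<close>.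
\<close>

lemma integral_bounded_measurable_eq_0:
  assumes v: "v \<in> L2_torus" and coeff: "\<And>k. fourier_coeff v k = 0"
    and w [measurable]: "w \<in> borel_measurable torus" and bound: "\<And>x. cmod (w x) \<le> M" and "M > 0"
  shows "(\<integral>x. v x * w x \<partial>torus) = 0"
proof -
  have "w measurable_on {0..2 * pi}"
    using w by (subst measurable_on_iff_borel_measurable) auto
  then obtain N g where N: "negligible N" and g: "\<And>n. continuous_on UNIV (g n)"
    "\<And>x. x \<notin> N \<Longrightarrow> (\<lambda>n. g n x) \<longlonglongrightarrow> (if x \<in> {0..2 * pi} then w x else 0)"
    unfolding measurable_on_def by blast
  \<comment> \<open>The radial retraction onto the disc of radius \<open>M\<close>: it makes the
    approximants uniformly bounded and leaves the values of \<open>w\<close> fixed.\<close>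
  define clamp where "clamp = (\<lambda>z :: complex. of_real (M / max M (cmod z)) * z)"
  \<comment> \<open>A cut-off that vanishes at both endpoints, so that \<open>h n\<close> is
    periodic, and equals 1 at each interior point for all large \<open>n\<close>.\<close>
  define \<phi> where "\<phi> n x = max 0 (min 1 (real n * (x * (2 * pi - x))))" for n x
  define h where "h n x = of_real (\<phi> n x) * clamp (g n x)" for n x
  have clamp_cont: "continuous_on UNIV clamp"
    unfolding clamp_def using \<open>M > 0\<close> by (intro continuous_intros) (auto simp: max_def)
  have clamp_bound: "cmod (clamp z) \<le> M" for z
    using \<open>M > 0\<close> by (auto simp: clamp_def norm_mult norm_divide max_def field_simps)
  have clamp_id: "clamp z = z" if "cmod z \<le> M" for z
    using that \<open>M > 0\<close> by (simp add: clamp_def max_def)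
  have h_cont: "continuous_on UNIV (h n)" for n
    unfolding h_def \<phi>_def
    by (intro continuous_intros continuous_on_compose2[OF clamp_cont g(1)]) auto
  have h_bound: "cmod (h n x) \<le> M" for n x
  proof -
    have "\<bar>\<phi> n x\<bar> * cmod (clamp (g n x)) \<le> 1 * M"
      using clamp_bound by (intro mult_mono) (auto simp: \<phi>_def)
    then show ?thesis by (simp add: h_def norm_mult)
  qed
  have "(\<integral>x. v x * h n x \<partial>torus) = 0" for n
    by (rule integral_periodic_eq_0[OF v coeff h_cont]) (simp add: h_def \<phi>_def)
  moreover have "(\<lambda>n. \<integral>x. v x * h n x \<partial>torus) \<longlonglongrightarrow> (\<integral>x. v x * w x \<partial>torus)"
  proof (rule integral_dominated_convergence[where w = "\<lambda>x. M * cmod (v x)"])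
    note [measurable] = L2_torus_measurable[OF v]
    show "(\<lambda>x. v x * w x) \<in> borel_measurable torus" by measurable
    have [measurable]: "h n \<in> borel_measurable torus" for n
      using h_cont by (intro borel_measurable_torus borel_measurable_continuous_onI)
    show "(\<lambda>x. v x * h n x) \<in> borel_measurable torus" for n by measurable
    show "integrable torus (\<lambda>x. M * cmod (v x))" using integrable_L2_torus[OF v] by simp
    show "AE x in torus. norm (v x * h n x) \<le> M * cmod (v x)" for n
      using h_bound by (intro AE_I2) (simp add: norm_mult mult_left_mono mult.commute[of M])
    have "N \<union> {0, 2 * pi} \<in> null_sets lebesgue"
      using N by (simp add: negligible_iff_null_sets[symmetric])
    then have "AE x in lebesgue. x \<notin> N \<union> {0, 2 * pi}" by (rule AE_not_in)
    then have "AE x in torus. x \<notin> N \<union> {0, 2 * pi}"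
      by (subst AE_restrict_space_iff) auto
    then show "AE x in torus. (\<lambda>n. v x * h n x) \<longlonglongrightarrow> v x * w x"
    proof (rule AE_mp[OF _ AE_I2], intro impI)
      fix x assume x: "x \<in> space torus" "x \<notin> N \<union> {0, 2 * pi}"
      then have "x * (2 * pi - x) > 0" by auto
      then obtain m :: nat where m: "1 < real m * (x * (2 * pi - x))" using ex_less_of_nat_mult by blast
      have "\<phi> n x = 1" if "n \<ge> m" for n
      proof -
        have "real m * (x * (2 * pi - x)) \<le> real n * (x * (2 * pi - x))"
          using that \<open>x * (2 * pi - x) > 0\<close> by (intro mult_right_mono) auto
        then show ?thesis using m by (simp add: \<phi>_def)
      qed
      then have "eventually (\<lambda>n. h n x = clamp (g n x)) sequentially"
        by (intro eventually_sequentiallyI[of m]) (simp add: h_def)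
      moreover have "(\<lambda>n. clamp (g n x)) \<longlonglongrightarrow> clamp (w x)"
      proof -
        have "isCont clamp (w x)" using clamp_cont by (simp add: continuous_on_eq_continuous_at)
        moreover have "(\<lambda>n. g n x) \<longlonglongrightarrow> w x" using g(2)[of x] x by simp
        ultimately show ?thesis by (rule isCont_tendsto_compose)
      qed
      ultimately have "(\<lambda>n. h n x) \<longlonglongrightarrow> clamp (w x)"
        by (simp add: tendsto_cong)
      then show "(\<lambda>n. v x * h n x) \<longlonglongrightarrow> v x * w x"
        by (intro tendsto_mult_left) (simp add: clamp_id bound)
    qed
  qed
  ultimately have "(\<lambda>n::nat. 0) \<longlonglongrightarrow> (\<integral>x. v x * w x \<partial>torus)" by simp
  then show ?thesis by (simp add: LIMSEQ_const_iff)
qed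

text \<open>As \<open>v\<close> need not be bounded, the test function is \<open>cnj v\<close> cut
  off where \<open>cmod (v x)\<close> exceeds \<open>Suc M\<close>. The pairing becomes the integral
  of \<open>(cmod (v x))\<^sup>2\<close> over a sublevel set, and these sets exhaust the
  torus.\<close>

theorem fourier_coeff_unique:
  assumes v: "v \<in> L2_torus" and coeff: "\<And>k. fourier_coeff v k = 0"
  shows "AE x in torus. v x = 0"
proof -
  note [measurable] = L2_torus_measurable[OF v]
  have "AE x in torus. cmod (v x) \<le> real (Suc M) \<longrightarrow> v x = 0" for M
  proof -
    define w where "w x = (if cmod (v x) \<le> real (Suc M) then cnj (v x) else 0)" for x
    have [measurable]: "w \<in> borel_measurable torus" unfolding w_def by measurable
    let ?s = "\<lambda>x. if cmod (v x) \<le> real (Suc M) then (cmod (v x))\<^sup>2 else 0"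
    have "(\<integral>x. v x * w x \<partial>torus) = 0"
      by (rule integral_bounded_measurable_eq_0[OF v coeff, where M = "real (Suc M)"]) (auto simp: w_def)
    moreover have "v x * w x = complex_of_real (?s x)" for x
      by (simp add: w_def complex_norm_square del: of_real_power)
    ultimately have "complex_of_real (\<integral>x. ?s x \<partial>torus) = 0"
      by (simp only: integral_complex_of_real[symmetric])
    then have "(\<integral>x. ?s x \<partial>torus) = 0" by (simp only: of_real_eq_0_iff)
    moreover have "integrable torus ?s"
      by (rule Bochner_Integration.integrable_bound[OF L2_torus_integrable[OF v]]) (auto intro!: AE_I2)
    ultimately have "AE x in torus. ?s x = 0"
      by (subst (asm) integral_nonneg_eq_0_iff_AE) auto
    then show ?thesis by (rule AE_mp) (auto intro!: AE_I2)
  qed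
  then have "AE x in torus. \<forall>M. cmod (v x) \<le> real (Suc M) \<longrightarrow> v x = 0"
    by (subst AE_all_countable) blast
  then show ?thesis
  proof (rule AE_mp[OF _ AE_I2], intro impI)
    fix x assume *: "\<forall>M. cmod (v x) \<le> real (Suc M) \<longrightarrow> v x = 0"
    obtain M where "cmod (v x) \<le> real M" using real_arch_simple by blast
    then have "cmod (v x) \<le> real (Suc M)" by simp
    with * show "v x = 0" by blast
  qed
qed

section \<open>The propagator\<close>

lemma propagator_partial_sum_expo:
  "propagator_partial_sum p u0 N t x
    = (\<Sum>k\<in>{- int N..int N}. fourier_coeff u0 k * expo (mode p k) (t, x))"
  by (simp add: propagator_partial_sum_def expo_def cis_conv_exp)

lemma propagator_partial_sum_cis:
  "propagator_partial_sum p u0 N t = (\<lambda>x. \<Sum>k\<in>{- int N..int N}.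
    (fourier_coeff u0 k * cis (of_int (poly p k) * t)) * cis (of_int k * x))"
  by (rule ext) (simp add: propagator_partial_sum_expo expo_def mult_ac flip: cis_mult)

lemma propagator_partial_sum_L2: "propagator_partial_sum p u0 N t \<in> L2_torus"
  unfolding propagator_partial_sum_cis by (rule L2_torus_cis_sum)

text \<open>Integrating the pointwise inequality with factors 2 is enough, because it is applied to
  errors that can be made arbitrarily small.\<close>

lemma L2_norm_squared_triangle:
  assumes "u \<in> L2_torus" "v \<in> L2_torus" "w \<in> L2_torus"
  shows "(L2_norm (\<lambda>x. u x - w x))\<^sup>2 \<le> 2 * (L2_norm (\<lambda>x. u x - v x))\<^sup>2 + 2 * (L2_norm (\<lambda>x. v x - w x))\<^sup>2"
proof -
  let ?f = "\<lambda>u v x. (cmod (u x - v x))\<^sup>2"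
  note int = L2_torus_integrable[OF L2_torus_diff]
  have "integral\<^sup>L torus (?f u w) \<le> (\<integral>x. 2 * ?f u v x + 2 * ?f v w x \<partial>torus)"
  proof (rule integral_mono)
    show "?f u w x \<le> 2 * ?f u v x + 2 * ?f v w x" for x
      using cmod_add_squared_le[of "u x - v x" "v x - w x"] by simp
  qed (use assms int in auto)
  also have "\<dots> = 2 * integral\<^sup>L torus (?f u v) + 2 * integral\<^sup>L torus (?f v w)"
    using assms int by simp
  finally show ?thesis by (simp only: L2_norm_squared)
qed

text \<open>Young's inequality with a free parameter: in its use the norm tends to 0 first, and
  \<open>e\<close> afterwards.\<close>

lemma integral_cmod_le_L2:
  assumes "f \<in> L2_torus" "e > 0"
  shows "(\<integral>x. cmod (f x) \<partial>torus) \<le> 2 * pi * e + (L2_norm f)\<^sup>2 / e"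
proof -
  interpret finite_measure torus by (rule finite_measure_torus)
  have "(\<integral>x. cmod (f x) \<partial>torus) \<le> (\<integral>x. e + (cmod (f x))\<^sup>2 / e \<partial>torus)"
  proof (rule integral_mono)
    show "integrable torus (\<lambda>x. cmod (f x))" using integrable_L2_torus[OF assms(1)] by simp
    show "integrable torus (\<lambda>x. e + (cmod (f x))\<^sup>2 / e)"
      using L2_torus_integrable[OF assms(1)] by simp
    show "cmod (f x) \<le> e + (cmod (f x))\<^sup>2 / e" for x
    proof -
      have "2 * cmod (f x) * e \<le> e\<^sup>2 + (cmod (f x))\<^sup>2"
        using sum_squares_bound[of "cmod (f x)" e] by simp
      moreover have "0 \<le> cmod (f x) * e" using assms(2) by simp
      ultimately have "cmod (f x) * e \<le> e\<^sup>2 + (cmod (f x))\<^sup>2" by linarith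
      then show ?thesis using assms(2) by (simp add: field_simps power2_eq_square)
    qed
  qed
  also have "\<dots> = 2 * pi * e + (L2_norm f)\<^sup>2 / e"
    using L2_torus_integrable[OF assms(1)] by (simp add: measure_torus L2_norm_squared)
  finally show ?thesis .
qed

text \<open>What Bessel's inequality loses at level \<open>N\<close>. Through
  \<open>fourier_pythagoras\<close> it is also the squared error of the partial sum at time 0, and
  up to a factor it bounds the error at all times.\<close>

definition fourier_tail :: "(real \<Rightarrow> complex) \<Rightarrow> nat \<Rightarrow> real" where
  "fourier_tail u N = (L2_norm u)\<^sup>2 - 2 * pi * (\<Sum>k\<in>{- int N..int N}. (cmod (fourier_coeff u k))\<^sup>2)"

lemma fourier_tail_eq:
  assumes "u \<in> L2_torus"
  shows "fourier_tail u N = (L2_norm (\<lambda>x. u x - propagator_partial_sum p u N 0 x))\<^sup>2"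
  using fourier_pythagoras[OF assms, of "{- int N..int N}"]
  by (simp add: fourier_tail_def propagator_partial_sum_cis)

lemma fourier_tail_nonneg: "u \<in> L2_torus \<Longrightarrow> fourier_tail u N \<ge> 0"
  by (simp add: fourier_tail_eq[where p = 0])

lemma fourier_tail_le: "fourier_tail u N \<le> (L2_norm u)\<^sup>2"
  unfolding fourier_tail_def by (simp add: sum_nonneg)

lemma fourier_bessel:
  assumes "u \<in> L2_torus"
  shows "2 * pi * (\<Sum>k\<in>{- int N..int N}. (cmod (fourier_coeff u k))\<^sup>2) \<le> (L2_norm u)\<^sup>2"
  using fourier_tail_nonneg[OF assms, of N] by (simp add: fourier_tail_def)

text \<open>The phases \<open>cis (poly p k * t)\<close> have modulus 1, so the estimate is uniform
  in \<open>t\<close>.\<close>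

lemma propagator_partial_sum_diff_le:
  assumes u0: "u0 \<in> L2_torus" and "N \<le> M"
  shows "(L2_norm (\<lambda>x. propagator_partial_sum p u0 M t x - propagator_partial_sum p u0 N t x))\<^sup>2
    \<le> fourier_tail u0 N"
proof -
  let ?I = "\<lambda>N. {- int N..int N}" and ?s = "\<lambda>I. \<Sum>k\<in>I. (cmod (fourier_coeff u0 k))\<^sup>2"
  have sub: "?I N \<subseteq> ?I M" using \<open>N \<le> M\<close> by auto
  have diff: "propagator_partial_sum p u0 M t x - propagator_partial_sum p u0 N t x
      = (\<Sum>k\<in>?I M - ?I N. (fourier_coeff u0 k * cis (of_int (poly p k) * t)) * cis (of_int k * x))" for x
    unfolding propagator_partial_sum_cis using sub by (subst sum_diff) auto
  have "(L2_norm (\<lambda>x. propagator_partial_sum p u0 M t x - propagator_partial_sum p u0 N t x))\<^sup>2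
      = 2 * pi * (\<Sum>k\<in>?I M - ?I N. (cmod (fourier_coeff u0 k * cis (of_int (poly p k) * t)))\<^sup>2)"
    unfolding diff by (rule L2_norm_cis_sum) simp
  also have "\<dots> = 2 * pi * (?s (?I M) - ?s (?I N))"
    using sub by (simp add: norm_mult sum_diff)
  also have "\<dots> \<le> fourier_tail u0 N"
    using fourier_bessel[OF u0, of M] by (simp add: fourier_tail_def right_diff_distrib)
  finally show ?thesis .
qed

section \<open>Versions of the propagator and Parseval's identity\<close>

context
  fixes p :: "int poly" and T :: real and u0 :: "real \<Rightarrow> complex" and u :: "real \<Rightarrow> real \<Rightarrow> complex"
  assumes u0: "u0 \<in> L2_torus" and propagator: "is_propagator p T u0 u"
begin

lemma propagator_L2: "t \<in> {0..T} \<Longrightarrow> u t \<in> L2_torus"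
  using propagator by (auto simp: is_propagator_def)

lemma propagator_tendsto:
  assumes "t \<in> {0..T}"
  shows "(\<lambda>N. (L2_norm (\<lambda>x. u t x - propagator_partial_sum p u0 N t x))\<^sup>2) \<longlonglongrightarrow> 0"
proof -
  have "(\<lambda>N. L2_norm (\<lambda>x. u t x - propagator_partial_sum p u0 N t x)) \<longlonglongrightarrow> 0"
    using propagator assms by (auto simp: is_propagator_def)
  from tendsto_power[OF this, of 2] show ?thesis by simp
qed

text \<open>The hypothesis gives convergence for each \<open>t\<close> without a rate. Comparing
  with the partial sum of order \<open>M\<close> and letting \<open>M\<close> grow gives a bound
  uniform in \<open>t\<close>, as integration in time requires.\<close>

lemma propagator_error_le:
  assumes t: "t \<in> {0..T}"
  shows "(L2_norm (\<lambda>x. u t x - propagator_partial_sum p u0 N t x))\<^sup>2 \<le> 2 * fourier_tail u0 N"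
proof -
  let ?W = "\<lambda>N. propagator_partial_sum p u0 N t"
  let ?r = "\<lambda>M. 2 * (L2_norm (\<lambda>x. u t x - ?W M x))\<^sup>2 + 2 * fourier_tail u0 N"
  have "?r \<longlonglongrightarrow> 2 * 0 + 2 * fourier_tail u0 N"
    by (intro tendsto_intros propagator_tendsto t)
  moreover have "(L2_norm (\<lambda>x. u t x - ?W N x))\<^sup>2 \<le> ?r M" if "N \<le> M" for M
  proof -
    have "(L2_norm (\<lambda>x. u t x - ?W N x))\<^sup>2
      \<le> 2 * (L2_norm (\<lambda>x. u t x - ?W M x))\<^sup>2 + 2 * (L2_norm (\<lambda>x. ?W M x - ?W N x))\<^sup>2"
      by (intro L2_norm_squared_triangle propagator_L2 t propagator_partial_sum_L2)
    then show ?thesis using propagator_partial_sum_diff_le[OF u0 that, of p t] by linarith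
  qed
  ultimately show ?thesis by (intro LIMSEQ_le_const[of ?r]) auto
qed

lemma fourier_coeff_partial_sum_diff:
  assumes "\<bar>k\<bar> \<le> int M"
  shows "(\<integral>x. (u0 x - propagator_partial_sum p u0 M 0 x) * cnj (cis (of_int k * x)) \<partial>torus) = 0"
proof -
  let ?I = "{- int M..int M}"
  have e: "cis (of_int l * x) * cnj (cis (of_int k * x)) = cis (of_int (l - k) * x)" for l and x :: real
    by (simp add: cis_cnj cis_mult left_diff_distrib)
  have "(\<integral>x. propagator_partial_sum p u0 M 0 x * cnj (cis (of_int k * x)) \<partial>torus)
      = (\<integral>x. (\<Sum>l\<in>?I. fourier_coeff u0 l * (cis (of_int l * x) * cnj (cis (of_int k * x)))) \<partial>torus)"
    by (simp add: propagator_partial_sum_cis sum_distrib_right mult.assoc)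
  also have "\<dots> = (\<Sum>l\<in>?I. fourier_coeff u0 l * (\<integral>x. cis (of_int l * x) * cnj (cis (of_int k * x)) \<partial>torus))"
    using L2_torus_product[OF cis_L2_torus cis_L2_torus]
    by (subst Bochner_Integration.integral_sum) auto
  also have "\<dots> = (\<Sum>l\<in>?I. if l = k then fourier_coeff u0 l * of_real (2 * pi) else 0)"
    unfolding e integral_cis_torus by (intro sum.cong refl) simp
  also have "\<dots> = of_real (2 * pi) * fourier_coeff u0 k"
    using assms by (subst sum.delta) auto
  finally have "(\<integral>x. propagator_partial_sum p u0 M 0 x * cnj (cis (of_int k * x)) \<partial>torus)
      = (\<integral>x. u0 x * cnj (cis (of_int k * x)) \<partial>torus)"
    by (simp only: fourier_coeff_cis)
  then show ?thesis
    using L2_torus_product[OF u0 cis_L2_torus] L2_torus_product[OF propagator_partial_sum_L2 cis_L2_torus]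
    by (simp add: left_diff_distrib)
qed

text \<open>Here completeness enters. At time 0 the hypothesis says that the Fourier partial sums of
  \<open>u0\<close> converge to \<open>u 0\<close>, not that the limit is \<open>u0\<close>. It
  follows that all Fourier coefficients of the difference vanish, and
  \<open>fourier_coeff_unique\<close> applies.\<close>

lemma propagator_initial:
  assumes "T \<ge> 0"
  shows "AE x in torus. u0 x - u 0 x = 0"
proof (rule fourier_coeff_unique)
  have 0: "0 \<in> {0..T}" using assms by simp
  note uL = propagator_L2[OF 0]
  show "(\<lambda>x. u0 x - u 0 x) \<in> L2_torus" by (rule L2_torus_diff[OF u0 uL])
  fix k
  let ?J = "\<integral>x. (u0 x - u 0 x) * cnj (cis (of_int k * x)) \<partial>torus"
  let ?W = "\<lambda>M. propagator_partial_sum p u0 M 0"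
  \<comment> \<open>For such \<open>M\<close> the difference \<open>u0 - ?W M\<close> is orthogonal
    to mode \<open>k\<close>, so only \<open>u 0 - ?W M\<close> contributes, and its norm tends to
    0.\<close>
  have bound: "cmod ?J \<le> 2 * pi * e + (L2_norm (\<lambda>x. u 0 x - ?W M x))\<^sup>2 / e"
    if e: "e > 0" and M: "\<bar>k\<bar> \<le> int M" for e M
  proof -
    note D = L2_torus_diff[OF u0 propagator_partial_sum_L2, THEN L2_torus_product, OF cis_L2_torus]
      L2_torus_diff[OF uL propagator_partial_sum_L2, THEN L2_torus_product, OF cis_L2_torus]
    have "?J = (\<integral>x. (u0 x - ?W M x) * cnj (cis (of_int k * x)) - (u 0 x - ?W M x) * cnj (cis (of_int k * x)) \<partial>torus)"
      by (simp add: algebra_simps)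
    also have "\<dots> = (\<integral>x. (u0 x - ?W M x) * cnj (cis (of_int k * x)) \<partial>torus)
        - (\<integral>x. (u 0 x - ?W M x) * cnj (cis (of_int k * x)) \<partial>torus)"
      by (rule Bochner_Integration.integral_diff[OF D])
    also have "\<dots> = - (\<integral>x. (u 0 x - ?W M x) * cnj (cis (of_int k * x)) \<partial>torus)"
      by (simp add: fourier_coeff_partial_sum_diff[OF M])
    finally have "cmod ?J = cmod (\<integral>x. (u 0 x - ?W M x) * cnj (cis (of_int k * x)) \<partial>torus)"
      by (simp only: norm_minus_cancel)
    also have "\<dots> \<le> (\<integral>x. cmod ((u 0 x - ?W M x) * cnj (cis (of_int k * x))) \<partial>torus)"
      by (rule integral_norm_bound)
    also have "\<dots> = (\<integral>x. cmod (u 0 x - ?W M x) \<partial>torus)" by (simp add: norm_mult)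
    also have "\<dots> \<le> 2 * pi * e + (L2_norm (\<lambda>x. u 0 x - ?W M x))\<^sup>2 / e"
      by (rule integral_cmod_le_L2[OF L2_torus_diff[OF uL propagator_partial_sum_L2] e])
    finally show ?thesis .
  qed
  have "cmod ?J \<le> 2 * pi * e" if e: "e > 0" for e
  proof (rule LIMSEQ_le_const)
    have "(\<lambda>M. 2 * pi * e + (L2_norm (\<lambda>x. u 0 x - ?W M x))\<^sup>2 / e) \<longlonglongrightarrow> 2 * pi * e + 0 / e"
      using e by (intro tendsto_intros propagator_tendsto 0) auto
    then show "(\<lambda>M. 2 * pi * e + (L2_norm (\<lambda>x. u 0 x - ?W M x))\<^sup>2 / e) \<longlonglongrightarrow> 2 * pi * e" by simp
    show "\<exists>N. \<forall>M\<ge>N. cmod ?J \<le> 2 * pi * e + (L2_norm (\<lambda>x. u 0 x - ?W M x))\<^sup>2 / e"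
      using bound[OF e] by (intro exI[of _ "nat \<bar>k\<bar>"]) auto
  qed
  from this[of "\<epsilon> / (2 * pi)" for \<epsilon>] have "cmod ?J \<le> 0 + \<epsilon>" if "\<epsilon> > 0" for \<epsilon>
    using that by simp
  then have "cmod ?J \<le> 0" by (rule field_le_epsilon)
  then have "of_real (2 * pi) * fourier_coeff (\<lambda>x. u0 x - u 0 x) k = 0"
    unfolding fourier_coeff_cis by simp
  then show "fourier_coeff (\<lambda>x. u0 x - u 0 x) k = 0" by simp
qed

text \<open>Parseval's identity: in \<open>fourier_tail_eq\<close> the function \<open>u0\<close>
  may be replaced by \<open>u 0\<close>, to which the partial sums converge by hypothesis.\<close>

lemma fourier_tail_tendsto_0:
  assumes "T \<ge> 0"
  shows "fourier_tail u0 \<longlonglongrightarrow> 0"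
proof -
  have 0: "0 \<in> {0..T}" using assms by simp
  have "fourier_tail u0 N = (L2_norm (\<lambda>x. u 0 x - propagator_partial_sum p u0 N 0 x))\<^sup>2" for N
    unfolding fourier_tail_eq[OF u0, where p = p] L2_norm_squared
  proof (rule integral_cong_AE)
    have [measurable]: "u0 \<in> borel_measurable torus" "u 0 \<in> borel_measurable torus"
      "propagator_partial_sum p u0 N 0 \<in> borel_measurable torus"
      using u0 propagator_L2[OF 0] propagator_partial_sum_L2 by (auto intro: L2_torus_measurable)
    show "(\<lambda>x. (cmod (u0 x - propagator_partial_sum p u0 N 0 x))\<^sup>2) \<in> borel_measurable torus"
      "(\<lambda>x. (cmod (u 0 x - propagator_partial_sum p u0 N 0 x))\<^sup>2) \<in> borel_measurable torus"
      by measurable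
    show "AE x in torus. (cmod (u0 x - propagator_partial_sum p u0 N 0 x))\<^sup>2
        = (cmod (u 0 x - propagator_partial_sum p u0 N 0 x))\<^sup>2"
      using propagator_initial[OF assms] by (rule AE_mp) (auto intro!: AE_I2)
  qed
  then show ?thesis using propagator_tendsto[OF 0] by presburger
qed

end

section \<open>Space-time weights\<close>

text \<open>In its uses \<open>A\<close> is an essential supremum as a function of \<open>x\<close>,
  or an integral involving \<open>u\<close> as a function of \<open>t\<close>, whose measurability
  is not established. Hence the constant is pulled out of an integral of the measurable
  \<open>g\<close>.\<close>

lemma nn_integral_le_cmult:
  assumes [measurable]: "g \<in> borel_measurable M" and "c \<ge> 0" and le: "AE x in M. g x \<le> ennreal c * A x"
  shows "(\<integral>\<^sup>+x. g x \<partial>M) \<le> ennreal c * (\<integral>\<^sup>+x. A x \<partial>M)"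
proof (cases "c = 0")
  case True
  then have "AE x in M. g x = 0" using le by auto
  then have "(\<integral>\<^sup>+x. g x \<partial>M) = 0" by (subst nn_integral_0_iff_AE) auto
  then show ?thesis by simp
next
  case False
  then have c: "c > 0" using \<open>c \<ge> 0\<close> by simp
  have inv: "ennreal c * (ennreal (1 / c) * y) = y" "ennreal (1 / c) * (ennreal c * y) = y" for y
    using c by (simp_all add: mult.assoc[symmetric] ennreal_mult[symmetric])
  have "(\<integral>\<^sup>+x. g x \<partial>M) = (\<integral>\<^sup>+x. ennreal c * (ennreal (1 / c) * g x) \<partial>M)" by (simp only: inv)
  also have "\<dots> = ennreal c * (\<integral>\<^sup>+x. ennreal (1 / c) * g x \<partial>M)" by (rule nn_integral_cmult) measurable
  also have "\<dots> \<le> ennreal c * (\<integral>\<^sup>+x. A x \<partial>M)"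
  proof (intro mult_left_mono nn_integral_mono_AE)
    show "AE x in M. ennreal (1 / c) * g x \<le> A x"
      using le
    proof (rule AE_mp[OF _ AE_I2], intro impI)
      fix x assume "g x \<le> ennreal c * A x"
      then have "ennreal (1 / c) * g x \<le> ennreal (1 / c) * (ennreal c * A x)" by (rule mult_left_mono) simp
      then show "ennreal (1 / c) * g x \<le> A x" by (simp only: inv)
    qed
  qed simp
  finally show ?thesis .
qed

lemma AE_lebesgue_on_iff:
  fixes S :: "'a::euclidean_space set"
  assumes "S \<in> sets borel"
  shows "(AE x in lebesgue_on S. P x) \<longleftrightarrow> (AE x in lborel. x \<in> S \<longrightarrow> P x)"
  using assms by (subst AE_restrict_space_iff) (auto simp: AE_completion_iff)

lemma nn_integral_lebesgue_on:
  fixes S :: "'a::euclidean_space set"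
  assumes "S \<in> sets borel"
  shows "(\<integral>\<^sup>+x. f x \<partial>lebesgue_on S) = (\<integral>\<^sup>+x. f x * indicator S x \<partial>lborel)"
  using assms by (simp add: nn_integral_restrict_space nn_integral_completion)

text \<open>The weight \<open>a\<close> is only Lebesgue measurable, while the Fubini arguments use
  a Borel function on the plane. Agreement is recorded in both orders: almost every \<open>t\<close>
  first matches \<open>weighted_integral\<close>, almost every \<open>x\<close> first matches the
  essential supremum in the norm.\<close>

lemma borel_weight:
  fixes a :: "real \<Rightarrow> real \<Rightarrow> complex"
  assumes a: "(\<lambda>(t, x). a t x) \<in> borel_measurable (lebesgue_on ({0..T} \<times> {0..2 * pi}))"
  obtains b :: "real \<times> real \<Rightarrow> ennreal" where "b \<in> borel_measurable borel"
    "\<And>z. z \<notin> {0..T} \<times> {0..2 * pi} \<Longrightarrow> b z = 0"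
    "AE t in lborel. AE x in lborel. (t, x) \<in> {0..T} \<times> {0..2 * pi} \<longrightarrow> b (t, x) = ennreal (cmod (a t x))"
    "AE x in lborel. AE t in lborel. (t, x) \<in> {0..T} \<times> {0..2 * pi} \<longrightarrow> b (t, x) = ennreal (cmod (a t x))"
proof -
  let ?R = "{0..T} \<times> {0..2 * pi}"
  have R: "?R \<in> sets borel" by (simp add: borel_closed closed_Times)
  define f where "f z = (if z \<in> ?R then ennreal (cmod (a (fst z) (snd z))) else 0)" for z
  have "(\<lambda>z. ennreal (cmod (a (fst z) (snd z)))) \<in> borel_measurable (lebesgue_on ?R)"
    using a by (simp add: case_prod_unfold)
  then have "f \<in> borel_measurable lebesgue"
    unfolding f_def using R by (intro measurable_If_restrict_space_iff[THEN iffD2] conjI) auto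
  then obtain g where g: "g \<in> borel_measurable lborel" "AE z in lborel. f z = g z"
    using completion_ex_borel_measurable by blast
  obtain N where N: "N \<in> null_sets lborel" "\<And>z. z \<notin> N \<Longrightarrow> f z = g z"
    using g(2) by (auto elim!: AE_E3)
  define b where "b z = g z * indicator ?R z" for z
  have ae: "AE z in (lborel \<Otimes>\<^sub>M lborel). z \<notin> N"
    unfolding lborel_prod by (rule AE_not_in[OF N(1)])
  have tx: "AE t in lborel. AE x in lborel. (t, x) \<notin> N"
    using lborel_pair.AE_pair[OF ae] .
  have "{z \<in> space (lborel \<Otimes>\<^sub>M lborel). (fst z, snd z) \<notin> N} \<in> sets (lborel \<Otimes>\<^sub>M lborel)"
    using N(1) unfolding lborel_prod by (auto intro!: borel_comp simp: Compl_eq[symmetric])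
  then have xt: "AE x in lborel. AE t in lborel. (t, x) \<notin> N"
    using tx by (subst lborel_pair.AE_commute[symmetric]) auto
  have b_eq: "z \<in> ?R \<longrightarrow> b z = ennreal (cmod (a (fst z) (snd z)))" if "z \<notin> N" for z
    using N(2)[OF that] by (auto simp: b_def f_def)
  show thesis
  proof (rule that[of b])
    have "?R \<in> sets lborel" using R by simp
    then show "b \<in> borel_measurable borel" unfolding b_def using g(1) by measurable
    show "b z = 0" if "z \<notin> ?R" for z using that by (simp add: b_def)
    show "AE t in lborel. AE x in lborel. (t, x) \<in> ?R \<longrightarrow> b (t, x) = ennreal (cmod (a t x))"
      using tx
    proof eventually_elim
      case (elim t)
      then show ?case
      proof eventually_elim
        case (elim x)
        then show ?case using b_eq[of "(t, x)"] by simp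
      qed
    qed
    show "AE x in lborel. AE t in lborel. (t, x) \<in> ?R \<longrightarrow> b (t, x) = ennreal (cmod (a t x))"
      using xt
    proof eventually_elim
      case (elim x)
      then show ?case
      proof eventually_elim
        case (elim t)
        then show ?case using b_eq[of "(t, x)"] by simp
      qed
    qed
  qed
qed

lemma weighted_integral_eq:
  assumes b0: "\<And>z. z \<notin> {0..T} \<times> {0..2 * pi} \<Longrightarrow> b z = 0"
    and b: "AE t in lborel. AE x in lborel. (t, x) \<in> {0..T} \<times> {0..2 * pi} \<longrightarrow> b (t, x) = ennreal (cmod (a t x))"
  shows "weighted_integral T a u = (\<integral>\<^sup>+t. (\<integral>\<^sup>+x. b (t, x) * ennreal ((cmod (u t x))\<^sup>2) \<partial>torus) \<partial>lborel)"
proof -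
  have "weighted_integral T a u = (\<integral>\<^sup>+t. (\<integral>\<^sup>+x. ennreal (cmod (a t x) * (cmod (u t x))\<^sup>2) \<partial>torus) * indicator {0..T} t \<partial>lborel)"
    unfolding weighted_integral_def by (rule nn_integral_lebesgue_on) simp
  also have "\<dots> = (\<integral>\<^sup>+t. (\<integral>\<^sup>+x. b (t, x) * ennreal ((cmod (u t x))\<^sup>2) \<partial>torus) \<partial>lborel)"
  proof (rule nn_integral_cong_AE, use b in \<open>rule AE_mp\<close>, intro AE_I2 impI)
    fix t assume t: "AE x in lborel. (t, x) \<in> {0..T} \<times> {0..2 * pi} \<longrightarrow> b (t, x) = ennreal (cmod (a t x))"
    show "(\<integral>\<^sup>+x. ennreal (cmod (a t x) * (cmod (u t x))\<^sup>2) \<partial>torus) * indicator {0..T} t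
      = (\<integral>\<^sup>+x. b (t, x) * ennreal ((cmod (u t x))\<^sup>2) \<partial>torus)"
    proof (cases "t \<in> {0..T}")
      case True
      have "(\<integral>\<^sup>+x. ennreal (cmod (a t x) * (cmod (u t x))\<^sup>2) \<partial>torus)
        = (\<integral>\<^sup>+x. b (t, x) * ennreal ((cmod (u t x))\<^sup>2) \<partial>torus)"
      proof (rule nn_integral_cong_AE)
        show "AE x in torus. ennreal (cmod (a t x) * (cmod (u t x))\<^sup>2) = b (t, x) * ennreal ((cmod (u t x))\<^sup>2)"
          unfolding AE_lebesgue_on_iff[OF atLeastAtMost_borel]
          using t by (rule AE_mp) (use True in \<open>auto intro!: AE_I2 simp: ennreal_mult\<close>)
      qed
      then show ?thesis using True by simp
    next
      case False
      then have "b (t, x) = 0" for x by (intro b0) auto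
      with False show ?thesis by simp
    qed
  qed
  finally show ?thesis .
qed

lemma nn_integral_L2_norm:
  assumes "v \<in> L2_torus"
  shows "(\<integral>\<^sup>+x. ennreal ((cmod (v x))\<^sup>2) \<partial>torus) = ennreal ((L2_norm v)\<^sup>2)"
  unfolding L2_norm_squared by (rule nn_integral_eq_integral[OF L2_torus_integrable[OF assms]]) simp

lemma ennreal_cmod_squared_le:
  "ennreal ((cmod z)\<^sup>2) \<le> 2 * ennreal ((cmod w)\<^sup>2) + 2 * ennreal ((cmod (z - w))\<^sup>2)"
proof -
  have "ennreal ((cmod z)\<^sup>2) \<le> ennreal (2 * (cmod w)\<^sup>2 + 2 * (cmod (z - w))\<^sup>2)"
    using cmod_add_squared_le[of w "z - w"] by (intro ennreal_leI) simp
  also have "\<dots> = 2 * ennreal ((cmod w)\<^sup>2) + 2 * ennreal ((cmod (z - w))\<^sup>2)"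
    by (simp add: ennreal_mult)
  finally show ?thesis .
qed

lemma nn_integral_truncation:
  fixes g :: "'a \<Rightarrow> ennreal"
  assumes [measurable]: "g \<in> borel_measurable M" "w \<in> borel_measurable M"
  shows "(\<integral>\<^sup>+x. g x * w x \<partial>M) = (SUP m. \<integral>\<^sup>+x. min (g x) (of_nat m) * w x \<partial>M)"
    and "incseq (\<lambda>m. \<integral>\<^sup>+x. min (g x) (of_nat m) * w x \<partial>M)"
proof -
  have inc: "min (g x) (of_nat m) * w x \<le> min (g x) (of_nat n) * w x" if "m \<le> n" for m n x
    using that by (intro mult_right_mono min.mono) auto
  then show "incseq (\<lambda>m. \<integral>\<^sup>+x. min (g x) (of_nat m) * w x \<partial>M)"
    by (intro monoI nn_integral_mono)
  have "(SUP m. min (g x) (of_nat m)) = g x" for x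
  proof -
    have "(SUP m. min (g x) (of_nat m)) = inf (g x) (SUP m. of_nat m)"
      unfolding inf_SUP by (simp add: inf_min)
    then show ?thesis by (simp add: ennreal_SUP_of_nat_eq_top)
  qed
  then have "g x * w x = (SUP m. min (g x) (of_nat m) * w x)" for x
    by (simp add: SUP_mult_right_ennreal[symmetric])
  then show "(\<integral>\<^sup>+x. g x * w x \<partial>M) = (SUP m. \<integral>\<^sup>+x. min (g x) (of_nat m) * w x \<partial>M)"
    using inc by (simp add: nn_integral_monotone_convergence_SUP[symmetric] incseq_def le_fun_def)
qed

lemma propagator_partial_sum_borel [measurable]:
  "(\<lambda>z. propagator_partial_sum p u0 N (fst z) (snd z)) \<in> borel_measurable borel"
  unfolding propagator_partial_sum_expo by simp

text \<open>Here \<open>b\<close> is a Borel representative of \<open>cmod a\<close>, extended by 0.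
  The order of the two almost-everywhere quantifiers in \<open>b_xt\<close> is the one that links
  \<open>b\<close> to the norm of \<open>a\<close>; both bounds are then proved for
  \<open>b\<close>.\<close>

locale space_time_weight =
  fixes T :: real and a :: "real \<Rightarrow> real \<Rightarrow> complex" and b :: "real \<times> real \<Rightarrow> ennreal"
  assumes b_meas [measurable]: "b \<in> borel_measurable borel"
    and b0: "\<And>z. z \<notin> {0..T} \<times> {0..2 * pi} \<Longrightarrow> b z = 0"
    and b_xt: "AE x in lborel. AE t in lborel. (t, x) \<in> {0..T} \<times> {0..2 * pi} \<longrightarrow> b (t, x) = ennreal (cmod (a t x))"
    and T: "T > 0"
begin

lemma weight_le_esssup:
  "AE x in lborel. AE t in lborel. b (t, x) \<le>
    esssup (lebesgue_on {0..T}) (\<lambda>t. ennreal (cmod (a t x))) * indicator {0..2 * pi} x"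
  using b_xt
proof eventually_elim
  case (elim x)
  have "AE t in lborel. t \<in> {0..T} \<longrightarrow> ennreal (cmod (a t x)) \<le> esssup (lebesgue_on {0..T}) (\<lambda>t. ennreal (cmod (a t x)))"
    using esssup_AE[where M = "lebesgue_on {0..T}" and f = "\<lambda>t. ennreal (cmod (a t x))"]
    by (simp only: AE_lebesgue_on_iff[OF atLeastAtMost_borel])
  with elim show ?case
  proof eventually_elim
    case (elim t)
    then show ?case using b0[of "(t, x)"] by (cases "(t, x) \<in> {0..T} \<times> {0..2 * pi}") auto
  qed
qed

lemma weight_eq_0_imp_norm_eq_0:
  assumes "AE z in lborel. b z = 0"
  shows "L1_Linf_norm T a = 0"
proof -
  have ae: "AE z in (lborel \<Otimes>\<^sub>M lborel). b z = 0" unfolding lborel_prod by (rule assms)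
  have tx: "AE t in lborel. AE x in lborel. b (t, x) = 0"
    using lborel_pair.AE_pair[OF ae] .
  have "{z \<in> space (lborel \<Otimes>\<^sub>M lborel). b (fst z, snd z) = 0} \<in> sets (lborel \<Otimes>\<^sub>M lborel)"
    unfolding lborel_prod by simp
  then have "AE x in lborel. AE t in lborel. b (t, x) = 0"
    using tx by (subst lborel_pair.AE_commute[symmetric]) auto
  with b_xt have "AE x in lborel. x \<in> {0..2 * pi} \<longrightarrow> esssup (lebesgue_on {0..T}) (\<lambda>t. ennreal (cmod (a t x))) = 0"
  proof eventually_elim
    case (elim x)
    show ?case
    proof
      assume x: "x \<in> {0..2 * pi}"
      let ?f = "\<lambda>t. ennreal (cmod (a t x))"
      from elim have "AE t in lborel. t \<in> {0..T} \<longrightarrow> ?f t = 0"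
        by eventually_elim (use x in auto)
      then have zero: "AE t in lebesgue_on {0..T}. ?f t = 0"
        by (simp only: AE_lebesgue_on_iff[OF atLeastAtMost_borel])
      \<comment> \<open>The essential supremum of a nonmeasurable function is \<open>top\<close> by
        convention, so measurability of the slice has to be shown. It holds by completeness of
        Lebesgue measure, as the slice vanishes almost everywhere.\<close>
      have "?f \<in> borel_measurable (lebesgue_on {0..T})"
      proof -
        define g where "g t = (if t \<in> {0..T} then cmod (a t x) else 0)" for t
        have "AE t in lborel. 0 = g t"
          using \<open>AE t in lborel. t \<in> {0..T} \<longrightarrow> ?f t = 0\<close> by eventually_elim (simp add: g_def)
        then have "AE t in lebesgue. 0 = g t" by (rule AE_completion)
        then have "g \<in> borel_measurable lebesgue"
          by (rule borel_measurable_AE[where f = "\<lambda>_. 0", OF borel_measurable_const])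
        then have "(\<lambda>t. ennreal (g t)) \<in> borel_measurable (lebesgue_on {0..T})"
          by (intro measurable_compose[OF _ measurable_ennreal] measurable_restrict_space1)
        then show ?thesis by (subst measurable_cong[of _ _ "\<lambda>t. ennreal (g t)"]) (auto simp: g_def)
      qed
      then have "esssup (lebesgue_on {0..T}) ?f \<le> 0"
        using zero by (intro esssup_I) auto
      then show "esssup (lebesgue_on {0..T}) ?f = 0" by simp
    qed
  qed
  then have "AE x in torus. esssup (lebesgue_on {0..T}) (\<lambda>t. ennreal (cmod (a t x))) = 0"
    by (simp only: AE_lebesgue_on_iff[OF atLeastAtMost_borel])
  then have "L1_Linf_norm T a = (\<integral>\<^sup>+x. 0 \<partial>torus)"
    unfolding L1_Linf_norm_def by (intro nn_integral_cong_AE) auto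
  then show ?thesis by simp
qed

lemma borel_measurable_weight_product:
  assumes [measurable]: "g \<in> borel_measurable borel"
  shows "(\<lambda>(t, x). b (t, x) * ennreal (g (t, x)) * indicator {0..2 * pi} x) \<in> borel_measurable (lborel \<Otimes>\<^sub>M lborel)"
proof -
  have [measurable]: "(\<lambda>z :: real \<times> real. snd z) \<in> borel_measurable borel"
    by (intro borel_measurable_continuous_onI continuous_intros)
  have "(\<lambda>z. b z * ennreal (g z) * indicator {0..2 * pi} (snd z)) \<in> borel_measurable (lborel \<Otimes>\<^sub>M lborel)"
    unfolding lborel_prod by measurable
  then show ?thesis by (simp add: case_prod_beta)
qed

lemma borel_measurable_weight_integral:
  assumes "g \<in> borel_measurable borel"
  shows "(\<lambda>t. \<integral>\<^sup>+x. b (t, x) * ennreal (g (t, x)) \<partial>torus) \<in> borel_measurable borel"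
  using lborel.borel_measurable_nn_integral[OF borel_measurable_weight_product[OF assms]]
  by (simp add: nn_integral_torus)

text \<open>Fubini puts the time integral inside. For fixed \<open>x\<close> the weight is replaced
  by its essential supremum in time, and \<open>time_integral_le\<close> bounds the rest over
  \<open>n\<close> whole periods covering \<open>{0..T}\<close>.\<close>

lemma weighted_partial_sum_le:
  fixes p :: "int poly" and c :: "int \<Rightarrow> complex"
  assumes p: "degree p > 0" and I: "finite I" and n: "T \<le> 2 * pi * real n"
  shows "(\<integral>\<^sup>+t. (\<integral>\<^sup>+x. b (t, x) * ennreal ((cmod (\<Sum>k\<in>I. c k * expo (mode p k) (t, x)))\<^sup>2) \<partial>torus) \<partial>lborel)
    \<le> ennreal (2 * pi * real n * real (degree p) * (\<Sum>k\<in>I. (cmod (c k))\<^sup>2)) * L1_Linf_norm T a"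
proof -
  define w where "w z = (cmod (\<Sum>k\<in>I. c k * expo (mode p k) z))\<^sup>2" for z
  let ?K = "2 * pi * real n * real (degree p) * (\<Sum>k\<in>I. (cmod (c k))\<^sup>2)"
  let ?A = "\<lambda>x. esssup (lebesgue_on {0..T}) (\<lambda>t. ennreal (cmod (a t x)))"
  have w_meas [measurable]: "w \<in> borel_measurable borel" unfolding w_def by measurable
  have time: "(\<integral>\<^sup>+t. ennreal (w (t, x)) * indicator {0..2 * pi * real n} t \<partial>lborel) \<le> ennreal ?K" for x
  proof -
    have "(\<integral>\<^sup>+t. ennreal (w (t, x)) * indicator {0..2 * pi * real n} t \<partial>lborel)
      = (\<integral>\<^sup>+t. ennreal (indicator {0..2 * pi * real n} t *\<^sub>R w (t, x)) \<partial>lborel)"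
      by (intro nn_integral_cong) (auto simp: indicator_def)
    also have "\<dots> = ennreal (LINT t:{0..2 * pi * real n}|lborel. w (t, x))"
      using time_integral_le(2)[OF p I] unfolding set_lebesgue_integral_def w_def set_integrable_def
      by (intro nn_integral_eq_integral AE_I2) auto
    also have "\<dots> \<le> ennreal ?K"
      unfolding w_def by (intro ennreal_leI time_integral_le(1)[OF p I])
    finally show ?thesis .
  qed
  note F = borel_measurable_weight_product[OF w_meas]
  have "(\<integral>\<^sup>+t. (\<integral>\<^sup>+x. b (t, x) * ennreal (w (t, x)) \<partial>torus) \<partial>lborel)
      = (\<integral>\<^sup>+x. (\<integral>\<^sup>+t. b (t, x) * ennreal (w (t, x)) * indicator {0..2 * pi} x \<partial>lborel) \<partial>lborel)"
    unfolding nn_integral_torus by (rule lborel_pair.Fubini'[symmetric, OF F])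
  also have "\<dots> \<le> ennreal ?K * (\<integral>\<^sup>+x. ?A x * indicator {0..2 * pi} x \<partial>lborel)"
  proof (rule nn_integral_le_cmult)
    have "case_prod (\<lambda>x t. b (t, x) * ennreal (w (t, x)) * indicator {0..2 * pi} x) \<in> borel_measurable (lborel \<Otimes>\<^sub>M lborel)"
    proof -
      have [measurable]: "(\<lambda>z :: real \<times> real. fst z) \<in> borel_measurable borel"
        and swap: "(\<lambda>z :: real \<times> real. (snd z, fst z)) \<in> borel_measurable borel"
        by (intro borel_measurable_continuous_onI continuous_intros)+
      note [measurable] = measurable_compose[OF swap b_meas] measurable_compose[OF swap w_meas]
      have "(\<lambda>z. b (snd z, fst z) * ennreal (w (snd z, fst z)) * indicator {0..2 * pi} (fst z)) \<in> borel_measurable (lborel \<Otimes>\<^sub>M lborel)"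
        unfolding lborel_prod by measurable
      then show ?thesis by (simp add: case_prod_beta)
    qed
    then show "(\<lambda>x. \<integral>\<^sup>+t. b (t, x) * ennreal (w (t, x)) * indicator {0..2 * pi} x \<partial>lborel) \<in> borel_measurable lborel"
      by (rule lborel.borel_measurable_nn_integral)
    show "?K \<ge> 0" by (simp add: sum_nonneg)
    show "AE x in lborel. (\<integral>\<^sup>+t. b (t, x) * ennreal (w (t, x)) * indicator {0..2 * pi} x \<partial>lborel)
        \<le> ennreal ?K * (?A x * indicator {0..2 * pi} x)"
      using weight_le_esssup
    proof eventually_elim
      case (elim x)
      let ?a = "?A x * indicator {0..2 * pi} x"
      have "(\<integral>\<^sup>+t. b (t, x) * ennreal (w (t, x)) * indicator {0..2 * pi} x \<partial>lborel)
        \<le> (\<integral>\<^sup>+t. ?a * (ennreal (w (t, x)) * indicator {0..2 * pi * real n} t) \<partial>lborel)"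
      proof (rule nn_integral_mono_AE, use elim in eventually_elim)
        case (elim t)
        show ?case
        proof (cases "t \<in> {0..T}")
          case True
          then have "t \<in> {0..2 * pi * real n}" using n by auto
          then have "b (t, x) * ennreal (w (t, x)) \<le> ?a * (ennreal (w (t, x)) * indicator {0..2 * pi * real n} t)"
            using elim by (simp add: mult_right_mono)
          then show ?thesis by (cases "x \<in> {0..2 * pi}") auto
        next
          case False
          then have "b (t, x) = 0" by (intro b0) auto
          then show ?thesis by simp
        qed
      qed
      also have "\<dots> = ?a * (\<integral>\<^sup>+t. ennreal (w (t, x)) * indicator {0..2 * pi * real n} t \<partial>lborel)"
        by (rule nn_integral_cmult) measurable
      also have "\<dots> \<le> ?a * ennreal ?K" by (intro mult_left_mono time) simp
      finally show ?case by (simp only: mult.commute)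
    qed
  qed
  also have "(\<integral>\<^sup>+x. ?A x * indicator {0..2 * pi} x \<partial>lborel) = L1_Linf_norm T a"
    unfolding L1_Linf_norm_def by (rule nn_integral_torus[symmetric])
  finally show ?thesis by (simp only: w_def)
qed

text \<open>
  The weight is truncated at height \<open>m\<close> in order to use convergence in \<open>L\<^sup>2\<close> for fixed \<open>t\<close>; the
  number of modes is then chosen depending on \<open>m\<close>, and Fatou's lemma in \<open>t\<close> avoids any joint
  measurability of \<open>u\<close>.
\<close>

lemma weighted_integral_le:
  fixes p :: "int poly"
  assumes p: "degree p > 0" and n: "T \<le> 2 * pi * real n"
    and l: "L1_Linf_norm T a = ennreal l" "l \<ge> 0"
    and u0: "u0 \<in> L2_torus" and propagator: "is_propagator p T u0 u"
  shows "(\<integral>\<^sup>+t. (\<integral>\<^sup>+x. b (t, x) * ennreal ((cmod (u t x))\<^sup>2) \<partial>torus) \<partial>lborel)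
    \<le> ennreal ((2 * real n * real (degree p) * l + T) * (L2_norm u0)\<^sup>2)"
proof -
  let ?M = "(L2_norm u0)\<^sup>2" and ?K = "2 * pi * real n * real (degree p)"
  let ?W = "propagator_partial_sum p u0"
  define f where "f N t = (\<integral>\<^sup>+x. b (t, x) * ennreal ((cmod (?W N t x))\<^sup>2) \<partial>torus)" for N t
  have f_meas [measurable]: "f N \<in> borel_measurable borel" for N
    unfolding f_def
    using borel_measurable_weight_integral[of "\<lambda>z. (cmod (?W N (fst z) (snd z)))\<^sup>2"] by simp
  \<comment> \<open>The 4 combines the 2 of \<open>ennreal_cmod_squared_le\<close> with the 2 of
    \<open>propagator_error_le\<close>; \<open>m\<close> is the truncation height. If
    \<open>?M = 0\<close>, the tail is not positive and \<open>N = 0\<close> works.\<close>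
  have "\<exists>N. 4 * real m * fourier_tail u0 N \<le> ?M" for m
  proof (cases "?M = 0")
    case True
    then show ?thesis using fourier_tail_le[of u0 0] by (intro exI[of _ 0]) (simp add: mult_nonneg_nonpos)
  next
    case False
    then have "?M > 0" by simp
    have "(\<lambda>N. 4 * real m * fourier_tail u0 N) \<longlonglongrightarrow> 4 * real m * 0"
      using T by (intro tendsto_intros fourier_tail_tendsto_0[OF u0 propagator]) simp
    then have "\<forall>\<^sub>F N in sequentially. 4 * real m * fourier_tail u0 N < ?M"
      using \<open>?M > 0\<close> by (intro order_tendstoD(2)) auto
    then show ?thesis by (meson eventually_sequentially less_imp_le order_refl)
  qed
  then obtain N where N: "\<And>m. 4 * real m * fourier_tail u0 (N m) \<le> ?M" by metis
  \<comment> \<open>A majorant built from partial sums, hence measurable in \<open>t\<close>, as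
    Fatou's lemma requires.\<close>
  define h where "h m t = (2 * f (N m) t + ennreal ?M) * indicator {0..T} t" for m t
  have h_meas [measurable]: "h m \<in> borel_measurable lborel" for m unfolding h_def by measurable
  have trunc: "(\<integral>\<^sup>+x. min (b (t, x)) (of_nat m) * ennreal ((cmod (u t x))\<^sup>2) \<partial>torus) \<le> h m t"
    if t: "t \<in> {0..T}" for t m
  proof -
    let ?e = "\<lambda>x. u t x - ?W (N m) t x"
    have eL: "?e \<in> L2_torus"
      by (intro L2_torus_diff propagator_L2[OF u0 propagator t] propagator_partial_sum_L2)
    note [measurable] = L2_torus_measurable[OF eL]
    have WL [measurable]: "?W (N m) t \<in> borel_measurable torus"
      by (rule L2_torus_measurable[OF propagator_partial_sum_L2])
    have [measurable]: "(\<lambda>x. b (t, x)) \<in> borel_measurable torus"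
      by (rule borel_measurable_torus) measurable
    have "(\<integral>\<^sup>+x. min (b (t, x)) (of_nat m) * ennreal ((cmod (u t x))\<^sup>2) \<partial>torus)
      \<le> (\<integral>\<^sup>+x. 2 * (b (t, x) * ennreal ((cmod (?W (N m) t x))\<^sup>2)) + (2 * of_nat m) * ennreal ((cmod (?e x))\<^sup>2) \<partial>torus)"
    proof (rule nn_integral_mono)
      fix x
      let ?y = "ennreal ((cmod (?W (N m) t x))\<^sup>2)" and ?z = "ennreal ((cmod (?e x))\<^sup>2)"
      have "min (b (t, x)) (of_nat m) * ennreal ((cmod (u t x))\<^sup>2) \<le> min (b (t, x)) (of_nat m) * (2 * ?y + 2 * ?z)"
        by (intro mult_left_mono ennreal_cmod_squared_le) simp
      also have "\<dots> = 2 * (min (b (t, x)) (of_nat m) * ?y) + 2 * (min (b (t, x)) (of_nat m) * ?z)"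
        by (simp add: distrib_left mult_ac)
      also have "\<dots> \<le> 2 * (b (t, x) * ?y) + 2 * (of_nat m * ?z)"
        by (intro add_mono mult_left_mono mult_right_mono) auto
      finally show "min (b (t, x)) (of_nat m) * ennreal ((cmod (u t x))\<^sup>2) \<le> 2 * (b (t, x) * ?y) + (2 * of_nat m) * ?z"
        by (simp only: mult.assoc)
    qed
    also have "\<dots> = 2 * f (N m) t + (2 * of_nat m) * (\<integral>\<^sup>+x. ennreal ((cmod (?e x))\<^sup>2) \<partial>torus)"
      unfolding f_def by (subst nn_integral_add) (auto simp: nn_integral_cmult)
    also have "\<dots> \<le> 2 * f (N m) t + ennreal ?M"
    proof (intro add_left_mono)
      have "(2 * of_nat m) * (\<integral>\<^sup>+x. ennreal ((cmod (?e x))\<^sup>2) \<partial>torus) = ennreal (2 * real m * (L2_norm ?e)\<^sup>2)"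
        by (simp add: nn_integral_L2_norm[OF eL] ennreal_mult ennreal_of_nat_eq_real_of_nat)
      also have "\<dots> \<le> ennreal (2 * real m * (2 * fourier_tail u0 (N m)))"
        by (intro ennreal_leI mult_left_mono propagator_error_le[OF u0 propagator t]) auto
      also have "\<dots> \<le> ennreal ?M" using N[of m] by (intro ennreal_leI) simp
      finally show "(2 * of_nat m) * (\<integral>\<^sup>+x. ennreal ((cmod (?e x))\<^sup>2) \<partial>torus) \<le> ennreal ?M" .
    qed
    finally show ?thesis using t by (simp add: h_def)
  qed
  have pointwise: "(\<integral>\<^sup>+x. b (t, x) * ennreal ((cmod (u t x))\<^sup>2) \<partial>torus) \<le> liminf (\<lambda>m. h m t)" for t
  proof (cases "t \<in> {0..T}")
    case True
    let ?F = "\<lambda>m. \<integral>\<^sup>+x. min (b (t, x)) (of_nat m) * ennreal ((cmod (u t x))\<^sup>2) \<partial>torus"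
    have [measurable]: "(\<lambda>x. b (t, x)) \<in> borel_measurable torus"
      by (rule borel_measurable_torus) measurable
    have [measurable]: "u t \<in> borel_measurable torus"
      by (rule L2_torus_measurable[OF propagator_L2[OF u0 propagator True]])
    have meas: "(\<lambda>x. ennreal ((cmod (u t x))\<^sup>2)) \<in> borel_measurable torus" by measurable
    note tr = nn_integral_truncation[OF \<open>(\<lambda>x. b (t, x)) \<in> borel_measurable torus\<close> meas]
    have "?F \<longlonglongrightarrow> (SUP m. ?F m)" using tr(2) by (rule LIMSEQ_SUP)
    then have "(SUP m. ?F m) = liminf ?F" by (simp add: lim_imp_Liminf)
    also have "\<dots> \<le> liminf (\<lambda>m. h m t)"
      using trunc[OF True] by (intro Liminf_mono always_eventually allI)
    finally show ?thesis unfolding tr(1) .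
  next
    case False
    then have "b (t, x) = 0" for x by (intro b0) auto
    then show ?thesis by simp
  qed
  have "(\<integral>\<^sup>+t. h m t \<partial>lborel) \<le> ennreal ((2 * real n * real (degree p) * l + T) * ?M)" for m
  proof -
    \<comment> \<open>The \<open>2 * pi\<close> in \<open>?K\<close> is absorbed by Bessel's
      inequality, which leaves \<open>real n * real (degree p) * l\<close>; the summand
      \<open>T\<close> comes from integrating the error \<open>?M\<close> over
      \<open>{0..T}\<close>.\<close>
    let ?S = "\<Sum>k\<in>{- int (N m)..int (N m)}. (cmod (fourier_coeff u0 k))\<^sup>2"
    have "(\<integral>\<^sup>+t. h m t \<partial>lborel) \<le> (\<integral>\<^sup>+t. 2 * f (N m) t + ennreal ?M * indicator {0..T} t \<partial>lborel)"
      unfolding h_def by (intro nn_integral_mono) (auto simp: indicator_def)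
    also have "\<dots> = 2 * (\<integral>\<^sup>+t. f (N m) t \<partial>lborel) + ennreal ?M * ennreal T"
      using T by (simp add: nn_integral_add nn_integral_cmult nn_integral_cmult_indicator)
    also have "(\<integral>\<^sup>+t. f (N m) t \<partial>lborel) \<le> ennreal (?K * ?S) * L1_Linf_norm T a"
      unfolding f_def propagator_partial_sum_expo
      by (rule weighted_partial_sum_le[OF p _ n]) simp
    also have "ennreal (?K * ?S) * L1_Linf_norm T a = ennreal (?K * ?S * l)"
      unfolding l(1) using l(2) by (simp add: ennreal_mult sum_nonneg)
    also have "\<dots> \<le> ennreal (real n * real (degree p) * l * ?M)"
    proof (rule ennreal_leI)
      have "?K * ?S * l = (real n * real (degree p) * l) * (2 * pi * ?S)" by (simp add: mult_ac)
      also have "\<dots> \<le> (real n * real (degree p) * l) * ?M"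
        using l(2) by (intro mult_left_mono fourier_bessel[OF u0]) simp
      finally show "?K * ?S * l \<le> real n * real (degree p) * l * ?M" .
    qed
    also have "2 * ennreal (real n * real (degree p) * l * ?M) + ennreal ?M * ennreal T
        = ennreal (2 * (real n * real (degree p) * l * ?M) + ?M * T)"
      using l(2) T by (simp add: ennreal_mult)
    also have "2 * (real n * real (degree p) * l * ?M) + ?M * T = (2 * real n * real (degree p) * l + T) * ?M"
      by (simp add: algebra_simps)
    finally show ?thesis by (simp add: add_right_mono mult_left_mono)
  qed
  then have "liminf (\<lambda>m. \<integral>\<^sup>+t. h m t \<partial>lborel) \<le> ennreal ((2 * real n * real (degree p) * l + T) * ?M)"
    by (intro order_trans[OF Liminf_le_Limsup Limsup_bounded]) auto
  moreover have "(\<integral>\<^sup>+t. (\<integral>\<^sup>+x. b (t, x) * ennreal ((cmod (u t x))\<^sup>2) \<partial>torus) \<partial>lborel)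
      \<le> (\<integral>\<^sup>+t. liminf (\<lambda>m. h m t) \<partial>lborel)"
    by (intro nn_integral_mono pointwise)
  moreover have "(\<integral>\<^sup>+t. liminf (\<lambda>m. h m t) \<partial>lborel) \<le> liminf (\<lambda>m. \<integral>\<^sup>+t. h m t \<partial>lborel)"
    by (rule nn_integral_liminf) measurable
  ultimately show ?thesis by (meson order_trans)
qed

text \<open>Observability is applied to the partial sums on \<open>E\<close>, where \<open>b\<close>
  is at least \<open>\<eta>\<close>. Replacing them by \<open>u\<close> costs a multiple of the
  Fourier tail, uniformly in time, and the tail tends to 0.\<close>

lemma weighted_integral_ge:
  fixes p :: "int poly" and \<tau> :: real
  assumes p: "degree p \<ge> 2"
    and E: "E \<in> sets borel" "E \<subseteq> {\<tau>..\<tau> + 2 * pi} \<times> {0..2 * pi}" and pos: "measure lborel E > 0"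
    and \<eta>: "\<eta> > 0" "\<And>z. z \<in> E \<Longrightarrow> ennreal \<eta> \<le> b z"
  obtains C where "C > 0"
    "\<And>u0 u. u0 \<in> L2_torus \<Longrightarrow> is_propagator p T u0 u \<Longrightarrow>
      ennreal ((L2_norm u0)\<^sup>2) \<le> ennreal C * (\<integral>\<^sup>+t. (\<integral>\<^sup>+x. b (t, x) * ennreal ((cmod (u t x))\<^sup>2) \<partial>torus) \<partial>lborel)"
proof -
  obtain C0 where C0: "C0 > 0"
    "\<And>I c. finite I \<Longrightarrow> (\<Sum>k\<in>I. (cmod (c k))\<^sup>2) \<le> C0 * energy E (mode p) I c"
    using trigonometric_observability[OF p E pos] by blast
  have [measurable]: "E \<in> sets borel" by (rule E(1))
  have finE: "fin_meas E" using fin_meas_subset[OF fin_meas_box E] .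
  have ER: "z \<in> {0..T} \<times> {0..2 * pi}" if "z \<in> E" for z
  proof (rule ccontr)
    assume "z \<notin> {0..T} \<times> {0..2 * pi}"
    then have "b z = 0" by (rule b0)
    with \<eta>(1) \<eta>(2)[OF that] show False by simp
  qed
  show thesis
  proof (rule that)
    \<comment> \<open>Here \<open>2 * pi\<close> is the normalisation in Parseval's identity,
      \<open>C0\<close> the observability constant, and \<open>2 / \<eta>\<close> pays for passing
      from the partial sum to \<open>u\<close> and from the indicator of \<open>E\<close> to
      \<open>b\<close>.\<close>
    show "2 * pi * C0 * (2 / \<eta>) > 0" using C0(1) \<eta>(1) by simp
    fix u0 :: "real \<Rightarrow> complex" and u
    assume u0: "u0 \<in> L2_torus" and propagator: "is_propagator p T u0 u"
    let ?W = "propagator_partial_sum p u0" and ?\<rho> = "fourier_tail u0"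
    define f where "f t = (\<integral>\<^sup>+x. b (t, x) * ennreal ((cmod (u t x))\<^sup>2) \<partial>torus)" for t
    let ?F = "\<integral>\<^sup>+t. f t \<partial>lborel"
    have bound: "ennreal ((L2_norm u0)\<^sup>2) \<le> ennreal (2 * pi * C0 * (2 / \<eta>)) * ?F
        + ennreal ((2 * pi * C0 * (4 * T) + 1) * ?\<rho> N)" for N
    proof -
      let ?I = "{- int N..int N}" and ?c = "fourier_coeff u0"
      have \<rho>: "?\<rho> N \<ge> 0" by (rule fourier_tail_nonneg[OF u0])
      define e where "e t = (\<integral>\<^sup>+x. indicator E (t, x) * ennreal ((cmod (?W N t x))\<^sup>2) \<partial>torus)" for t
      have "(\<lambda>z. indicator E z * ennreal ((cmod (?W N (fst z) (snd z)))\<^sup>2)) \<in> borel_measurable (lborel \<Otimes>\<^sub>M lborel)"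
        unfolding lborel_prod by measurable
      then have em: "(\<lambda>(t, x). indicator E (t, x) * ennreal ((cmod (?W N t x))\<^sup>2)) \<in> borel_measurable (lborel \<Otimes>\<^sub>M lborel)"
        by (simp add: case_prod_unfold)
      have e_eq: "e t = (\<integral>\<^sup>+x. indicator E (t, x) * ennreal ((cmod (?W N t x))\<^sup>2) \<partial>lborel)" for t
        unfolding e_def nn_integral_torus using ER by (intro nn_integral_cong) (auto simp: indicator_def)
      have e_meas [measurable]: "e \<in> borel_measurable lborel"
        unfolding e_eq by (rule lborel.borel_measurable_nn_integral[OF em])
      have "(\<integral>\<^sup>+t. e t \<partial>lborel)
          = (\<integral>\<^sup>+z. indicator E z * ennreal ((cmod (?W N (fst z) (snd z)))\<^sup>2) \<partial>lborel)"
        unfolding e_eq using lborel.nn_integral_fst[OF em] by (simp add: lborel_prod case_prod_unfold)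
      also have "\<dots> = (\<integral>\<^sup>+z. ennreal (indicator E z *\<^sub>R (cmod (\<Sum>k\<in>?I. ?c k * expo (mode p k) z))\<^sup>2) \<partial>lborel)"
        unfolding propagator_partial_sum_expo by (intro nn_integral_cong) (auto simp: indicator_def)
      also have "\<dots> = ennreal (energy E (mode p) ?I ?c)"
        unfolding energy_def set_lebesgue_integral_def
        using set_integrable_energy[OF finE, of ?c "mode p" ?I]
        by (intro nn_integral_eq_integral) (auto simp: set_integrable_def)
      finally have energy: "(\<integral>\<^sup>+t. e t \<partial>lborel) = ennreal (energy E (mode p) ?I ?c)" .
      have e_le: "e t \<le> ennreal (4 * ?\<rho> N) * indicator {0..T} t + ennreal (2 / \<eta>) * f t" for t
      proof (cases "t \<in> {0..T}")
        case True
        let ?e = "\<lambda>x. u t x - ?W N t x"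
        have uL: "u t \<in> L2_torus" by (rule propagator_L2[OF u0 propagator True])
        have eL: "?e \<in> L2_torus" by (intro L2_torus_diff uL propagator_partial_sum_L2)
        note [measurable] = L2_torus_measurable[OF eL] L2_torus_measurable[OF uL]
        have [measurable]: "(\<lambda>x. b (t, x)) \<in> borel_measurable torus"
          by (rule borel_measurable_torus) measurable
        have "e t \<le> (\<integral>\<^sup>+x. 2 * ennreal ((cmod (?e x))\<^sup>2) + ennreal (2 / \<eta>) * (b (t, x) * ennreal ((cmod (u t x))\<^sup>2)) \<partial>torus)"
          unfolding e_def
        proof (rule nn_integral_mono)
          fix x
          let ?y = "ennreal ((cmod (u t x))\<^sup>2)" and ?z = "ennreal ((cmod (?e x))\<^sup>2)"
          show "indicator E (t, x) * ennreal ((cmod (?W N t x))\<^sup>2) \<le> 2 * ?z + ennreal (2 / \<eta>) * (b (t, x) * ?y)"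
          proof (cases "(t, x) \<in> E")
            case True
            have "ennreal (2 / \<eta>) * ennreal \<eta> = 2"
              using \<eta>(1) by (simp add: ennreal_mult[symmetric])
            then have "2 * ?y = ennreal (2 / \<eta>) * (ennreal \<eta> * ?y)"
              by (simp only: mult.assoc[symmetric])
            also have "\<dots> \<le> ennreal (2 / \<eta>) * (b (t, x) * ?y)"
              by (intro mult_left_mono mult_right_mono \<eta>(2) True) auto
            finally have "2 * ?y \<le> ennreal (2 / \<eta>) * (b (t, x) * ?y)" .
            moreover have "ennreal ((cmod (?W N t x))\<^sup>2) \<le> 2 * ?y + 2 * ?z"
              using ennreal_cmod_squared_le[of "?W N t x" "u t x"] by (simp add: norm_minus_commute)
            ultimately have "ennreal ((cmod (?W N t x))\<^sup>2) \<le> ennreal (2 / \<eta>) * (b (t, x) * ?y) + 2 * ?z"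
              by (meson add_right_mono order_trans)
            then show ?thesis using True by (simp add: add.commute)
          qed simp
        qed
        also have "\<dots> = 2 * (\<integral>\<^sup>+x. ennreal ((cmod (?e x))\<^sup>2) \<partial>torus) + ennreal (2 / \<eta>) * f t"
          unfolding f_def by (subst nn_integral_add) (auto simp: nn_integral_cmult)
        also have "2 * (\<integral>\<^sup>+x. ennreal ((cmod (?e x))\<^sup>2) \<partial>torus) = ennreal (2 * (L2_norm ?e)\<^sup>2)"
          by (simp add: nn_integral_L2_norm[OF eL] ennreal_mult)
        also have "\<dots> \<le> ennreal (4 * ?\<rho> N)"
          using propagator_error_le[OF u0 propagator True, of N] by (intro ennreal_leI) simp
        finally show ?thesis using True by simp
      next
        case False
        then have "(t, x) \<notin> E" for x using ER by auto
        then show ?thesis by (simp add: e_def)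
      qed
      \<comment> \<open>The error is moved to the side of the measurable \<open>e\<close>, since
        additivity of the integral is not at hand for \<open>f\<close>, which involves
        \<open>u\<close>. Truncated subtraction still leaves \<open>e\<close> below \<open>g\<close>
        plus the error.\<close>
      define g where "g t = e t - ennreal (4 * ?\<rho> N) * indicator {0..T} t" for t
      have [measurable]: "g \<in> borel_measurable lborel" unfolding g_def by measurable
      have "(\<integral>\<^sup>+t. g t \<partial>lborel) \<le> ennreal (2 / \<eta>) * ?F"
      proof (rule nn_integral_le_cmult)
        show "AE t in lborel. g t \<le> ennreal (2 / \<eta>) * f t"
          unfolding g_def using e_le
          by (intro AE_I2) (auto simp: ennreal_minus_le_iff indicator_def)
      qed (use \<eta>(1) in auto)
      have "ennreal (energy E (mode p) ?I ?c) \<le> (\<integral>\<^sup>+t. g t + ennreal (4 * ?\<rho> N) * indicator {0..T} t \<partial>lborel)"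
        unfolding energy[symmetric] g_def
        by (intro nn_integral_mono) (metis add.commute ennreal_minus_le_iff order_refl)
      also have "\<dots> = (\<integral>\<^sup>+t. g t \<partial>lborel) + ennreal (4 * ?\<rho> N) * ennreal T"
        using T by (simp add: nn_integral_add nn_integral_cmult_indicator)
      also have "\<dots> \<le> ennreal (2 / \<eta>) * ?F + ennreal (4 * ?\<rho> N) * ennreal T"
        by (intro add_right_mono) fact
      finally have en: "ennreal (energy E (mode p) ?I ?c) \<le> ennreal (2 / \<eta>) * ?F + ennreal (4 * ?\<rho> N * T)"
        using \<rho> T by (simp add: ennreal_mult)
      have "(L2_norm u0)\<^sup>2 = 2 * pi * (\<Sum>k\<in>?I. (cmod (?c k))\<^sup>2) + ?\<rho> N"
        by (simp add: fourier_tail_def)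
      also have "\<dots> \<le> 2 * pi * (C0 * energy E (mode p) ?I ?c) + ?\<rho> N"
        using C0(2)[of ?I ?c] by simp
      finally have "ennreal ((L2_norm u0)\<^sup>2) \<le> ennreal (2 * pi * (C0 * energy E (mode p) ?I ?c) + ?\<rho> N)"
        by (rule ennreal_leI)
      also have "\<dots> = ennreal (2 * pi * C0) * ennreal (energy E (mode p) ?I ?c) + ennreal (?\<rho> N)"
        using C0(1) \<rho> energy_nonneg[of E "mode p" ?I ?c]
        by (simp add: ennreal_plus ennreal_mult[symmetric] mult.assoc)
      also have "\<dots> \<le> ennreal (2 * pi * C0) * (ennreal (2 / \<eta>) * ?F + ennreal (4 * ?\<rho> N * T)) + ennreal (?\<rho> N)"
        by (intro add_right_mono mult_left_mono en) simp
      also have "\<dots> = ennreal (2 * pi * C0 * (2 / \<eta>)) * ?F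
          + (ennreal (2 * pi * C0 * (4 * ?\<rho> N * T)) + ennreal (?\<rho> N))"
      proof -
        have "ennreal (2 * pi * C0 * (2 / \<eta>)) = ennreal (2 * pi * C0) * ennreal (2 / \<eta>)"
          "ennreal (2 * pi * C0 * (4 * ?\<rho> N * T)) = ennreal (2 * pi * C0) * ennreal (4 * ?\<rho> N * T)"
          using C0(1) \<eta>(1) \<rho> T by (intro ennreal_mult; simp)+
        then show ?thesis by (simp only: distrib_left mult.assoc add.assoc)
      qed
      also have "ennreal (2 * pi * C0 * (4 * ?\<rho> N * T)) + ennreal (?\<rho> N) = ennreal ((2 * pi * C0 * (4 * T) + 1) * ?\<rho> N)"
        using C0(1) \<rho> T by (subst ennreal_plus[symmetric]) (auto simp: algebra_simps)
      finally show ?thesis .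
    qed
    have "(\<lambda>N. ennreal ((2 * pi * C0 * (4 * T) + 1) * ?\<rho> N)) \<longlonglongrightarrow> ennreal ((2 * pi * C0 * (4 * T) + 1) * 0)"
      using T by (intro tendsto_ennrealI tendsto_intros fourier_tail_tendsto_0[OF u0 propagator]) simp
    then have "(\<lambda>N. ennreal (2 * pi * C0 * (2 / \<eta>)) * ?F + ennreal ((2 * pi * C0 * (4 * T) + 1) * ?\<rho> N))
        \<longlonglongrightarrow> ennreal (2 * pi * C0 * (2 / \<eta>)) * ?F + 0"
      by (intro tendsto_add tendsto_const) simp
    then have "ennreal ((L2_norm u0)\<^sup>2) \<le> ennreal (2 * pi * C0 * (2 / \<eta>)) * ?F + 0"
      by (rule LIMSEQ_le_const) (use bound in blast)
    then show "ennreal ((L2_norm u0)\<^sup>2) \<le> ennreal (2 * pi * C0 * (2 / \<eta>))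
        * (\<integral>\<^sup>+t. (\<integral>\<^sup>+x. b (t, x) * ennreal ((cmod (u t x))\<^sup>2) \<partial>torus) \<partial>lborel)"
      by (simp add: f_def)
  qed
qed

text \<open>The countably many sets \<open>S m j\<close> exhaust the set where \<open>b\<close> is
  positive; were they all null, \<open>b\<close> would vanish almost everywhere and the norm of
  \<open>a\<close> with it. The cut into time strips of length \<open>2 * pi\<close> puts
  \<open>E\<close> within one period, as observability requires.\<close>

lemma weight_superlevel_set:
  assumes "L1_Linf_norm T a > 0"
  obtains E \<tau> \<eta> where "E \<in> sets borel" "E \<subseteq> {\<tau>..\<tau> + 2 * pi} \<times> {0..2 * pi}" "measure lborel E > 0"
    "\<eta> > 0" "\<And>z. z \<in> E \<Longrightarrow> ennreal \<eta> \<le> b z"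
proof -
  define S where "S m j = {z. ennreal (1 / real (Suc m)) < b z}
    \<inter> ({2 * pi * real j..2 * pi * real j + 2 * pi} \<times> {0..2 * pi})" for m j :: nat
  have S: "S m j \<in> sets borel" for m j
    unfolding S_def by (intro sets.Int) (measurable, simp add: borel_closed closed_Times)
  have "\<exists>m j. emeasure lborel (S m j) \<noteq> 0"
  proof (rule ccontr)
    assume "\<not> ?thesis"
    then have "S m j \<in> null_sets lborel" for m j using S by auto
    then have "AE z in lborel. \<forall>m j. z \<notin> S m j"
      unfolding AE_all_countable by (intro allI AE_not_in)
    then have "AE z in lborel. b z = 0"
    proof eventually_elim
      case (elim z)
      show ?case
      proof (rule ccontr)
        assume nz: "b z \<noteq> 0"
        then have z: "z \<in> {0..T} \<times> {0..2 * pi}" using b0 by blast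
        obtain r where r: "0 < r" "ennreal r < b z"
        proof -
          from nz have "0 < b z" by (simp add: zero_less_iff_neq_zero)
          then obtain y where y: "0 < y" "y < b z" using dense by blast
          then have "y \<noteq> top" by auto
          then obtain r where "y = ennreal r" "r \<ge> 0" by (cases y) auto
          with y show thesis by (intro that[of r]) (auto simp: less_le)
        qed
        obtain m where m: "1 / real (Suc m) < r"
          using reals_Archimedean[OF r(1)] by (auto simp: inverse_eq_divide)
        define j where "j = nat \<lfloor>fst z / (2 * pi)\<rfloor>"
        have "real j = of_int \<lfloor>fst z / (2 * pi)\<rfloor>" using z by (auto simp: j_def)
        then have "real j \<le> fst z / (2 * pi)" "fst z / (2 * pi) \<le> real j + 1" by linarith+
        then have "2 * pi * real j \<le> fst z" "fst z \<le> 2 * pi * real j + 2 * pi"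
          by (simp_all add: field_simps)
        moreover have "ennreal (1 / real (Suc m)) < b z"
          using m r by (meson ennreal_leI less_imp_le order_le_less_trans)
        ultimately have "z \<in> S m j" using z by (auto simp: S_def)
        with elim show False by blast
      qed
    qed
    from weight_eq_0_imp_norm_eq_0[OF this] assms show False by simp
  qed
  then obtain m j where mj: "emeasure lborel (S m j) \<noteq> 0" by blast
  have sub: "S m j \<subseteq> {2 * pi * real j..2 * pi * real j + 2 * pi} \<times> {0..2 * pi}" by (auto simp: S_def)
  have "emeasure lborel (S m j) < \<infinity>"
    using fin_meas_subset[OF fin_meas_box S sub] by (simp only: fin_meas_def)
  then have "emeasure lborel (S m j) = ennreal (measure lborel (S m j))"
    by (intro emeasure_eq_ennreal_measure) auto
  with mj have "measure lborel (S m j) \<noteq> 0" by auto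
  then have "measure lborel (S m j) > 0" using zero_less_measure_iff by blast
  show thesis
  proof (rule that[OF S sub \<open>measure lborel (S m j) > 0\<close>])
    show "1 / real (Suc m) > 0" by simp
    fix z assume "z \<in> S m j"
    then have "ennreal (1 / real (Suc m)) < b z" unfolding S_def by blast
    then show "ennreal (1 / real (Suc m)) \<le> b z" by (rule less_imp_le)
  qed
qed

end

theorem theorem1p3:
  fixes p :: "int poly" and T :: real and a :: "real \<Rightarrow> real \<Rightarrow> complex"
  assumes "lead_coeff p = 1"
    and "degree p \<ge> 2"
    and "T > 0"
    and "a \<in> L1_Linf T"
  shows "(\<exists>C::real. C > 0 \<and>
            (\<forall>u0\<in>L2_torus. \<forall>u. is_propagator p T u0 u \<longrightarrow>
               weighted_integral T a u \<le> ennreal (C * (L2_norm u0)\<^sup>2))) \<and>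
         (L1_Linf_norm T a > 0 \<longrightarrow>
          (\<exists>C'::real. C' > 0 \<and>
            (\<forall>u0\<in>L2_torus. \<forall>u. is_propagator p T u0 u \<longrightarrow>
               ennreal ((L2_norm u0)\<^sup>2) \<le> ennreal C' * weighted_integral T a u)))"
proof -
  have a: "(\<lambda>(t, x). a t x) \<in> borel_measurable (lebesgue_on ({0..T} \<times> {0..2 * pi}))"
    and norm: "L1_Linf_norm T a < \<infinity>"
    using assms(4) by (auto simp: L1_Linf_def)
  obtain b where b: "b \<in> borel_measurable borel" "\<And>z. z \<notin> {0..T} \<times> {0..2 * pi} \<Longrightarrow> b z = 0"
    "AE t in lborel. AE x in lborel. (t, x) \<in> {0..T} \<times> {0..2 * pi} \<longrightarrow> b (t, x) = ennreal (cmod (a t x))"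
    "AE x in lborel. AE t in lborel. (t, x) \<in> {0..T} \<times> {0..2 * pi} \<longrightarrow> b (t, x) = ennreal (cmod (a t x))"
    using borel_weight[OF a] by blast
  interpret space_time_weight T a b
    using b(1,2,4) assms(3) by unfold_locales
  have weighted: "weighted_integral T a u = (\<integral>\<^sup>+t. (\<integral>\<^sup>+x. b (t, x) * ennreal ((cmod (u t x))\<^sup>2) \<partial>torus) \<partial>lborel)" for u
    by (rule weighted_integral_eq[OF b(2,3)])
  obtain n :: nat where "T / (2 * pi) \<le> real n" using real_arch_simple by blast
  then have n: "T \<le> 2 * pi * real n" by (simp add: field_simps)
  obtain l where l: "L1_Linf_norm T a = ennreal l" "l \<ge> 0"
    using norm by (cases "L1_Linf_norm T a") auto
  show ?thesis
  proof (intro conjI impI)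
    show "\<exists>C>0. \<forall>u0\<in>L2_torus. \<forall>u. is_propagator p T u0 u \<longrightarrow>
        weighted_integral T a u \<le> ennreal (C * (L2_norm u0)\<^sup>2)"
    proof (intro exI[of _ "2 * real n * real (degree p) * l + T"] conjI ballI allI impI)
      \<comment> \<open>The summand \<open>T\<close> keeps the constant positive even if the norm of
        \<open>a\<close> is 0.\<close>
      show "2 * real n * real (degree p) * l + T > 0"
        using l(2) T by (intro add_nonneg_pos) auto
    next
      fix u0 u assume "u0 \<in> L2_torus" "is_propagator p T u0 u"
      then show "weighted_integral T a u \<le> ennreal ((2 * real n * real (degree p) * l + T) * (L2_norm u0)\<^sup>2)"
        unfolding weighted using weighted_integral_le[OF _ n l] assms(2) by simp
    qed
  next
    assume "L1_Linf_norm T a > 0"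
    then obtain E \<tau> \<eta> where E: "E \<in> sets borel" "E \<subseteq> {\<tau>..\<tau> + 2 * pi} \<times> {0..2 * pi}"
      "measure lborel E > 0" "\<eta> > 0" "\<And>z. z \<in> E \<Longrightarrow> ennreal \<eta> \<le> b z"
      using weight_superlevel_set by blast
    obtain C' where C': "C' > 0"
      "\<And>u0 u. u0 \<in> L2_torus \<Longrightarrow> is_propagator p T u0 u \<Longrightarrow>
        ennreal ((L2_norm u0)\<^sup>2) \<le> ennreal C' * (\<integral>\<^sup>+t. (\<integral>\<^sup>+x. b (t, x) * ennreal ((cmod (u t x))\<^sup>2) \<partial>torus) \<partial>lborel)"
    proof (rule weighted_integral_ge[OF assms(2) E])
      fix C assume "C > 0" "\<And>u0 u. u0 \<in> L2_torus \<Longrightarrow> is_propagator p T u0 u \<Longrightarrow>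
        ennreal ((L2_norm u0)\<^sup>2) \<le> ennreal C * (\<integral>\<^sup>+t. (\<integral>\<^sup>+x. b (t, x) * ennreal ((cmod (u t x))\<^sup>2) \<partial>torus) \<partial>lborel)"
      then show thesis by (rule that)
    qed
    show "\<exists>C'>0. \<forall>u0\<in>L2_torus. \<forall>u. is_propagator p T u0 u \<longrightarrow>
        ennreal ((L2_norm u0)\<^sup>2) \<le> ennreal C' * weighted_integral T a u"
      unfolding weighted using C' by (intro exI[of _ C'] conjI ballI allI impI)
  qed
qed

end
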